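(* Let $d=1$, fix $m\in\mathbb N^{+}$, a period $X>0$ and $V_+>0$. Every local maximizer of $G_m$ over $\mathcal A(X,V_+)$ with $\beta_m>\alpha_m$ is (a.e. equal to) a step function with exactly $2m$ transition points per period. In other words, in one period (viewed as the circle $\mathbb R/X\mathbb Z$) there are $m$ intervals where $V=V_+$ and $m$ intervals where $V=0$.
   Context: $\mathcal A(X,V_+)$ is the set of real-valued $V\in L^\infty(\mathbb R)$ that are $X$-periodic with $V(x)\in[0,V_+]$ for a.e. $x$. For $V\in\mathcal A(X,V_+)$ and $k\in[-\pi/X,\pi/X]$, $E_1(k)\le E_2(k)\le\cdots$ are the eigenvalues (with multiplicity) of $H_V(k)=-(\partial_x+ik)^2+V$ on $X$-periodic functions. Put $\alpha_m=\max_kE_m(k)$, $\beta_m=\min_kE_{m+1}(k)$ and $G_m[V]=\frac{\beta_m-\alpha_m}{(\alpha_m+\beta_m)/2}$. A transition point is a point at which the step function switches between the values $0$ and $V_+$. Local maximizer is understood with respect to the $L^\infty$ norm on $\mathcal A(X,V_+)$. *)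

theory Defs
  imports "HOL-Probability.Essential_Supremum" "HOL-Library.Function_Algebras"
begin

text \<open>Elements of \<open>L\<^sup>\<infinity>\<close> are represented by Lebesgue measurable functions, so both the
  periodicity and the bounds are required almost everywhere only.\<close>

definition admissible :: "real \<Rightarrow> real \<Rightarrow> (real \<Rightarrow> real) set" where
  "admissible X Vp = {V. V \<in> borel_measurable lebesgue \<and>
     (AE x in lebesgue. V (x + X) = V x) \<and> (AE x in lebesgue. V x \<in> {0..Vp})}"

definition Linf_dist :: "(real \<Rightarrow> real) \<Rightarrow> (real \<Rightarrow> real) \<Rightarrow> ereal" where
  "Linf_dist V W = esssup lebesgue (\<lambda>x. ereal \<bar>V x - W x\<bar>)"

text \<open>The \<open>X\<close>-periodic functions in \<open>H\<^sup>2\<^sub>l\<^sub>o\<^sub>c\<close>, each given by its \<open>C\<^sup>1\<close> representative \<open>u\<close>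
  with classical derivative \<open>u1\<close>; the weak second derivative \<open>u2\<close> is determined up to null sets.\<close>

definition periodic_H2 ::
  "real \<Rightarrow> (real \<Rightarrow> complex) \<Rightarrow> (real \<Rightarrow> complex) \<Rightarrow> (real \<Rightarrow> complex) \<Rightarrow> bool" where
  "periodic_H2 X u u1 u2 \<longleftrightarrow>
     (\<forall>x. u (x + X) = u x) \<and>
     (\<forall>x. (u has_vector_derivative u1 x) (at x)) \<and>
     u2 \<in> borel_measurable lebesgue \<and>
     (\<forall>a b. set_integrable lebesgue {a..b} (\<lambda>x. (norm (u2 x))\<^sup>2)) \<and>
     (\<forall>a b. a \<le> b \<longrightarrow> u1 b - u1 a = set_lebesgue_integral lebesgue {a..b} u2)"

text \<open>\<open>H\<^sub>V(k) u\<close> evaluated at \<open>x\<close>: with \<open>w = u1 + i k u\<close>, whose derivative is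
  \<open>u2 + i k u1\<close>, this is \<open>- (w' + i k w) + V u\<close>.\<close>

definition bloch_op :: "(real \<Rightarrow> real) \<Rightarrow> real \<Rightarrow>
    (real \<Rightarrow> complex) \<Rightarrow> (real \<Rightarrow> complex) \<Rightarrow> (real \<Rightarrow> complex) \<Rightarrow> real \<Rightarrow> complex" where
  "bloch_op V k u u1 u2 x =
     - ((u2 x + \<i> * of_real k * u1 x) + \<i> * of_real k * (u1 x + \<i> * of_real k * u x))
     + of_real (V x) * u x"

definition bloch_eigenspace :: "real \<Rightarrow> (real \<Rightarrow> real) \<Rightarrow> real \<Rightarrow> real \<Rightarrow> (real \<Rightarrow> complex) set" where
  "bloch_eigenspace X V k \<mu> = {u. \<exists>u1 u2. periodic_H2 X u u1 u2 \<and>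
     (AE x in lebesgue. bloch_op V k u u1 u2 x = of_real \<mu> * u x)}"

lemma vector_space_cfun:
  "vector_space (\<lambda>(c::complex) (f::real \<Rightarrow> complex) x. c * f x)"
  by unfold_locales (auto simp: fun_eq_iff algebra_simps)

text \<open>Complex dimension of the eigenspace, \<open>0\<close> if \<open>\<mu>\<close> is not an eigenvalue. (The library's
  \<open>dim\<close> is also \<open>0\<close> in infinite dimension, which is irrelevant here: an eigenspace
  consists of solutions of a second order ODE, so has dimension at most \<open>2\<close>.)\<close>

definition bloch_mult :: "real \<Rightarrow> (real \<Rightarrow> real) \<Rightarrow> real \<Rightarrow> real \<Rightarrow> nat" where
  "bloch_mult X V k \<mu> =
     vector_space.dim (\<lambda>(c::complex) (f::real \<Rightarrow> complex) x. c * f x) (bloch_eigenspace X V k \<mu>)"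

text \<open>\<open>H\<^sub>V(k)\<close> is self-adjoint, so all eigenvalues are real and algebraic and geometric
  multiplicities agree. The sequence below starts at index \<open>0\<close>.\<close>

definition bloch_eigenvalue_seq :: "real \<Rightarrow> (real \<Rightarrow> real) \<Rightarrow> real \<Rightarrow> (nat \<Rightarrow> real) \<Rightarrow> bool" where
  "bloch_eigenvalue_seq X V k e \<longleftrightarrow> mono e \<and>
     (\<forall>\<mu>. finite {j. e j = \<mu>} \<and> card {j. e j = \<mu>} = bloch_mult X V k \<mu>)"

text \<open>\<open>E\<^sub>n(k)\<close>, meaningful for \<open>n \<ge> 1\<close>.\<close>

definition band :: "real \<Rightarrow> (real \<Rightarrow> real) \<Rightarrow> nat \<Rightarrow> real \<Rightarrow> real" where
  "band X V n k = (THE e. bloch_eigenvalue_seq X V k e) (n - 1)"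

text \<open>The supremum and infimum are attained, the bands being continuous in \<open>k\<close>.\<close>

definition band_max :: "real \<Rightarrow> (real \<Rightarrow> real) \<Rightarrow> nat \<Rightarrow> real" where
  "band_max X V m = (SUP k\<in>{- pi / X..pi / X}. band X V m k)"

definition band_min :: "real \<Rightarrow> (real \<Rightarrow> real) \<Rightarrow> nat \<Rightarrow> real" where
  "band_min X V m = (INF k\<in>{- pi / X..pi / X}. band X V (m + 1) k)"

definition gap_ratio :: "real \<Rightarrow> nat \<Rightarrow> (real \<Rightarrow> real) \<Rightarrow> real" where
  "gap_ratio X m V =
     (band_min X V m - band_max X V m) / ((band_max X V m + band_min X V m) / 2)"

definition local_maximizer :: "real \<Rightarrow> real \<Rightarrow> nat \<Rightarrow> (real \<Rightarrow> real) \<Rightarrow> bool" where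
  "local_maximizer X Vp m V \<longleftrightarrow> V \<in> admissible X Vp \<and>
     (\<exists>\<epsilon>>0. \<forall>W\<in>admissible X Vp. Linf_dist W V < ereal \<epsilon> \<longrightarrow> gap_ratio X m W \<le> gap_ratio X m V)"

text \<open>A function with values in a two-point set is continuous at \<open>x\<close> iff it is constant near
  \<open>x\<close>; hence finitely many discontinuities per period means piecewise constant.\<close>

definition step_function :: "real \<Rightarrow> real \<Rightarrow> (real \<Rightarrow> real) \<Rightarrow> bool" where
  "step_function X Vp S \<longleftrightarrow> (\<forall>x. S (x + X) = S x) \<and> (\<forall>x. S x \<in> {0, Vp}) \<and>
     finite {x \<in> {0..<X}. \<not> isCont S x}"

text \<open>The half-open interval \<open>[0, X)\<close> represents the circle \<open>\<real>/X\<int>\<close>. The value of \<open>S\<close> at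
  the point itself is immaterial.\<close>

definition transition_points :: "real \<Rightarrow> real \<Rightarrow> (real \<Rightarrow> real) \<Rightarrow> real set" where
  "transition_points X Vp S = {x \<in> {0..<X}. \<exists>\<delta>>0.
     ((\<forall>y\<in>{x - \<delta><..<x}. S y = 0) \<and> (\<forall>y\<in>{x<..<x + \<delta>}. S y = Vp)) \<or>
     ((\<forall>y\<in>{x - \<delta><..<x}. S y = Vp) \<and> (\<forall>y\<in>{x<..<x + \<delta>}. S y = 0))}"

text \<open>One period, cut at a suitable point \<open>a 0\<close>, splits into \<open>m\<close> intervals on which \<open>S\<close> is
  \<open>Vp\<close> alternating with \<open>m\<close> intervals on which \<open>S\<close> is \<open>0\<close>.\<close>

definition alternating_intervals :: "real \<Rightarrow> real \<Rightarrow> nat \<Rightarrow> (real \<Rightarrow> real) \<Rightarrow> bool" where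
  "alternating_intervals X Vp m S \<longleftrightarrow> (\<exists>a :: nat \<Rightarrow> real.
     (\<forall>j<2 * m. a j < a (j + 1)) \<and> a (2 * m) = a 0 + X \<and>
     (\<forall>j<m. (\<forall>x\<in>{a (2 * j)<..<a (2 * j + 1)}. S x = Vp) \<and>
            (\<forall>x\<in>{a (2 * j + 1)<..<a (2 * j + 2)}. S x = 0)))"

end

theory Submission
  imports Defs
begin

text \<open>The band edges are read off from the Pruefer angle \<open>\<theta>\<close> of \<open>y'' = (V - \<lambda>) y\<close>: its increment over one
  period, minus \<open>m \<pi>\<close>, is at most \<open>0\<close> with equality for some initial angle exactly at \<open>\<lambda> = \<alpha>\<^sub>m\<close>, and at
  least \<open>0\<close> with equality exactly at \<open>\<lambda> = \<beta>\<^sub>m\<close>. Being extremal over initial angles, both edges respond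
  to a perturbation \<open>V + t h\<close> at least as fast as first order perturbation theory predicts, in
  the direction needed. A local maximizer with an open gap therefore satisfies \<open>V = V\<^sub>+\<close> where
  \<open>f = \<alpha> u\<^sub>\<beta>\<^sup>2 - \<beta> u\<^sub>\<alpha>\<^sup>2\<close> is positive and \<open>V = 0\<close> where it is negative, for normalized edge eigenfunctions
  \<open>u\<^sub>\<alpha>\<close>, \<open>u\<^sub>\<beta>\<close>. By comparison the angles of \<open>u\<^sub>\<alpha>\<close> and \<open>u\<^sub>\<beta>\<close> never agree modulo \<open>\<pi>\<close>, so \<open>u\<^sub>\<beta> / u\<^sub>\<alpha>\<close> is strictly
  monotone between the \<open>m\<close> zeros of \<open>u\<^sub>\<alpha>\<close> in a period, and \<open>f\<close> changes sign exactly twice between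
  consecutive ones.\<close>

section \<open>Primitives of locally bounded measurable functions\<close>

text \<open>The bands are given only through eigenvalue multiplicities, so the angles have to be
  tied to them: \<open>\<mu>\<close> is an eigenvalue at quasimomentum \<open>k\<close> iff the
  trace \<open>D\<close> of the monodromy matrix equals \<open>2 cos (k X)\<close>, and it is double
  iff that matrix is scalar. That \<open>D\<close> is injective on each band comes from comparison
  alone, without derivatives in the spectral parameter. Likewise the edges are never differentiated:
  trial angles give one-sided bounds, which suffice.

  The weight \<open>f\<close> arises because the gap ratio is an increasing function of
  \<open>\<beta> / \<alpha>\<close>, whose first variation in direction \<open>h\<close> has the
  sign of the integral of \<open>h\<close> times
  \<open>\<alpha> u_\<beta>^2 - \<beta> u_\<alpha>^2\<close>. The direction used is the step
  function minus the potential; the segment between them stays admissible by convexity.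

  Since the potential is merely measurable, solutions have no classical second derivative; the
  calculus is carried out with increments and integrals, for a Borel representative that is periodic
  and bounded at every point.\<close>

lemma periodic_int:
  fixes g :: "real \<Rightarrow> 'a"
  assumes "\<And>x. g (x + X) = g x" shows "g (x + of_int n * X) = g x"
proof (induction n rule: int_induct[where k=0])
  case (step1 i)
  have "x + of_int (i + 1) * X = (x + of_int i * X) + X" by (simp add: algebra_simps)
  then show ?case using step1 assms by metis
next
  case (step2 i)
  have "x + of_int i * X = (x + of_int (i - 1) * X) + X" by (simp add: algebra_simps)
  then show ?case using step2 assms by metis
qed simp

text \<open>Borel rather than Lebesgue measurability, because it survives translation and
  composition with continuous functions. The bound holds at every point, so estimates of integrands
  need no exceptional set.\<close>

definition loc_bdd_meas :: "(real \<Rightarrow> 'a::{real_normed_field,euclidean_space}) \<Rightarrow> bool" where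
  "loc_bdd_meas f \<longleftrightarrow> f \<in> borel_measurable borel \<and> (\<forall>N. \<exists>B. \<forall>x. \<bar>x\<bar> \<le> N \<longrightarrow> norm (f x) \<le> B)"

text \<open>Absolutely continuous functions with locally bounded derivative, described by
  increments: the coefficient of the equation is merely measurable, so \<open>F\<close> need not be
  differentiable everywhere and \<open>f\<close> is determined only up to a null set. Real and
  complex values are treated at once.\<close>

definition primitive :: "(real \<Rightarrow> 'a::{real_normed_field,euclidean_space}) \<Rightarrow> (real \<Rightarrow> 'a) \<Rightarrow> bool" where
  "primitive F f \<longleftrightarrow> loc_bdd_meas f \<and> (\<forall>a b. a \<le> b \<longrightarrow> (f has_integral (F b - F a)) {a..b})"

lemma loc_bdd_measD: "loc_bdd_meas f \<Longrightarrow> f \<in> borel_measurable borel"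
  by (simp add: loc_bdd_meas_def)

lemma loc_bdd_meas_bound:
  assumes "loc_bdd_meas f"
  obtains B where "B > 0" "\<And>x. \<bar>x\<bar> \<le> N \<Longrightarrow> norm (f x) \<le> B"
proof -
  obtain B where "\<forall>x. \<bar>x\<bar> \<le> N \<longrightarrow> norm (f x) \<le> B" using assms by (auto simp: loc_bdd_meas_def)
  then show ?thesis using that[of "max 1 B"] by (auto simp: le_max_iff_disj)
qed

lemma loc_bdd_measI:
  assumes "f \<in> borel_measurable borel" "\<And>N. \<exists>B. \<forall>x. \<bar>x\<bar> \<le> N \<longrightarrow> norm (f x) \<le> B"
  shows "loc_bdd_meas f"
  using assms by (auto simp: loc_bdd_meas_def)

lemma loc_bdd_meas_bdd:
  assumes "f \<in> borel_measurable borel" "\<And>x. norm (f x) \<le> B"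
  shows "loc_bdd_meas f"
  using assms by (auto simp: loc_bdd_meas_def)

lemma loc_bdd_meas_cont:
  assumes "continuous_on UNIV f" shows "loc_bdd_meas f"
proof (rule loc_bdd_measI)
  show "f \<in> borel_measurable borel" using assms by (rule borel_measurable_continuous_onI)
  fix N :: real
  have "compact (f ` {-N..N})"
    by (rule compact_continuous_image) (use assms continuous_on_subset in auto)
  then obtain B where B: "\<forall>y \<in> f ` {-N..N}. norm y \<le> B"
    using bounded_iff compact_imp_bounded by blast
  then show "\<exists>B. \<forall>x. \<bar>x\<bar> \<le> N \<longrightarrow> norm (f x) \<le> B"
    by (intro exI[of _ B]) (auto simp: abs_le_iff)
qed

lemma loc_bdd_meas_const [intro, simp]: "loc_bdd_meas (\<lambda>x. c)"
  by (rule loc_bdd_meas_cont) simp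

lemma loc_bdd_meas_add:
  assumes "loc_bdd_meas f" "loc_bdd_meas g" shows "loc_bdd_meas (\<lambda>x. f x + g x)"
proof (rule loc_bdd_measI)
  show "(\<lambda>x. f x + g x) \<in> borel_measurable borel" using assms by (auto dest!: loc_bdd_measD)
  fix N
  obtain B where B: "\<And>x. \<bar>x\<bar> \<le> N \<Longrightarrow> norm (f x) \<le> B" using loc_bdd_meas_bound[OF assms(1)] by blast
  obtain C where C: "\<And>x. \<bar>x\<bar> \<le> N \<Longrightarrow> norm (g x) \<le> C" using loc_bdd_meas_bound[OF assms(2)] by blast
  have "norm (f x + g x) \<le> B + C" if "\<bar>x\<bar> \<le> N" for x
    using norm_triangle_ineq[of "f x" "g x"] B[OF that] C[OF that] by linarith
  then show "\<exists>B. \<forall>x. \<bar>x\<bar> \<le> N \<longrightarrow> norm (f x + g x) \<le> B" by blast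
qed

lemma loc_bdd_meas_mult:
  assumes "loc_bdd_meas f" "loc_bdd_meas g" shows "loc_bdd_meas (\<lambda>x. f x * g x)"
proof (rule loc_bdd_measI)
  show "(\<lambda>x. f x * g x) \<in> borel_measurable borel" using assms by (auto dest!: loc_bdd_measD)
  fix N
  obtain B where B: "B > 0" "\<And>x. \<bar>x\<bar> \<le> N \<Longrightarrow> norm (f x) \<le> B" using loc_bdd_meas_bound[OF assms(1)] by blast
  obtain C where C: "\<And>x. \<bar>x\<bar> \<le> N \<Longrightarrow> norm (g x) \<le> C" using loc_bdd_meas_bound[OF assms(2)] by blast
  have "norm (f x * g x) \<le> B * C" if "\<bar>x\<bar> \<le> N" for x
    using B(1) B(2)[OF that] C[OF that] by (simp add: norm_mult mult_mono)
  then show "\<exists>B. \<forall>x. \<bar>x\<bar> \<le> N \<longrightarrow> norm (f x * g x) \<le> B" by blast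
qed

lemma loc_bdd_meas_minus:
  "loc_bdd_meas f \<Longrightarrow> loc_bdd_meas (\<lambda>x. - f x)"
  using loc_bdd_meas_mult[of "\<lambda>x. -1" f] by simp

lemma loc_bdd_meas_diff:
  "loc_bdd_meas f \<Longrightarrow> loc_bdd_meas g \<Longrightarrow> loc_bdd_meas (\<lambda>x. f x - g x)"
  using loc_bdd_meas_add[of f "\<lambda>x. - g x"] loc_bdd_meas_minus[of g] by simp

lemma loc_bdd_meas_power:
  "loc_bdd_meas f \<Longrightarrow> loc_bdd_meas (\<lambda>x. f x ^ n)"
  by (induction n) (simp_all add: loc_bdd_meas_mult)

lemma loc_bdd_meas_of_real:
  assumes "loc_bdd_meas f"
  shows "loc_bdd_meas (\<lambda>x. of_real (f x) :: 'a::{real_normed_field,euclidean_space})"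
proof (rule loc_bdd_measI)
  show "(\<lambda>x. of_real (f x) :: 'a) \<in> borel_measurable borel"
    using assms by (auto dest!: loc_bdd_measD simp: of_real_def)
  show "\<exists>B. \<forall>x. \<bar>x\<bar> \<le> N \<longrightarrow> norm (of_real (f x) :: 'a) \<le> B" for N
    using loc_bdd_meas_bound[OF assms, of N] by auto
qed

lemma loc_bdd_meas_shift:
  assumes "loc_bdd_meas f" shows "loc_bdd_meas (\<lambda>x. f (x + c))"
proof (rule loc_bdd_measI)
  show "(\<lambda>x. f (x + c)) \<in> borel_measurable borel" using loc_bdd_measD[OF assms] by measurable
  show "\<exists>B. \<forall>x. \<bar>x\<bar> \<le> N \<longrightarrow> norm (f (x + c)) \<le> B" for N
  proof -
    obtain B where B: "\<And>x. \<bar>x\<bar> \<le> N + \<bar>c\<bar> \<Longrightarrow> norm (f x) \<le> B" using loc_bdd_meas_bound[OF assms] by blast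
    then show ?thesis by (intro exI[of _ B]) (auto intro!: B)
  qed
qed

lemma loc_bdd_meas_integrable:
  assumes "loc_bdd_meas f" shows "f integrable_on {a..b}"
proof -
  obtain B where B: "\<And>x. \<bar>x\<bar> \<le> \<bar>a\<bar> + \<bar>b\<bar> \<Longrightarrow> norm (f x) \<le> B" using loc_bdd_meas_bound[OF assms] by blast
  show ?thesis
  proof (rule measurable_bounded_by_integrable_imp_integrable)
    show "f \<in> borel_measurable (lebesgue_on {a..b})"
      using loc_bdd_measD[OF assms] by (simp add: measurable_completion measurable_restrict_space1)
    show "(\<lambda>x. B) integrable_on {a..b}" by (rule integrable_const_ivl)
    show "norm (f x) \<le> B" if "x \<in> {a..b}" for x using that by (intro B) auto
  qed auto
qed

text \<open>Replaces almost everywhere differentiation: the product and chain rules below hold because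
  both sides have the same increments up to \<open>O((y - x)\<^sup>2)\<close>.\<close>

lemma const_if_quadratic_increments:
  fixes H :: "real \<Rightarrow> 'a::real_normed_vector"
  assumes "\<And>N. \<exists>C. \<forall>x y. \<bar>x\<bar> \<le> N \<longrightarrow> \<bar>y\<bar> \<le> N \<longrightarrow> x \<le> y \<longrightarrow> norm (H y - H x) \<le> C * (y - x)\<^sup>2"
  shows "H y = H x"
proof -
  have "(H has_derivative (\<lambda>h. 0)) (at x)" for x
    unfolding has_derivative_at_alt
  proof (intro conjI allI impI)
    fix e :: real assume "e > 0"
    obtain C where C: "\<forall>x' y. \<bar>x'\<bar> \<le> \<bar>x\<bar> + 1 \<longrightarrow> \<bar>y\<bar> \<le> \<bar>x\<bar> + 1 \<longrightarrow> x' \<le> y \<longrightarrow> norm (H y - H x') \<le> C * (y - x')\<^sup>2"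
      using assms by blast
    define d where "d = min 1 (e / (\<bar>C\<bar> + 1))"
    have "d > 0" using \<open>e > 0\<close> by (simp add: d_def)
    moreover have "norm (H y - H x - 0) \<le> e * norm (y - x)" if "norm (y - x) < d" for y
    proof -
      have a: "\<bar>y - x\<bar> < 1" "\<bar>y - x\<bar> \<le> e / (\<bar>C\<bar> + 1)" using that by (auto simp: d_def)
      have "norm (H y - H x) \<le> C * (y - x)\<^sup>2"
      proof (cases "x \<le> y")
        case True then show ?thesis using C a by auto
      next
        case False then show ?thesis using C[rule_format, of y x] a by (auto simp: norm_minus_commute power2_commute)
      qed
      also have "\<dots> \<le> (\<bar>C\<bar> + 1) * \<bar>y - x\<bar> * \<bar>y - x\<bar>"
        by (simp add: power2_eq_square mult.assoc mult_right_mono)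
      also have "\<dots> \<le> e * \<bar>y - x\<bar>"
        using a(2) by (intro mult_right_mono) (auto simp: field_simps)
      finally show ?thesis by simp
    qed
    ultimately show "\<exists>d>0. \<forall>y. norm (y - x) < d \<longrightarrow> norm (H y - H x - 0) \<le> e * norm (y - x)" by blast
  qed auto
  then show ?thesis using has_derivative_zero_unique[of UNIV H y x] by simp
qed

text \<open>The signed integral from \<open>0\<close> to \<open>x\<close>; one of the two intervals
  is always empty or a point.\<close>

definition indef :: "(real \<Rightarrow> 'a::{real_normed_field,euclidean_space}) \<Rightarrow> real \<Rightarrow> 'a" where
  "indef f x = integral {0..x} f - integral {x..0} f"

lemma primitive_indef:
  assumes "loc_bdd_meas f" shows "primitive (indef f) f"
  unfolding primitive_def
proof (intro conjI allI impI assms)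
  fix a b :: real assume ab: "a \<le> b"
  note I = loc_bdd_meas_integrable[OF assms]
  have [simp]: "integral {0..x} f = 0" if "x \<le> 0" for x using that by (cases "x = 0") auto
  have [simp]: "integral {x..0} f = 0" if "x \<ge> 0" for x using that by (cases "x = 0") auto
  consider "a \<ge> 0" | "b \<le> 0" | "a < 0" "b > 0" by linarith
  then have "indef f b - indef f a = integral {a..b} f"
  proof cases
    case 1 then show ?thesis using Henstock_Kurzweil_Integration.integral_combine[of 0 a b f, OF _ ab I] ab
      by (simp add: indef_def algebra_simps)
  next
    case 2 then show ?thesis using Henstock_Kurzweil_Integration.integral_combine[of a b 0 f, OF ab _ I] ab
      by (simp add: indef_def algebra_simps)
  next
    case 3 then show ?thesis using Henstock_Kurzweil_Integration.integral_combine[of a 0 b f, OF _ _ I] ab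
      by (simp add: indef_def algebra_simps)
  qed
  then show "(f has_integral (indef f b - indef f a)) {a..b}"
    using I[of a b] by (simp add: has_integral_integral)
qed

lemma indef_0 [simp]: "indef f 0 = 0" by (simp add: indef_def)

lemma primitiveD: "primitive F f \<Longrightarrow> a \<le> b \<Longrightarrow> (f has_integral (F b - F a)) {a..b}"
  "primitive F f \<Longrightarrow> loc_bdd_meas f"
  "primitive F f \<Longrightarrow> a \<le> b \<Longrightarrow> integral {a..b} f = F b - F a"
  by (auto simp: primitive_def integral_unique)

lemma primitive_lipschitz:
  assumes "primitive F f"
  obtains B where "B > 0" "\<And>x y. \<bar>x\<bar> \<le> N \<Longrightarrow> \<bar>y\<bar> \<le> N \<Longrightarrow> norm (F y - F x) \<le> B * \<bar>y - x\<bar>"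
    "\<And>x. \<bar>x\<bar> \<le> N \<Longrightarrow> norm (f x) \<le> B"
proof -
  obtain B where B: "B > 0" "\<And>x. \<bar>x\<bar> \<le> N \<Longrightarrow> norm (f x) \<le> B"
    using loc_bdd_meas_bound[OF primitiveD(2)[OF assms]] by blast
  have *: "norm (F y - F x) \<le> B * \<bar>y - x\<bar>" if "\<bar>x\<bar> \<le> N" "\<bar>y\<bar> \<le> N" "x \<le> y" for x y
  proof -
    have "norm (F y - F x) \<le> B * measure lborel {x..y}"
      by (rule has_integral_bound_real[OF _ finite.emptyI primitiveD(1)[OF assms \<open>x \<le> y\<close>]])
         (use that B in \<open>auto intro!: B(2)\<close>)
    then show ?thesis using that by simp
  qed
  have "norm (F y - F x) \<le> B * \<bar>y - x\<bar>" if "\<bar>x\<bar> \<le> N" "\<bar>y\<bar> \<le> N" for x y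
    using *[of x y] *[of y x] that by (cases "x \<le> y") (auto simp: norm_minus_commute abs_minus_commute)
  then show ?thesis using that B by blast
qed

lemma primitive_continuous:
  assumes "primitive F f" shows "continuous_on S F"
proof -
  have "isCont F x" for x
  proof -
    obtain B where B: "B > 0" "\<And>x' y. \<bar>x'\<bar> \<le> \<bar>x\<bar> + 1 \<Longrightarrow> \<bar>y\<bar> \<le> \<bar>x\<bar> + 1 \<Longrightarrow> norm (F y - F x') \<le> B * \<bar>y - x'\<bar>"
        "\<And>y. \<bar>y\<bar> \<le> \<bar>x\<bar> + 1 \<Longrightarrow> norm (f y) \<le> B"
      by (rule primitive_lipschitz[OF assms, of "\<bar>x\<bar> + 1"]) blast
    show ?thesis unfolding continuous_at_eps_delta
    proof (intro allI impI)
      fix e :: real assume "e > 0"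
      then show "\<exists>d>0. \<forall>x'. dist x' x < d \<longrightarrow> dist (F x') (F x) < e"
      proof (intro exI[of _ "min 1 (e / B)"] conjI allI impI)
        fix y assume y: "dist y x < min 1 (e / B)"
        have "norm (F y - F x) \<le> B * \<bar>y - x\<bar>" using y by (intro B) (auto simp: dist_real_def)
        also have "\<dots> < e" using y B(1) by (auto simp: dist_real_def field_simps)
        finally show "dist (F y) (F x) < e" by (simp add: dist_norm)
      qed (use B in auto)
    qed
  qed
  then show ?thesis by (simp add: continuous_at_imp_continuous_on)
qed

lemma primitive_loc_bdd_meas: "primitive F f \<Longrightarrow> loc_bdd_meas F"
  using loc_bdd_meas_cont primitive_continuous by blast

text \<open>Subtracting the signed integral of \<open>h\<close> reduces this to
  \<open>const_if_quadratic_increments\<close>. The product and chain rules are checked in this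
  form.\<close>

lemma primitiveI_quadratic:
  assumes h: "loc_bdd_meas h"
    and "\<And>N. \<exists>C. \<forall>x y. \<bar>x\<bar> \<le> N \<longrightarrow> \<bar>y\<bar> \<le> N \<longrightarrow> x \<le> y \<longrightarrow>
      norm (H y - H x - integral {x..y} h) \<le> C * (y - x)\<^sup>2"
  shows "primitive H h"
proof -
  note P = primitive_indef[OF h]
  have "(\<lambda>x. H x - indef h x) y = (\<lambda>x. H x - indef h x) x" for x y
  proof (rule const_if_quadratic_increments)
    fix N
    obtain C where C: "\<forall>x y. \<bar>x\<bar> \<le> N \<longrightarrow> \<bar>y\<bar> \<le> N \<longrightarrow> x \<le> y \<longrightarrow>
      norm (H y - H x - integral {x..y} h) \<le> C * (y - x)\<^sup>2" using assms by blast
    show "\<exists>C. \<forall>x y. \<bar>x\<bar> \<le> N \<longrightarrow> \<bar>y\<bar> \<le> N \<longrightarrow> x \<le> y \<longrightarrow>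
      norm (H y - indef h y - (H x - indef h x)) \<le> C * (y - x)\<^sup>2"
      using C primitiveD(3)[OF P] by (intro exI[of _ C]) (simp add: algebra_simps)
  qed
  then have "H y - H x = indef h y - indef h x" for x y
    unfolding diff_eq_eq by (simp add: algebra_simps)
  then show ?thesis using P by (simp add: primitive_def)
qed

lemma primitive_mult:
  assumes F: "primitive F f" and G: "primitive G g"
  shows "primitive (\<lambda>x. F x * G x) (\<lambda>x. f x * G x + F x * g x)"
proof (rule primitiveI_quadratic)
  note m = primitiveD(2)[OF F] primitiveD(2)[OF G] primitive_loc_bdd_meas[OF F] primitive_loc_bdd_meas[OF G]
  show M: "loc_bdd_meas (\<lambda>x. f x * G x + F x * g x)" by (intro loc_bdd_meas_add loc_bdd_meas_mult m)
  fix N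
  obtain B where B: "B > 0" "\<And>x y. \<bar>x\<bar> \<le> N \<Longrightarrow> \<bar>y\<bar> \<le> N \<Longrightarrow> norm (F y - F x) \<le> B * \<bar>y - x\<bar>"
    "\<And>x. \<bar>x\<bar> \<le> N \<Longrightarrow> norm (f x) \<le> B" by (rule primitive_lipschitz[OF F, of N]) blast
  obtain C where C: "C > 0" "\<And>x y. \<bar>x\<bar> \<le> N \<Longrightarrow> \<bar>y\<bar> \<le> N \<Longrightarrow> norm (G y - G x) \<le> C * \<bar>y - x\<bar>"
    "\<And>x. \<bar>x\<bar> \<le> N \<Longrightarrow> norm (g x) \<le> C" by (rule primitive_lipschitz[OF G, of N]) blast
  have "norm (F y * G y - F x * G x - integral {x..y} (\<lambda>x. f x * G x + F x * g x)) \<le> (2 * B * C) * (y - x)\<^sup>2"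
    if xy: "\<bar>x\<bar> \<le> N" "\<bar>y\<bar> \<le> N" "x \<le> y" for x y
  proof -
    have 1: "((\<lambda>t. f t * G y) has_integral (F y - F x) * G y) {x..y}"
      by (intro has_integral_mult_left primitiveD(1)[OF F] xy)
    have 2: "((\<lambda>t. F x * g t) has_integral F x * (G y - G x)) {x..y}"
      by (intro has_integral_mult_right primitiveD(1)[OF G] xy)
    have 3: "((\<lambda>t. f t * G t + F t * g t) has_integral integral {x..y} (\<lambda>x. f x * G x + F x * g x)) {x..y}"
      using loc_bdd_meas_integrable[OF M] by (simp add: has_integral_integral)
    have 4: "((\<lambda>t. f t * G y + F x * g t - (f t * G t + F t * g t)) has_integral
       (F y - F x) * G y + F x * (G y - G x) - integral {x..y} (\<lambda>x. f x * G x + F x * g x)) {x..y}"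
      by (intro has_integral_diff has_integral_add 1 2 3)
    have "norm ((F y - F x) * G y + F x * (G y - G x) - integral {x..y} (\<lambda>x. f x * G x + F x * g x))
        \<le> (2 * B * C * (y - x)) * measure lborel {x..y}"
    proof (rule has_integral_bound_real[OF _ finite.emptyI 4])
      show "0 \<le> 2 * B * C * (y - x)" using B C xy by simp
      fix t assume "t \<in> {x..y} - {}"
      then have t: "\<bar>t\<bar> \<le> N" "\<bar>y - t\<bar> \<le> y - x" "\<bar>t - x\<bar> \<le> y - x" using xy by auto
      have "f t * G y + F x * g t - (f t * G t + F t * g t) = f t * (G y - G t) - (F t - F x) * g t"
        by (simp add: algebra_simps)
      also have "norm \<dots> \<le> norm (f t) * norm (G y - G t) + norm (F t - F x) * norm (g t)"
        using norm_triangle_ineq4[of "f t * (G y - G t)" "(F t - F x) * g t"] by (simp add: norm_mult)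
      also have "\<dots> \<le> B * (C * (y - x)) + (B * (y - x)) * C"
        using B(1) C(1) B(3)[OF t(1)] C(3)[OF t(1)] order_trans[OF C(2)[of t y] mult_left_mono[OF t(2)]]
          order_trans[OF B(2)[of x t] mult_left_mono[of "\<bar>t - x\<bar>" "y - x" B]] t xy
        by (intro add_mono mult_mono) auto
      finally show "norm (f t * G y + F x * g t - (f t * G t + F t * g t)) \<le> 2 * B * C * (y - x)"
        by (simp add: algebra_simps)
    qed
    then show ?thesis using xy by (simp add: algebra_simps power2_eq_square)
  qed
  then show "\<exists>C. \<forall>x y. \<bar>x\<bar> \<le> N \<longrightarrow> \<bar>y\<bar> \<le> N \<longrightarrow> x \<le> y \<longrightarrow>
    norm (F y * G y - F x * G x - integral {x..y} (\<lambda>x. f x * G x + F x * g x)) \<le> C * (y - x)\<^sup>2" by blast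
qed

text \<open>Two quadratic errors add up: the Taylor remainder of \<open>\<phi>\<close> at
  \<open>F x\<close>, and the cost of freezing \<open>\<phi>1 (F t)\<close> at \<open>t = x\<close>.
  Both rest on \<open>F\<close> being locally Lipschitz and \<open>\<phi>1\<close> being Lipschitz
  on the bounded range of \<open>F\<close>.\<close>

lemma primitive_compose:
  fixes F f :: "real \<Rightarrow> real"
  assumes F: "primitive F f"
    and d1: "\<And>x. (\<phi> has_real_derivative \<phi>1 x) (at x)" and d2: "\<And>x. (\<phi>1 has_real_derivative \<phi>2 x) (at x)"
    and c: "continuous_on UNIV \<phi>2"
  shows "primitive (\<lambda>x. \<phi> (F x)) (\<lambda>x. \<phi>1 (F x) * f x)"
proof (rule primitiveI_quadratic)
  have c1: "continuous_on UNIV \<phi>1" using d2 DERIV_isCont continuous_at_imp_continuous_on by blast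
  have c0: "continuous_on UNIV (\<lambda>x. \<phi>1 (F x))"
    by (rule continuous_on_compose2[OF c1 primitive_continuous[OF F]]) auto
  show M: "loc_bdd_meas (\<lambda>x. \<phi>1 (F x) * f x)"
    by (intro loc_bdd_meas_mult loc_bdd_meas_cont c0 primitiveD[OF F])
  fix N
  obtain B where B: "B > 0" "\<And>x y. \<bar>x\<bar> \<le> N \<Longrightarrow> \<bar>y\<bar> \<le> N \<Longrightarrow> norm (F y - F x) \<le> B * \<bar>y - x\<bar>"
    "\<And>x. \<bar>x\<bar> \<le> N \<Longrightarrow> norm (f x) \<le> B" by (rule primitive_lipschitz[OF F, of N]) blast
  obtain R where R: "R > 0" "\<And>x. \<bar>x\<bar> \<le> N \<Longrightarrow> norm (F x) \<le> R"
    by (rule loc_bdd_meas_bound[OF primitive_loc_bdd_meas[OF F], of N]) blast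
  obtain L where L: "L > 0" "\<And>x. \<bar>x\<bar> \<le> R \<Longrightarrow> norm (\<phi>2 x) \<le> L"
    by (rule loc_bdd_meas_bound[OF loc_bdd_meas_cont[OF c], of R]) blast
  have lip: "\<bar>\<phi>1 v - \<phi>1 u\<bar> \<le> L * \<bar>v - u\<bar>" if "\<bar>u\<bar> \<le> R" "\<bar>v\<bar> \<le> R" for u v
    using field_differentiable_bound[of "{-R..R}" \<phi>1 \<phi>2 L v u] that L(2) d2
    by (auto simp: abs_le_iff has_field_derivative_at_within)
  have taylor: "\<bar>\<phi> v - \<phi> u - \<phi>1 u * (v - u)\<bar> \<le> L * \<bar>v - u\<bar>\<^sup>2" if uv: "\<bar>u\<bar> \<le> R" "\<bar>v\<bar> \<le> R" for u v
  proof (cases "u = v")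
    case False
    have "\<exists>w. \<bar>w - u\<bar> \<le> \<bar>v - u\<bar> \<and> \<bar>w\<bar> \<le> R \<and> \<phi> v - \<phi> u = (v - u) * \<phi>1 w"
    proof (cases "u < v")
      case True
      then obtain z where "u < z" "z < v" "\<phi> v - \<phi> u = (v - u) * \<phi>1 z"
        using MVT2[of u v \<phi> \<phi>1] d1 by blast
      then show ?thesis using uv by (intro exI[of _ z]) auto
    next
      case 2: False
      then obtain z where "v < z" "z < u" "\<phi> u - \<phi> v = (u - v) * \<phi>1 z"
        using MVT2[of v u \<phi> \<phi>1] d1 False by fastforce
      then show ?thesis using uv by (intro exI[of _ z]) (auto simp: algebra_simps)
    qed
    then obtain w where w: "\<bar>w - u\<bar> \<le> \<bar>v - u\<bar>" "\<bar>w\<bar> \<le> R" "\<phi> v - \<phi> u = (v - u) * \<phi>1 w" by blast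
    have "\<bar>\<phi> v - \<phi> u - \<phi>1 u * (v - u)\<bar> = \<bar>v - u\<bar> * \<bar>\<phi>1 w - \<phi>1 u\<bar>"
      unfolding w(3) abs_mult[symmetric] by (simp add: algebra_simps)
    also have "\<dots> \<le> \<bar>v - u\<bar> * (L * \<bar>v - u\<bar>)"
      using order_trans[OF lip[OF uv(1) w(2)] mult_left_mono[OF w(1)]] L(1) by (intro mult_left_mono) auto
    finally show ?thesis by (simp add: power2_eq_square algebra_simps)
  qed simp
  have "norm (\<phi> (F y) - \<phi> (F x) - integral {x..y} (\<lambda>x. \<phi>1 (F x) * f x)) \<le> (2 * L * B\<^sup>2) * (y - x)\<^sup>2"
    if xy: "\<bar>x\<bar> \<le> N" "\<bar>y\<bar> \<le> N" "x \<le> y" for x y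
  proof -
    have 1: "((\<lambda>t. \<phi>1 (F x) * f t) has_integral \<phi>1 (F x) * (F y - F x)) {x..y}"
      by (intro has_integral_mult_right primitiveD(1)[OF F] xy)
    have 3: "((\<lambda>t. \<phi>1 (F t) * f t) has_integral integral {x..y} (\<lambda>x. \<phi>1 (F x) * f x)) {x..y}"
      using loc_bdd_meas_integrable[OF M] by (simp add: has_integral_integral)
    have 4: "((\<lambda>t. \<phi>1 (F x) * f t - \<phi>1 (F t) * f t) has_integral
       \<phi>1 (F x) * (F y - F x) - integral {x..y} (\<lambda>x. \<phi>1 (F x) * f x)) {x..y}"
      by (intro has_integral_diff 1 3)
    have "norm (\<phi>1 (F x) * (F y - F x) - integral {x..y} (\<lambda>x. \<phi>1 (F x) * f x))
        \<le> (L * B\<^sup>2 * (y - x)) * measure lborel {x..y}"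
    proof (rule has_integral_bound_real[OF _ finite.emptyI 4])
      show "0 \<le> L * B\<^sup>2 * (y - x)" using B L xy by simp
      fix t assume "t \<in> {x..y} - {}"
      then have t: "\<bar>t\<bar> \<le> N" "\<bar>x - t\<bar> \<le> y - x" using xy by auto
      have "\<phi>1 (F x) * f t - \<phi>1 (F t) * f t = (\<phi>1 (F x) - \<phi>1 (F t)) * f t"
        by (simp add: algebra_simps)
      also have "norm \<dots> \<le> (L * (B * (y - x))) * B" unfolding abs_mult real_norm_def
      proof (intro mult_mono)
        have "\<bar>\<phi>1 (F x) - \<phi>1 (F t)\<bar> \<le> L * \<bar>F x - F t\<bar>" using R(2) t xy by (intro lip) auto
        also have "\<dots> \<le> L * (B * (y - x))"
          using order_trans[OF B(2)[of t x] mult_left_mono[OF t(2)]] t xy L(1) B(1) by (intro mult_left_mono) auto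
        finally show "\<bar>\<phi>1 (F x) - \<phi>1 (F t)\<bar> \<le> L * (B * (y - x))" .
      qed (use B L xy t in auto)
      finally show "norm (\<phi>1 (F x) * f t - \<phi>1 (F t) * f t) \<le> L * B\<^sup>2 * (y - x)"
        by (simp add: algebra_simps power2_eq_square)
    qed
    moreover have "norm (\<phi> (F y) - \<phi> (F x) - \<phi>1 (F x) * (F y - F x)) \<le> L * (B * \<bar>y - x\<bar>)\<^sup>2"
    proof -
      have "\<bar>F y - F x\<bar>\<^sup>2 \<le> (B * \<bar>y - x\<bar>)\<^sup>2" using B(2)[OF xy(1,2)] by (intro power_mono) auto
      then have "L * \<bar>F y - F x\<bar>\<^sup>2 \<le> L * (B * \<bar>y - x\<bar>)\<^sup>2" using L(1) by (intro mult_left_mono) auto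
      then show ?thesis using taylor[of "F x" "F y"] R(2) xy by fastforce
    qed
    ultimately show ?thesis using xy by (simp add: algebra_simps power2_eq_square)
  qed
  then show "\<exists>C. \<forall>x y. \<bar>x\<bar> \<le> N \<longrightarrow> \<bar>y\<bar> \<le> N \<longrightarrow> x \<le> y \<longrightarrow>
    norm (\<phi> (F y) - \<phi> (F x) - integral {x..y} (\<lambda>x. \<phi>1 (F x) * f x)) \<le> C * (y - x)\<^sup>2" by blast
qed

lemma primitive_cong:
  assumes "primitive F f" "\<And>x. F x = G x" "\<And>x. f x = g x" shows "primitive G g"
  using assms by (metis ext)

lemma primitive_add:
  assumes "primitive F f" "primitive G g" shows "primitive (\<lambda>x. F x + G x) (\<lambda>x. f x + g x)"
  unfolding primitive_def
proof (intro conjI allI impI)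
  show "loc_bdd_meas (\<lambda>x. f x + g x)" using assms by (intro loc_bdd_meas_add primitiveD)
  fix a b :: real assume "a \<le> b"
  then show "((\<lambda>x. f x + g x) has_integral (F b + G b - (F a + G a))) {a..b}"
    using has_integral_add[OF primitiveD(1)[OF assms(1)] primitiveD(1)[OF assms(2)], of a b]
    by (simp add: algebra_simps)
qed

lemma primitive_const: "primitive (\<lambda>x. c) (\<lambda>x. 0)"
  by (simp add: primitive_def)

lemma primitive_cmult: "primitive F f \<Longrightarrow> primitive (\<lambda>x. c * F x) (\<lambda>x. c * f x)"
  using primitive_mult[OF primitive_const, of F f c] by simp

lemma primitive_minus: "primitive F f \<Longrightarrow> primitive (\<lambda>x. - F x) (\<lambda>x. - f x)"
  using primitive_cmult[of F f "-1"] by simp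

lemma primitive_diff:
  "primitive F f \<Longrightarrow> primitive G g \<Longrightarrow> primitive (\<lambda>x. F x - G x) (\<lambda>x. f x - g x)"
  using primitive_add[OF _ primitive_minus, of F f G g] by simp

lemma primitive_of_real:
  assumes "primitive F f"
  shows "primitive (\<lambda>x. of_real (F x) :: 'a::{real_normed_field,euclidean_space}) (\<lambda>x. of_real (f x))"
  unfolding primitive_def
proof (intro conjI allI impI)
  show "loc_bdd_meas (\<lambda>x. of_real (f x) :: 'a)" using assms by (intro loc_bdd_meas_of_real primitiveD)
  fix a b :: real assume "a \<le> b"
  then show "((\<lambda>x. of_real (f x) :: 'a) has_integral (of_real (F b) - of_real (F a))) {a..b}"
    using has_integral_linear[OF primitiveD(1)[OF assms] bounded_linear_of_real[where 'a='a], of a b]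
    by (simp add: o_def)
qed

lemma primitive_shift:
  assumes "primitive F f" shows "primitive (\<lambda>x. F (x + c)) (\<lambda>x. f (x + c))"
  unfolding primitive_def
proof (intro conjI allI impI)
  show "loc_bdd_meas (\<lambda>x. f (x + c))" using assms by (intro loc_bdd_meas_shift primitiveD)
  fix a b :: real assume "a \<le> b"
  then show "((\<lambda>x. f (x + c)) has_integral (F (b + c) - F (a + c))) {a..b}"
    using has_integral_affinity[OF primitiveD(1)[OF assms, of "a + c" "b + c", unfolded cbox_interval[symmetric]], of 1 c]
    by (simp add: algebra_simps image_affinity_atLeastAtMost_diff)
qed

lemma primitive_deriv:
  assumes "\<And>x. (F has_vector_derivative f x) (at x)" "continuous_on UNIV f"
  shows "primitive F f"
  unfolding primitive_def
proof (intro conjI allI impI loc_bdd_meas_cont assms)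
  fix a b :: real assume "a \<le> b"
  then show "(f has_integral (F b - F a)) {a..b}"
    by (intro fundamental_theorem_of_calculus) (auto intro: has_vector_derivative_at_within assms)
qed

lemma primitive_has_vector_derivative:
  assumes F: "primitive F f" and "continuous_on UNIV f"
  shows "(F has_vector_derivative f x) (at x)"
proof -
  have c: "continuous_on {x-1..x+1} f" using assms(2) continuous_on_subset by blast
  have "((\<lambda>u. integral {x-1..u} f) has_vector_derivative f x) (at x within {x-1..x+1})"
    by (rule integral_has_vector_derivative[OF c]) auto
  then have "((\<lambda>u. F (x-1) + integral {x-1..u} f) has_vector_derivative f x) (at x within {x-1..x+1})"
    using has_vector_derivative_add[OF has_vector_derivative_const] by fastforce
  then have "(F has_vector_derivative f x) (at x within {x-1..x+1})"
    by (rule has_vector_derivative_transform[rotated 2]) (auto simp: primitiveD(3)[OF F])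
  then show ?thesis
    by (rule at_within_interior[THEN subst, rotated]) auto
qed

lemma primitive_real_derivative:
  fixes F :: "real \<Rightarrow> real"
  assumes F: "primitive F f" and "continuous_on UNIV f"
  shows "(F has_real_derivative f x) (at x)"
  using primitive_has_vector_derivative[OF assms] by (simp add: has_real_derivative_iff_has_vector_derivative)

lemma primitive_unique:
  assumes "primitive F f" "primitive G f" "F a = G a" shows "F x = G x"
proof -
  have "F y - F x = G y - G x" if "x \<le> y" for x y
    using primitiveD(1)[OF assms(1) that] primitiveD(1)[OF assms(2) that] has_integral_unique by blast
  from this[of a x] this[of x a] assms(3) show ?thesis by (cases "a \<le> x") auto
qed

lemma primitive_0_const:
  assumes "primitive F (\<lambda>x. 0)" shows "F x = F y"
  using primitive_unique[OF assms primitive_const[of "F y"], of y x] by simp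

lemma primitive_eq_indef:
  assumes "primitive F f" shows "F x = F 0 + indef f x"
  by (rule primitive_unique[OF assms, of _ 0])
     (use primitive_add[OF primitive_const primitive_indef[OF primitiveD(2)[OF assms]]] in auto)

lemma primitive_mono:
  fixes F :: "real \<Rightarrow> real"
  assumes "primitive F f" "\<And>x. a \<le> x \<Longrightarrow> x \<le> b \<Longrightarrow> f x \<ge> 0" "a \<le> b" shows "F a \<le> F b"
  using has_integral_nonneg[OF primitiveD(1)[OF assms(1,3)]] assms(2) by auto

lemma primitive_le:
  fixes F G :: "real \<Rightarrow> real"
  assumes "primitive F f" "primitive G g" "\<And>x. a \<le> x \<Longrightarrow> x \<le> b \<Longrightarrow> f x \<le> g x" "a \<le> b"
  shows "F b - F a \<le> G b - G a"
  using has_integral_le[OF primitiveD(1)[OF assms(1,4)] primitiveD(1)[OF assms(2,4)]] assms(3) by auto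

lemma primitive_sin:
  "primitive F f \<Longrightarrow> primitive (\<lambda>x. sin (F x :: real)) (\<lambda>x. cos (F x) * f x)"
  by (rule primitive_compose[where ?\<phi>2.0 = "\<lambda>x. - sin x"]) (auto intro!: derivative_eq_intros continuous_intros)

lemma primitive_cos:
  "primitive F f \<Longrightarrow> primitive (\<lambda>x. cos (F x :: real)) (\<lambda>x. - sin (F x) * f x)"
  by (rule primitive_compose[where ?\<phi>2.0 = "\<lambda>x. - cos x"]) (auto intro!: derivative_eq_intros continuous_intros)

lemma primitive_exp:
  "primitive F f \<Longrightarrow> primitive (\<lambda>x. exp (F x :: real)) (\<lambda>x. exp (F x) * f x)"
  by (rule primitive_compose[where ?\<phi>2.0 = "exp"]) (auto intro!: derivative_eq_intros continuous_intros)

text \<open>Divides out the homogeneous part of a linear equation, so that sign and size of the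
  inhomogeneity \<open>h\<close> pass to \<open>F\<close>. This is the Gronwall argument behind all
  comparison results.\<close>

lemma integrating_factor:
  fixes c :: "real \<Rightarrow> real"
  assumes "loc_bdd_meas c" "primitive F (\<lambda>x. c x * F x + h x)"
  shows "primitive (\<lambda>x. F x * exp (- indef c x)) (\<lambda>x. h x * exp (- indef c x))"
  by (rule primitive_cong[OF primitive_mult[OF assms(2) primitive_exp[OF primitive_minus[OF primitive_indef[OF assms(1)]]]]])
     (auto simp: algebra_simps)

section \<open>Existence of the Pruefer angle\<close>

definition bdd_meas :: "(real \<Rightarrow> real) \<Rightarrow> bool" where
  "bdd_meas q \<longleftrightarrow> q \<in> borel_measurable borel \<and> (\<exists>Q. \<forall>x. \<bar>q x\<bar> \<le> Q)"

lemma bdd_meas_loc: "bdd_meas q \<Longrightarrow> loc_bdd_meas q"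
  by (auto simp: bdd_meas_def loc_bdd_meas_def)

lemma bdd_meas_bound:
  assumes "bdd_meas q" obtains K where "K \<ge> 1" "\<And>x. \<bar>1 + q x\<bar> \<le> K"
proof -
  obtain Q where Q: "\<And>x. \<bar>q x\<bar> \<le> Q" using assms by (auto simp: bdd_meas_def)
  then have "\<bar>1 + q x\<bar> \<le> 1 + \<bar>Q\<bar>" for x
    using Q[of x] by linarith
  then show ?thesis using that[of "1 + \<bar>Q\<bar>"] by auto
qed

lemma indef_bound:
  fixes f g :: "real \<Rightarrow> real"
  assumes "loc_bdd_meas f" "loc_bdd_meas g" "\<And>x. \<bar>f x\<bar> \<le> g x"
  shows "\<bar>indef f x\<bar> \<le> \<bar>indef g x\<bar>"
proof -
  note P = primitive_indef[OF assms(1)] primitive_indef[OF assms(2)]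
  have g: "- g x \<le> f x" "f x \<le> g x" for x using assms(3)[of x] by auto
  show ?thesis
  proof (cases "x \<ge> 0")
    case True
    then show ?thesis using primitive_le[OF P g(2), of 0 x] primitive_le[OF primitive_minus[OF P(2)] P(1) g(1), of 0 x] by simp
  next
    case False
    then show ?thesis using primitive_le[OF P g(2), of x 0] primitive_le[OF primitive_minus[OF P(2)] P(1) g(1), of x 0] by simp
  qed
qed

text \<open>The Pruefer angle of solutions of \<open>y'' = q y\<close>, normalised by \<open>y = r sin \<theta>\<close>, \<open>y' = r cos \<theta>\<close>.\<close>

definition prufer :: "(real \<Rightarrow> real) \<Rightarrow> (real \<Rightarrow> real) \<Rightarrow> bool" where
  "prufer q \<theta> \<longleftrightarrow> primitive \<theta> (\<lambda>x. 1 - (1 + q x) * (sin (\<theta> x))\<^sup>2)"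

lemma sin_sq_diff: "(sin a)\<^sup>2 - (sin b)\<^sup>2 = sin (a + b) * sin (a - b)" for a b :: real
proof -
  have "sin (a + b) * sin (a - b) = (sin a)\<^sup>2 * (cos b)\<^sup>2 - (cos a)\<^sup>2 * (sin b)\<^sup>2"
    by (simp add: sin_add sin_diff algebra_simps power2_eq_square)
  also have "\<dots> = (sin a)\<^sup>2 - (sin b)\<^sup>2" by (simp add: cos_squared_eq algebra_simps)
  finally show ?thesis ..
qed

lemma abs_sin_sq_diff_le: "\<bar>(sin a)\<^sup>2 - (sin b)\<^sup>2\<bar> \<le> \<bar>a - b\<bar>" for a b :: real
proof -
  have "\<bar>sin (a + b)\<bar> * \<bar>sin (a - b)\<bar> \<le> 1 * \<bar>a - b\<bar>"
    by (intro mult_mono) (auto simp: abs_sin_x_le_abs_x)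
  then show ?thesis by (simp add: sin_sq_diff abs_mult)
qed

text \<open>Picard's contraction for the weighted norm \<open>sup exp (- 2 K \<bar>x\<bar>) \<bar>\<theta> x\<bar>\<close> on the whole line.\<close>

lemma prufer_exists:
  assumes q: "bdd_meas q"
  shows "\<exists>\<theta>. prufer q \<theta> \<and> \<theta> 0 = t0"
proof -
  obtain K where K: "K \<ge> 1" "\<And>x. \<bar>1 + q x\<bar> \<le> K" using bdd_meas_bound[OF q] by blast
  have qm: "q \<in> borel_measurable borel" using q by (simp add: bdd_meas_def)
  \<comment> \<open>The unknown is
    \<open>g x = (\<theta> x - t0) / exp (2 * K * \<bar>x\<bar>)\<close>, so that the plain sup norm
    on bounded continuous functions is the weighted norm of the angle.\<close>
  define F where "F g x = 1 - (1 + q x) * (sin (t0 + exp (2 * K * \<bar>x\<bar>) * g x))\<^sup>2" for g x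
  have Fb: "norm (F g x) \<le> 1 + K" for g x
  proof -
    have "\<bar>(1 + q x) * (sin (t0 + exp (2 * K * \<bar>x\<bar>) * g x))\<^sup>2\<bar> \<le> K * 1"
      unfolding abs_mult using K by (intro mult_mono) (auto simp: abs_square_le_1)
    then show ?thesis unfolding F_def real_norm_def by linarith
  qed
  have Fm: "loc_bdd_meas (F g)" if "continuous_on UNIV g" for g
  proof (rule loc_bdd_meas_bdd)
    have [measurable]: "g \<in> borel_measurable borel" using that by (rule borel_measurable_continuous_onI)
    note [measurable] = qm
    show "F g \<in> borel_measurable borel" unfolding F_def by measurable
  qed (rule Fb)
  define W where "W x = exp (2 * K * \<bar>x\<bar>)" for x :: real
  \<comment> \<open>The rate is twice the Lipschitz constant \<open>K\<close> of the right-hand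
    side: integrating \<open>K * W\<close> gives back at most half of \<open>W\<close>, and this
    half is the contraction factor.\<close>
  have W_prim: "\<bar>indef (\<lambda>x. K * W x) x\<bar> = (W x - 1) / 2" for x
  proof -
    have cW: "continuous_on UNIV (\<lambda>x. K * W x)" unfolding W_def by (intro continuous_intros)
    note P = primitive_indef[OF loc_bdd_meas_cont[OF cW]]
    have W1: "W x \<ge> 1" using K by (simp add: W_def)
    show ?thesis
    proof (cases "x \<ge> 0")
      case True
      have "((\<lambda>x. K * W x) has_integral (exp (2*K*x) / 2 - exp (2*K*0) / 2)) {0..x}"
        by (rule fundamental_theorem_of_calculus[OF True])
           (auto intro!: derivative_eq_intros simp: W_def simp flip: has_real_derivative_iff_has_vector_derivative)
      from has_integral_unique[OF this primitiveD(1)[OF P True]]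
      have "indef (\<lambda>x. K * W x) x = (W x - 1) / 2" using True by (simp add: W_def diff_divide_distrib)
      then show ?thesis using W1 by simp
    next
      case False
      then have x0: "x \<le> 0" by simp
      have "((\<lambda>x. K * W x) has_integral (- exp (-2*K*0) / 2 - (- exp (-2*K*x) / 2))) {x..0}"
        by (rule fundamental_theorem_of_calculus[OF x0])
           (auto intro!: derivative_eq_intros simp: W_def simp flip: has_real_derivative_iff_has_vector_derivative)
      from has_integral_unique[OF this primitiveD(1)[OF P x0]]
      have "indef (\<lambda>x. K * W x) x = - ((W x - 1) / 2)" using x0 by (simp add: W_def diff_divide_distrib)
      then show ?thesis using W1 by simp
    qed
  qed
  have W_pos: "W x > 0" for x by (simp add: W_def)
  define T0 where "T0 g x = indef (F g) x / W x" for g x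
  have T0: "T0 g \<in> bcontfun" if "continuous_on UNIV g" for g
  proof (rule bcontfun_normI)
    show "continuous_on UNIV (T0 g)" unfolding T0_def W_def
      by (intro continuous_intros primitive_continuous[OF primitive_indef[OF Fm[OF that]]]) auto
    fix x
    have "\<bar>indef (F g) x\<bar> \<le> \<bar>indef (\<lambda>x. 1 + K) x\<bar>"
      using Fb by (intro indef_bound Fm that) auto
    also have "\<dots> = (1 + K) * \<bar>x\<bar>" using K by (auto simp: indef_def abs_mult)
    also have "\<dots> \<le> (1 + K) * W x"
    proof (intro mult_left_mono)
      have "\<bar>x\<bar> \<le> 2 * K * \<bar>x\<bar>" using K mult_right_mono[of 1 "2 * K" "\<bar>x\<bar>"] by simp
      also have "\<dots> \<le> W x" unfolding W_def using exp_ge_add_one_self[of "2 * K * \<bar>x\<bar>"] by linarith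
      finally show "\<bar>x\<bar> \<le> W x" .
    qed (use K in auto)
    finally show "norm (T0 g x) \<le> 1 + K" using W_pos[of x] by (simp add: T0_def field_simps)
  qed
  define T :: "(real \<Rightarrow>\<^sub>C real) \<Rightarrow> (real \<Rightarrow>\<^sub>C real)" where "T g = Bcontfun (T0 g)" for g
  have T_app: "apply_bcontfun (T g) = T0 g" for g
    unfolding T_def by (intro Bcontfun_inverse T0) auto
  have "\<exists>!g. T g = g"
  proof (rule banach_fix_type[of "1/2"])
    show "\<forall>g h. dist (T g) (T h) \<le> 1 / 2 * dist g h"
    proof (intro allI)
      fix g h :: "real \<Rightarrow>\<^sub>C real"
      define d where "d = dist g h"
      have gc: "continuous_on UNIV (apply_bcontfun g)" "continuous_on UNIV (apply_bcontfun h)" by auto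
      show "dist (T g) (T h) \<le> 1 / 2 * dist g h"
      proof (rule dist_bound)
        fix x
        have b: "\<bar>F g x - F h x\<bar> \<le> d * (K * W x)" for x
        proof -
          have "F g x - F h x = (1 + q x) * ((sin (t0 + W x * h x))\<^sup>2 - (sin (t0 + W x * g x))\<^sup>2)"
            by (simp add: F_def W_def algebra_simps)
          also have "\<bar>\<dots>\<bar> \<le> K * \<bar>(t0 + W x * h x) - (t0 + W x * g x)\<bar>"
            unfolding abs_mult by (intro mult_mono K abs_sin_sq_diff_le) (use K in auto)
          also have "\<dots> = K * (W x * \<bar>g x - h x\<bar>)"
            using W_pos[of x] by (simp add: abs_mult flip: right_diff_distrib) (simp add: abs_minus_commute)
          also have "\<dots> \<le> K * (W x * d)"
            using dist_bounded[of g x h] K W_pos[of x] by (intro mult_left_mono) (auto simp: d_def dist_real_def)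
          finally show ?thesis by (simp add: algebra_simps)
        qed
        have cW: "continuous_on UNIV (\<lambda>x. K * W x)" unfolding W_def by (intro continuous_intros)
        have "indef (F g) x - indef (F h) x = indef (\<lambda>x. F g x - F h x) x"
          using primitive_eq_indef[OF primitive_diff[OF primitive_indef[OF Fm[OF gc(1)]] primitive_indef[OF Fm[OF gc(2)]]], of x]
          by simp
        also have "\<bar>\<dots>\<bar> \<le> \<bar>indef (\<lambda>x. d * (K * W x)) x\<bar>"
          by (intro indef_bound loc_bdd_meas_diff Fm gc b loc_bdd_meas_mult loc_bdd_meas_const loc_bdd_meas_cont[OF cW])
        also have "indef (\<lambda>x. d * (K * W x)) x = d * indef (\<lambda>x. K * W x) x"
          using primitive_eq_indef[OF primitive_cmult[OF primitive_indef[OF loc_bdd_meas_cont[OF cW]]], of d x] by simp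
        also have "\<bar>d * indef (\<lambda>x. K * W x) x\<bar> = d * ((W x - 1) / 2)"
          by (simp add: abs_mult W_prim d_def)
        also have "\<dots> \<le> d * (W x / 2)" by (intro mult_left_mono) (auto simp: d_def)
        finally show "dist (apply_bcontfun (T g) x) (apply_bcontfun (T h) x) \<le> 1 / 2 * dist g h"
          using W_pos[of x] by (simp add: T_app T0_def dist_real_def d_def diff_divide_distrib[symmetric] abs_divide field_simps)
      qed
    qed
  qed auto
  then obtain g where g: "T g = g" by blast
  define \<theta> where "\<theta> x = t0 + W x * apply_bcontfun g x" for x
  have gx: "W x * apply_bcontfun g x = indef (F g) x" for x
    using T_app[of g] W_pos[of x] unfolding g T0_def by (simp add: fun_eq_iff field_simps)
  have "primitive (\<lambda>x. t0 + indef (F g) x) (\<lambda>x. 0 + F g x)"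
    by (intro primitive_add primitive_const primitive_indef Fm) auto
  then have "prufer q \<theta>" unfolding prufer_def
    by (rule primitive_cong) (auto simp: \<theta>_def gx F_def W_def simp flip: W_def)
  moreover have "\<theta> 0 = t0" unfolding \<theta>_def gx by simp
  ultimately show ?thesis by blast
qed

section \<open>Comparison of Pruefer angles and linear solutions\<close>

text \<open>Through the difference quotient of \<open>sin^2\<close>, the difference of two angles
  solves a linear equation with bounded coefficient \<open>c\<close>, whose inhomogeneity carries
  the sign of \<open>q1 - q2\<close>.\<close>

lemma prufer_diff:
  assumes "bdd_meas q1" "bdd_meas q2" "prufer q1 \<theta>1" "prufer q2 \<theta>2"
  obtains c where "loc_bdd_meas c" "\<And>x. \<bar>c x\<bar> \<le> \<bar>1 + q2 x\<bar>"
    "primitive (\<lambda>x. \<theta>2 x - \<theta>1 x) (\<lambda>x. c x * (\<theta>2 x - \<theta>1 x) + (q1 x - q2 x) * (sin (\<theta>1 x))\<^sup>2)"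
proof -
  \<comment> \<open>Where the angles agree the quotient is \<open>0 / 0 = 0\<close>; this is
    harmless because \<open>c\<close> is multiplied by the vanishing difference.\<close>
  define c where "c x = - (1 + q2 x) * (sin (\<theta>2 x + \<theta>1 x) * (sin (\<theta>2 x - \<theta>1 x) / (\<theta>2 x - \<theta>1 x)))" for x
  have [measurable]: "q1 \<in> borel_measurable borel" "q2 \<in> borel_measurable borel"
    "\<theta>1 \<in> borel_measurable borel" "\<theta>2 \<in> borel_measurable borel"
    using assms primitive_loc_bdd_meas loc_bdd_measD by (auto simp: bdd_meas_def prufer_def)
  have cb: "\<bar>c x\<bar> \<le> \<bar>1 + q2 x\<bar>" for x
  proof -
    have "\<bar>sin (\<theta>2 x + \<theta>1 x)\<bar> * (\<bar>sin (\<theta>2 x - \<theta>1 x)\<bar> / \<bar>\<theta>2 x - \<theta>1 x\<bar>) \<le> 1 * 1"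
    proof (intro mult_mono)
      show "\<bar>sin (\<theta>2 x - \<theta>1 x)\<bar> / \<bar>\<theta>2 x - \<theta>1 x\<bar> \<le> 1"
        using abs_sin_x_le_abs_x[of "\<theta>2 x - \<theta>1 x"] by (simp add: divide_le_eq_1)
    qed auto
    then have "\<bar>1 + q2 x\<bar> * (\<bar>sin (\<theta>2 x + \<theta>1 x)\<bar> * (\<bar>sin (\<theta>2 x - \<theta>1 x)\<bar> / \<bar>\<theta>2 x - \<theta>1 x\<bar>)) \<le> \<bar>1 + q2 x\<bar> * 1"
      by (intro mult_left_mono) auto
    moreover have "\<bar>c x\<bar> = \<bar>1 + q2 x\<bar> * (\<bar>sin (\<theta>2 x + \<theta>1 x)\<bar> * (\<bar>sin (\<theta>2 x - \<theta>1 x)\<bar> / \<bar>\<theta>2 x - \<theta>1 x\<bar>))"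
      unfolding c_def abs_mult abs_divide abs_minus_cancel by simp
    ultimately show ?thesis by simp
  qed
  obtain K where K: "\<And>x. \<bar>1 + q2 x\<bar> \<le> K" using bdd_meas_bound[OF assms(2)] by blast
  have "loc_bdd_meas c"
  proof (rule loc_bdd_meas_bdd[where B=K])
    show "c \<in> borel_measurable borel" unfolding c_def by measurable
    show "norm (c x) \<le> K" for x using cb[of x] K[of x] by simp
  qed
  moreover have "primitive (\<lambda>x. \<theta>2 x - \<theta>1 x) (\<lambda>x. c x * (\<theta>2 x - \<theta>1 x) + (q1 x - q2 x) * (sin (\<theta>1 x))\<^sup>2)"
  proof (rule primitive_cong[OF primitive_diff[OF assms(4,3)[unfolded prufer_def]]])
    fix x
    have "c x * (\<theta>2 x - \<theta>1 x) = - (1 + q2 x) * ((sin (\<theta>2 x))\<^sup>2 - (sin (\<theta>1 x))\<^sup>2)"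
      unfolding sin_sq_diff by (cases "\<theta>2 x = \<theta>1 x") (simp_all add: c_def)
    then show "1 - (1 + q2 x) * (sin (\<theta>2 x))\<^sup>2 - (1 - (1 + q1 x) * (sin (\<theta>1 x))\<^sup>2) =
         c x * (\<theta>2 x - \<theta>1 x) + (q1 x - q2 x) * (sin (\<theta>1 x))\<^sup>2"
      by (simp add: algebra_simps)
  qed simp
  ultimately show ?thesis using that cb by blast
qed

text \<open>Lowering the potential makes the inhomogeneity nonnegative, so the difference times a
  positive integrating factor cannot decrease. An ordering of the angles, strict or not, therefore
  propagates forward.\<close>

lemma prufer_mono_factor:
  assumes "bdd_meas q1" "bdd_meas q2" "prufer q1 \<theta>1" "prufer q2 \<theta>2" "\<And>x. q2 x \<le> q1 x"
  obtains E :: "real \<Rightarrow> real" where "\<And>x. E x > 0" "\<And>x y. x \<le> y \<Longrightarrow> (\<theta>2 x - \<theta>1 x) * E x \<le> (\<theta>2 y - \<theta>1 y) * E y"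
proof -
  obtain c where c: "loc_bdd_meas c"
    "primitive (\<lambda>x. \<theta>2 x - \<theta>1 x) (\<lambda>x. c x * (\<theta>2 x - \<theta>1 x) + (q1 x - q2 x) * (sin (\<theta>1 x))\<^sup>2)"
    using prufer_diff[OF assms(1-4)] by blast
  have "(\<theta>2 x - \<theta>1 x) * exp (- indef c x) \<le> (\<theta>2 y - \<theta>1 y) * exp (- indef c y)" if "x \<le> y" for x y
    by (rule primitive_mono[OF integrating_factor[OF c] _ that]) (use assms(5) in auto)
  then show ?thesis using that[of "\<lambda>x. exp (- indef c x)"] by simp
qed

lemma prufer_le:
  assumes "bdd_meas q1" "bdd_meas q2" "prufer q1 \<theta>1" "prufer q2 \<theta>2" "\<And>x. q2 x \<le> q1 x"
    "\<theta>1 s \<le> \<theta>2 s" "s \<le> x"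
  shows "\<theta>1 x \<le> \<theta>2 x"
proof -
  obtain E where E: "\<And>x. E x > 0" "\<And>x y. x \<le> y \<Longrightarrow> (\<theta>2 x - \<theta>1 x) * E x \<le> (\<theta>2 y - \<theta>1 y) * E y"
    using prufer_mono_factor[OF assms(1-5)] by blast
  have "0 \<le> (\<theta>2 s - \<theta>1 s) * E s" using assms(6) E(1)[of s] by simp
  also have "\<dots> \<le> (\<theta>2 x - \<theta>1 x) * E x" using E(2) assms(7) by blast
  finally show ?thesis using E(1)[of x] by (simp add: zero_le_mult_iff)
qed

lemma prufer_less:
  assumes "bdd_meas q1" "bdd_meas q2" "prufer q1 \<theta>1" "prufer q2 \<theta>2" "\<And>x. q2 x \<le> q1 x"
    "\<theta>1 s < \<theta>2 s" "s \<le> x"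
  shows "\<theta>1 x < \<theta>2 x"
proof -
  obtain E where E: "\<And>x. E x > 0" "\<And>x y. x \<le> y \<Longrightarrow> (\<theta>2 x - \<theta>1 x) * E x \<le> (\<theta>2 y - \<theta>1 y) * E y"
    using prufer_mono_factor[OF assms(1-5)] by blast
  have "0 < (\<theta>2 s - \<theta>1 s) * E s" using assms(6) E(1)[of s] by simp
  also have "\<dots> \<le> (\<theta>2 x - \<theta>1 x) * E x" using E(2) assms(7) by blast
  finally show ?thesis using E(1)[of x] by (simp add: zero_less_mult_iff)
qed

text \<open>The integrand of \<open>sin \<theta> * cos \<theta>\<close> equals
  \<open>cos^2 \<theta> = 1\<close> wherever \<open>sin \<theta> = 0\<close>, while the function
  itself vanishes there. So the zeros of a solution cannot fill an interval.\<close>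

lemma prufer_sin_not_zero_on:
  assumes q: "bdd_meas q" and p: "prufer q \<theta>" and "s < x" and z: "\<And>y. s < y \<Longrightarrow> y < x \<Longrightarrow> sin (\<theta> y) = 0"
  shows False
proof -
  \<comment> \<open>The hypothesis says nothing at \<open>s\<close> and \<open>x\<close>; the middle
    third has its endpoints strictly inside.\<close>
  define s' x' where "s' = (2 * s + x) / 3" and "x' = (s + 2 * x) / 3"
  have sx: "s' < x'" "s < s'" "x' < x" using \<open>s < x\<close> by (auto simp: s'_def x'_def)
  note P = p[unfolded prufer_def]
  have "((\<lambda>y. cos (\<theta> y) * (1 - (1 + q y) * (sin (\<theta> y))\<^sup>2) * cos (\<theta> y)
      + sin (\<theta> y) * (- sin (\<theta> y) * (1 - (1 + q y) * (sin (\<theta> y))\<^sup>2))) has_integral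
     sin (\<theta> x') * cos (\<theta> x') - sin (\<theta> s') * cos (\<theta> s')) {s'..x'}"
    by (rule primitiveD(1)[OF primitive_mult[OF primitive_sin[OF P] primitive_cos[OF P]]]) (use sx in auto)
  moreover have "sin (\<theta> x') = 0" "sin (\<theta> s') = 0" using sx by (auto intro!: z)
  ultimately have "((\<lambda>y. cos (\<theta> y) * (1 - (1 + q y) * (sin (\<theta> y))\<^sup>2) * cos (\<theta> y)
      + sin (\<theta> y) * (- sin (\<theta> y) * (1 - (1 + q y) * (sin (\<theta> y))\<^sup>2))) has_integral 0) {s'..x'}"
    by simp
  then have "((\<lambda>y. 1::real) has_integral 0) {s'..x'}"
  proof (rule has_integral_eq[rotated])
    fix y assume "y \<in> {s'..x'}"
    then have "sin (\<theta> y) = 0" using sx by (intro z) auto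
    moreover from this have "cos (\<theta> y) * cos (\<theta> y) = 1"
      using sin_cos_squared_add[of "\<theta> y"] by (simp add: power2_eq_square)
    ultimately show "cos (\<theta> y) * (1 - (1 + q y) * (sin (\<theta> y))\<^sup>2) * cos (\<theta> y)
      + sin (\<theta> y) * (- sin (\<theta> y) * (1 - (1 + q y) * (sin (\<theta> y))\<^sup>2)) = 1" by simp
  qed
  moreover have "((\<lambda>y. 1::real) has_integral (x' - s')) {s'..x'}"
    using has_integral_const_real[of "1::real" s' x'] sx by simp
  ultimately have "0 = x' - s'" by (rule has_integral_unique)
  then show False using sx by simp
qed

text \<open>Without strictness at \<open>x\<close> the angles would agree on all of
  \<open>[s, x]\<close>, since a strict inequality persists. Then the inhomogeneity, at least
  \<open>\<eta> * sin^2 \<theta>1\<close>, integrates to nothing, and \<open>sin \<theta>1\<close>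
  vanishes on an interval.\<close>

lemma prufer_strict:
  assumes q: "bdd_meas q1" "bdd_meas q2" "prufer q1 \<theta>1" "prufer q2 \<theta>2"
    and d: "\<eta> > 0" "\<And>x. q2 x + \<eta> \<le> q1 x" and s: "\<theta>1 s \<le> \<theta>2 s" "s < x"
  shows "\<theta>1 x < \<theta>2 x"
proof (rule ccontr)
  assume "\<not> \<theta>1 x < \<theta>2 x"
  have le: "q2 x \<le> q1 x" for x using d(2)[of x] d(1) by simp
  have eq: "\<theta>1 y = \<theta>2 y" if "s \<le> y" "y \<le> x" for y
  proof (rule antisym)
    show "\<theta>1 y \<le> \<theta>2 y" by (rule prufer_le[OF q le s(1) that(1)])
    show "\<theta>2 y \<le> \<theta>1 y" using prufer_less[OF q le _ that(2)] \<open>\<not> \<theta>1 x < \<theta>2 x\<close> by (meson not_le_imp_less)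
  qed
  obtain c where c: "primitive (\<lambda>x. \<theta>2 x - \<theta>1 x) (\<lambda>x. c x * (\<theta>2 x - \<theta>1 x) + (q1 x - q2 x) * (sin (\<theta>1 x))\<^sup>2)"
    using prufer_diff[OF q] by blast
  have ct: "continuous_on UNIV \<theta>1" using q(3) primitive_continuous by (auto simp: prufer_def)
  have cs: "continuous_on UNIV (\<lambda>x. \<eta> * (sin (\<theta>1 x))\<^sup>2)" by (intro continuous_intros ct)
  define P where "P = indef (\<lambda>x. \<eta> * (sin (\<theta>1 x))\<^sup>2)"
  have P: "primitive P (\<lambda>x. \<eta> * (sin (\<theta>1 x))\<^sup>2)" unfolding P_def by (rule primitive_indef[OF loc_bdd_meas_cont[OF cs]])
  have Pm: "P a \<le> P b" if "a \<le> b" for a b by (rule primitive_mono[OF P _ that]) (use d in auto)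
  have "P x - P s \<le> (\<theta>2 x - \<theta>1 x) - (\<theta>2 s - \<theta>1 s)"
  proof (rule primitive_le[OF P c])
    fix y assume "s \<le> y" "y \<le> x"
    then show "\<eta> * (sin (\<theta>1 y))\<^sup>2 \<le> c y * (\<theta>2 y - \<theta>1 y) + (q1 y - q2 y) * (sin (\<theta>1 y))\<^sup>2"
      using eq[of y] d(2)[of y] by (auto intro!: mult_right_mono)
  qed (use s in auto)
  then have Pxs: "P x \<le> P s" using eq s by simp
  show False
  proof (rule prufer_sin_not_zero_on[OF q(1,3) s(2)])
    fix y assume y: "s < y" "y < x"
    have "(P has_real_derivative \<eta> * (sin (\<theta>1 y))\<^sup>2) (at y)" by (rule primitive_real_derivative[OF P cs])
    moreover have "(P has_real_derivative 0) (at y)"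
    proof (rule has_field_derivative_transform_within_open[of "\<lambda>x. P s" 0 y "{s<..<x}"])
      show "P s = P z" if "z \<in> {s<..<x}" for z using that Pm[of s z] Pm[of z x] Pxs by force
    qed (use y in auto)
    ultimately have "\<eta> * (sin (\<theta>1 y))\<^sup>2 = 0" by (rule DERIV_unique)
    then show "sin (\<theta>1 y) = 0" using d by simp
  qed
qed

text \<open>Both the integrating factor and its inverse are at most \<open>exp (K * L)\<close>,
  which accounts for the exponent \<open>2 * K * L\<close>. Being linear in \<open>\<eta>\<close>
  and uniform in the initial angle, the bound yields Lipschitz dependence on the spectral
  parameter.\<close>

lemma prufer_dist:
  assumes q: "bdd_meas q1" "bdd_meas q2" "prufer q1 \<theta>1" "prufer q2 \<theta>2"
    and K: "\<And>x. \<bar>1 + q2 x\<bar> \<le> K" and \<eta>: "\<And>x. \<bar>q1 x - q2 x\<bar> \<le> \<eta>" and x: "0 \<le> x" "x \<le> L"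
  shows "\<bar>\<theta>2 x - \<theta>1 x\<bar> \<le> exp (2 * K * L) * (\<bar>\<theta>2 0 - \<theta>1 0\<bar> + \<eta> * L)"
proof -
  obtain c where c: "loc_bdd_meas c" "\<And>x. \<bar>c x\<bar> \<le> \<bar>1 + q2 x\<bar>"
    "primitive (\<lambda>x. \<theta>2 x - \<theta>1 x) (\<lambda>x. c x * (\<theta>2 x - \<theta>1 x) + (q1 x - q2 x) * (sin (\<theta>1 x))\<^sup>2)"
    using prufer_diff[OF q] by blast
  have K0: "K \<ge> 0" "\<eta> \<ge> 0" using K[of 0] \<eta>[of 0] by auto
  have C: "\<bar>indef c y\<bar> \<le> K * L" if y: "0 \<le> y" "y \<le> L" for y
  proof -
    have "\<bar>indef c y\<bar> \<le> \<bar>indef (\<lambda>x. K) y\<bar>"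
      by (rule indef_bound[OF c(1) loc_bdd_meas_const]) (rule order_trans[OF c(2) K])
    also have "\<dots> = K * y" using y K0 by (auto simp: indef_def)
    also have "\<dots> \<le> K * L" using y K0 by (intro mult_left_mono)
    finally show ?thesis .
  qed
  define G where "G x = (\<theta>2 x - \<theta>1 x) * exp (- indef c x)" for x
  have G: "primitive G (\<lambda>x. (q1 x - q2 x) * (sin (\<theta>1 x))\<^sup>2 * exp (- indef c x))"
    unfolding G_def by (rule integrating_factor[OF c(1,3)])
  have "norm (G x - G 0) \<le> (\<eta> * exp (K * L)) * measure lborel {0..x}"
  proof (rule has_integral_bound_real[OF _ finite.emptyI primitiveD(1)[OF G x(1)]])
    fix y assume "y \<in> {0..x} - {}"
    then have y: "0 \<le> y" "y \<le> L" using x by auto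
    have "\<bar>q1 y - q2 y\<bar> * (sin (\<theta>1 y))\<^sup>2 * exp (- indef c y) \<le> \<eta> * 1 * exp (K * L)"
      by (intro mult_mono \<eta>) (use C[OF y] K0 in \<open>auto simp: abs_square_le_1\<close>)
    then show "norm ((q1 y - q2 y) * (sin (\<theta>1 y))\<^sup>2 * exp (- indef c y)) \<le> \<eta> * exp (K * L)"
      by (simp add: abs_mult)
  qed (use K0 in auto)
  also have "\<dots> \<le> \<eta> * exp (K * L) * L" using x K0 by (simp add: mult_left_mono)
  finally have 1: "\<bar>G x\<bar> \<le> \<bar>\<theta>2 0 - \<theta>1 0\<bar> + \<eta> * exp (K * L) * L" by (simp add: G_def)
  also have "\<dots> \<le> exp (K * L) * \<bar>\<theta>2 0 - \<theta>1 0\<bar> + \<eta> * exp (K * L) * L"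
    using K0 x by (simp add: mult_le_cancel_right1)
  finally have "\<bar>G x\<bar> \<le> exp (K * L) * (\<bar>\<theta>2 0 - \<theta>1 0\<bar> + \<eta> * L)" by (simp add: algebra_simps)
  moreover have "\<bar>\<theta>2 x - \<theta>1 x\<bar> = \<bar>G x\<bar> * exp (indef c x)" by (simp add: G_def abs_mult exp_minus)
  moreover have "exp (indef c x) \<le> exp (K * L)" using C[OF x] by auto
  ultimately have "\<bar>\<theta>2 x - \<theta>1 x\<bar> \<le> exp (K * L) * (\<bar>\<theta>2 0 - \<theta>1 0\<bar> + \<eta> * L) * exp (K * L)"
    using K0 x by (auto intro!: mult_mono)
  then show ?thesis by (simp add: mult_exp_exp algebra_simps flip: mult.assoc)
qed

definition th :: "(real \<Rightarrow> real) \<Rightarrow> real \<Rightarrow> real \<Rightarrow> real" where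
  "th q t = (SOME \<theta>. prufer q \<theta> \<and> \<theta> 0 = t)"

lemma th: assumes "bdd_meas q" shows "prufer q (th q t)" "th q t 0 = t"
  using someI_ex[OF prufer_exists[OF assms, of t]] by (auto simp: th_def)

text \<open>Forward, this is comparison in both directions; backward, angles that differ at
  \<open>x\<close> would by \<open>prufer_less\<close> still differ at the later point
  \<open>s\<close>.\<close>

lemma prufer_unique:
  assumes q: "bdd_meas q" "prufer q \<theta>" "prufer q \<theta>'" "\<theta> s = \<theta>' s" shows "\<theta> x = \<theta>' x"
proof (cases "s \<le> x")
  case True
  then show ?thesis using prufer_le[OF q(1,1,2,3), of s x] prufer_le[OF q(1,1,3,2), of s x] q(4) by simp
next
  case False
  then show ?thesis using prufer_less[OF q(1,1,2,3), of x s] prufer_less[OF q(1,1,3,2), of x s] q(4)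
    by (cases "\<theta> x" "\<theta>' x" rule: linorder_cases) auto
qed

lemma th_eq: "bdd_meas q \<Longrightarrow> prufer q \<theta> \<Longrightarrow> \<theta> x = th q (\<theta> 0) x"
  using prufer_unique[of q \<theta> "th q (\<theta> 0)" 0 x] th by simp

lemma prufer_add_pi_int:
  assumes "prufer q \<theta>" shows "prufer q (\<lambda>x. \<theta> x + of_int k * pi)"
proof -
  have s: "sin (of_int k * pi) = 0" by (auto simp: sin_zero_iff_int2)
  then have "(cos (of_int k * pi))\<^sup>2 = 1" using sin_cos_squared_add[of "of_int k * pi"] by simp
  then have "(sin (a + of_int k * pi))\<^sup>2 = (sin a)\<^sup>2" for a
    by (simp add: sin_add s power_mult_distrib)
  then show ?thesis using primitive_add[OF assms[unfolded prufer_def] primitive_const[of "of_int k * pi"]]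
    by (simp add: prufer_def)
qed

lemma prufer_shift:
  assumes "prufer q \<theta>" "\<And>x. q (x + X) = q x" shows "prufer q (\<lambda>x. \<theta> (x + X))"
  using primitive_shift[OF assms(1)[unfolded prufer_def], of X] assms(2) by (simp add: prufer_def)

lemma th_add_pi_int:
  assumes "bdd_meas q" shows "th q (t + of_int k * pi) x = th q t x + of_int k * pi"
  using th_eq[OF assms prufer_add_pi_int[OF th(1)[OF assms]], where x=x] by (simp add: th[OF assms])

text \<open>At multiples of \<open>\<pi>\<close> the angle has slope \<open>1\<close>, so it crosses them upwards only.\<close>

lemma prufer_cross:
  assumes q: "bdd_meas q" "prufer q \<theta>" "\<theta> s = of_int k * pi" "s < x" shows "\<theta> x > of_int k * pi"
proof -
  obtain K where K: "K \<ge> 1" "\<And>x. \<bar>1 + q x\<bar> \<le> K" using bdd_meas_bound[OF q(1)] by blast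
  have qK: "q y \<le> K * K" for y using abs_le_D1[OF K(2)[of y]] mult_right_mono[OF K(1), of K] K(1) by linarith
  have c: "bdd_meas (\<lambda>x. K * K)" by (auto simp: bdd_meas_def)
  \<comment> \<open>\<open>\<psi>\<close> is the angle of \<open>sinh (K * (x - s)) / K\<close>,
    which solves \<open>y'' = K^2 y\<close> and vanishes at \<open>s\<close>. Its potential
    \<open>K * K\<close> dominates \<open>q\<close>, so it is a lower barrier that is positive to
    the right of \<open>s\<close>.\<close>
  define \<psi> where "\<psi> x = arctan (tanh (K * (x - s)) / K)" for x :: real
  have d: "(\<psi> has_real_derivative (1 - (1 + K * K) * (sin (\<psi> y))\<^sup>2)) (at y)" for y
  proof -
    define T where "T = tanh (K * (y - s)) / K"
    have n: "1 + T\<^sup>2 \<noteq> 0" using zero_le_power2[of T] by linarith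
    have "(\<psi> has_real_derivative ((1 - (tanh (K * (y - s)))\<^sup>2) / (1 + T\<^sup>2))) (at y)"
      unfolding \<psi>_def by (auto intro!: derivative_eq_intros simp: T_def divide_inverse) (use K in auto)
    moreover have "(1 - (tanh (K * (y - s)))\<^sup>2) / (1 + T\<^sup>2) = 1 - (1 + K * K) * (sin (\<psi> y))\<^sup>2"
    proof -
      have "(sin (\<psi> y))\<^sup>2 = T\<^sup>2 / (1 + T\<^sup>2)"
        using n by (simp add: \<psi>_def sin_arctan T_def[symmetric] power_divide)
      moreover have "tanh (K * (y - s)) = K * T" using K by (simp add: T_def)
      ultimately show ?thesis using n by (simp add: field_simps power2_eq_square)
    qed
    ultimately show ?thesis by simp
  qed
  have p: "prufer (\<lambda>x. K * K) \<psi>" unfolding prufer_def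
  proof (rule primitive_deriv)
    have "continuous_on UNIV \<psi>" using d by (intro continuous_at_imp_continuous_on) (auto intro: DERIV_isCont)
    then show "continuous_on UNIV (\<lambda>x. 1 - (1 + K * K) * (sin (\<psi> x))\<^sup>2)" by (intro continuous_intros)
  qed (use d in \<open>simp add: has_real_derivative_iff_has_vector_derivative\<close>)
  have "\<psi> s + of_int k * pi \<le> \<theta> s" using q(3) by (simp add: \<psi>_def)
  then have "\<psi> x + of_int k * pi \<le> \<theta> x"
    by (rule prufer_le[OF c q(1) prufer_add_pi_int[OF p] q(2) qK]) (use q(4) in simp)
  moreover have "\<psi> x > 0" using K q(4) by (simp add: \<psi>_def)
  ultimately show ?thesis by simp
qed

section \<open>Linear solutions in polar form\<close>

definition sol :: "(real \<Rightarrow> real) \<Rightarrow> (real \<Rightarrow> 'a::{real_normed_field,euclidean_space}) \<Rightarrow> (real \<Rightarrow> 'a) \<Rightarrow> bool" where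
  "sol q y y1 \<longleftrightarrow> primitive y y1 \<and> primitive y1 (\<lambda>x. of_real (q x) * y x)"

lemma wronskian_primitive:
  fixes y z :: "real \<Rightarrow> 'a::{real_normed_field,euclidean_space}"
  assumes "sol p y y1" "sol q z z1"
  shows "primitive (\<lambda>x. y1 x * z x - y x * z1 x) (\<lambda>x. of_real (p x - q x) * (y x * z x))"
  by (rule primitive_cong[OF primitive_diff[OF
      primitive_mult[of y1 "\<lambda>x. of_real (p x) * y x" z z1] primitive_mult[of y y1 z1 "\<lambda>x. of_real (q x) * z x"]]])
     (use assms in \<open>auto simp: sol_def algebra_simps\<close>)

lemma wronskian_const:
  fixes y z :: "real \<Rightarrow> 'a::{real_normed_field,euclidean_space}"
  assumes "sol q y y1" "sol q z z1"
  shows "y1 x * z x - y x * z1 x = y1 s * z s - y s * z1 s"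
  using primitive_0_const[of "\<lambda>x. y1 x * z x - y x * z1 x" x s] wronskian_primitive[OF assms] by simp

lemma sol_of_real: "sol q y y1 \<Longrightarrow> sol q (\<lambda>x. of_real (y x)) (\<lambda>x. of_real (y1 x))"
  unfolding sol_def using primitive_of_real[of y y1] primitive_of_real[of y1 "\<lambda>x. q x * y x"]
  by simp

lemma sol_shift: "sol q y y1 \<Longrightarrow> (\<And>x. q (x + X) = q x) \<Longrightarrow> sol q (\<lambda>x. y (x + X)) (\<lambda>x. y1 (x + X))"
  unfolding sol_def using primitive_shift[of y y1 X] primitive_shift[of y1 "\<lambda>x. of_real (q x) * y x" X] by simp

lemma sol_cmult: "sol q y y1 \<Longrightarrow> sol q (\<lambda>x. c * y x) (\<lambda>x. c * y1 x)"
  unfolding sol_def using primitive_cmult[of y y1 c] primitive_cmult[of y1 "\<lambda>x. of_real (q x) * y x" c]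
  by (simp add: algebra_simps)

lemma sol_add: "sol q y y1 \<Longrightarrow> sol q z z1 \<Longrightarrow> sol q (\<lambda>x. y x + z x) (\<lambda>x. y1 x + z1 x)"
  unfolding sol_def using primitive_add[of y y1 z z1]
    primitive_add[of y1 "\<lambda>x. of_real (q x) * y x" z1 "\<lambda>x. of_real (q x) * z x"]
  by (simp add: algebra_simps)

text \<open>Logarithm of the Pruefer radius, zero at the origin: from
  \<open>r^2 = y^2 + y'^2\<close> and \<open>y'' = q y\<close> one gets
  \<open>r' / r = (1 + q) sin \<theta> cos \<theta>\<close>. Working with the logarithm keeps the
  radius positive.\<close>

definition log_rad :: "(real \<Rightarrow> real) \<Rightarrow> real \<Rightarrow> real \<Rightarrow> real" where
  "log_rad q t = indef (\<lambda>x. (1 + q x) * (sin (th q t x) * cos (th q t x)))"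

definition ysol :: "(real \<Rightarrow> real) \<Rightarrow> real \<Rightarrow> real \<Rightarrow> real" where
  "ysol q t x = exp (log_rad q t x) * sin (th q t x)"

definition ysol1 :: "(real \<Rightarrow> real) \<Rightarrow> real \<Rightarrow> real \<Rightarrow> real" where
  "ysol1 q t x = exp (log_rad q t x) * cos (th q t x)"

lemma th_loc: "bdd_meas q \<Longrightarrow> primitive (th q t) (\<lambda>x. 1 - (1 + q x) * (sin (th q t x))\<^sup>2)"
  using th(1) by (simp add: prufer_def)

lemma log_rad:
  assumes "bdd_meas q"
  shows "primitive (log_rad q t) (\<lambda>x. (1 + q x) * (sin (th q t x) * cos (th q t x)))"
  unfolding log_rad_def
  by (intro primitive_indef loc_bdd_meas_mult loc_bdd_meas_add loc_bdd_meas_const bdd_meas_loc assms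
      primitive_loc_bdd_meas[OF primitive_sin[OF th_loc]] primitive_loc_bdd_meas[OF primitive_cos[OF th_loc]])

lemma ysol_sol:
  assumes "bdd_meas q" shows "sol q (ysol q t) (ysol1 q t)"
  unfolding sol_def
proof
  note E = primitive_exp[OF log_rad[OF assms, of t]]
  show "primitive (ysol q t) (ysol1 q t)"
  proof (rule primitive_cong[OF primitive_mult[OF E primitive_sin[OF th_loc[OF assms, of t]]]])
    fix x
    show "exp (log_rad q t x) * ((1 + q x) * (sin (th q t x) * cos (th q t x))) * sin (th q t x) +
         exp (log_rad q t x) * (cos (th q t x) * (1 - (1 + q x) * (sin (th q t x))\<^sup>2)) = ysol1 q t x"
      by (simp add: ysol1_def algebra_simps power2_eq_square)
  qed (simp add: ysol_def)
  show "primitive (ysol1 q t) (\<lambda>x. of_real (q x) * ysol q t x)"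
  proof (rule primitive_cong[OF primitive_mult[OF E primitive_cos[OF th_loc[OF assms, of t]]]])
    fix x
    define s c where "s = sin (th q t x)" and "c = cos (th q t x)"
    have "c\<^sup>2 = 1 - s\<^sup>2" by (simp add: s_def c_def cos_squared_eq)
    then have "((1 + q x) * (s * c)) * c + (- s * (1 - (1 + q x) * s\<^sup>2)) = q x * s" by algebra
    then have "exp (log_rad q t x) * (((1 + q x) * (s * c)) * c + (- s * (1 - (1 + q x) * s\<^sup>2))) = exp (log_rad q t x) * (q x * s)"
      by simp
    then show "exp (log_rad q t x) * ((1 + q x) * (sin (th q t x) * cos (th q t x))) * cos (th q t x) +
         exp (log_rad q t x) * (- sin (th q t x) * (1 - (1 + q x) * (sin (th q t x))\<^sup>2)) = of_real (q x) * ysol q t x"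
      by (simp add: ysol_def s_def c_def algebra_simps)
  qed (simp add: ysol1_def)
qed

lemma ysol_0: "bdd_meas q \<Longrightarrow> ysol q t 0 = sin t" "bdd_meas q \<Longrightarrow> ysol1 q t 0 = cos t"
  by (simp_all add: ysol_def ysol1_def log_rad_def th)

text \<open>The Wronskians of \<open>y\<close> with the solutions of initial angle \<open>0\<close>
  and \<open>pi / 2\<close> are constant and equal its initial data up to sign; the mutual Wronskian
  of these two is \<open>1\<close>, so the linear system can be inverted. This is also uniqueness
  for the initial value problem.\<close>

lemma sol_repr:
  fixes y :: "real \<Rightarrow> 'a::{real_normed_field,euclidean_space}"
  assumes q: "bdd_meas q" and y: "sol q y y1"
  shows "y x = y 0 * of_real (ysol q (pi/2) x) + y1 0 * of_real (ysol q 0 x)"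
    and "y1 x = y 0 * of_real (ysol1 q (pi/2) x) + y1 0 * of_real (ysol1 q 0 x)"
proof -
  let ?f = "\<lambda>t x. of_real (ysol q t x) :: 'a" and ?g = "\<lambda>t x. of_real (ysol1 q t x) :: 'a"
  note S = sol_of_real[OF ysol_sol[OF q], where 'a='a]
  have 1: "y1 x * ?f 0 x - y x * ?g 0 x = - y 0"
    using wronskian_const[OF y S, of x 0 0] by (simp add: ysol_0[OF q])
  have 2: "y1 x * ?f (pi/2) x - y x * ?g (pi/2) x = y1 0"
    using wronskian_const[OF y S, of x "pi/2" 0] by (simp add: ysol_0[OF q])
  have 3: "?g 0 x * ?f (pi/2) x - ?f 0 x * ?g (pi/2) x = 1"
    using wronskian_const[OF S S, of 0 x "pi/2" 0] by (simp add: ysol_0[OF q])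
  show "y x = y 0 * ?f (pi/2) x + y1 0 * ?f 0 x" using 1 2 3 by algebra
  show "y1 x = y 0 * ?g (pi/2) x + y1 0 * ?g 0 x" using 1 2 3 by algebra
qed

lemma ysol_repr:
  assumes q: "bdd_meas q"
  shows "ysol q t x = sin t * ysol q (pi/2) x + cos t * ysol q 0 x"
    and "ysol1 q t x = sin t * ysol1 q (pi/2) x + cos t * ysol1 q 0 x"
  using sol_repr[OF q ysol_sol[OF q, of t], of x] by (simp_all add: ysol_0[OF q])

text \<open>Turns exact Wronskian identities into statements about the sign of an angle difference,
  as long as that difference is smaller than \<open>pi\<close>.\<close>

lemma wronskian_polar:
  "ysol1 p s x * ysol q t x - ysol p s x * ysol1 q t x
   = exp (log_rad p s x + log_rad q t x) * sin (th q t x - th p s x)"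
  by (simp add: ysol_def ysol1_def sin_diff exp_add algebra_simps)

lemma sin_cos_diff_le: "\<bar>sin a * cos a - sin b * cos b\<bar> \<le> \<bar>a - b\<bar>" for a b :: real
proof -
  have "(cos a)\<^sup>2 + (sin a)\<^sup>2 = 1" "(cos b)\<^sup>2 + (sin b)\<^sup>2 = 1" by simp_all
  then have "sin a * cos a - sin b * cos b = cos (a + b) * sin (a - b)"
    unfolding cos_add sin_diff by algebra
  moreover have "\<bar>cos (a + b)\<bar> * \<bar>sin (a - b)\<bar> \<le> 1 * \<bar>a - b\<bar>"
    by (intro mult_mono) (auto simp: abs_sin_x_le_abs_x)
  ultimately show ?thesis by (simp add: abs_mult)
qed

text \<open>The angles are close by \<open>prufer_dist\<close>; then so are the integrands of the
  logarithmic radii, and continuity of \<open>exp\<close> at \<open>0\<close> carries this over to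
  the solutions, uniformly on \<open>[0, L]\<close>.\<close>

lemma ysol_continuous_dependence:
  assumes q: "bdd_meas q" and L: "L \<ge> 0" and e: "e > 0"
  obtains d where "d > 0" "\<And>p x. bdd_meas p \<Longrightarrow> (\<And>x. \<bar>p x - q x\<bar> \<le> d) \<Longrightarrow> 0 \<le> x \<Longrightarrow> x \<le> L \<Longrightarrow>
     \<bar>th p t x - th q t x\<bar> \<le> e \<and> \<bar>ysol p t x - ysol q t x\<bar> \<le> e \<and> \<bar>ysol1 p t x - ysol1 q t x\<bar> \<le> e"
proof -
  obtain K where K: "K \<ge> 1" "\<And>x. \<bar>1 + q x\<bar> \<le> K" using bdd_meas_bound[OF q(1)] by blast
  define R where "R = exp (K * L)"
  define E where "E = exp (2 * K * L) * L"
  have pos: "R \<ge> 1" "E \<ge> 0" using K L by (auto simp: R_def E_def)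
  have eR: "e / (2 * R) > 0" using e pos by simp
  have "isCont exp (0::real)" by simp
  then obtain \<delta> where \<delta>: "\<delta> > 0" "\<And>z::real. \<bar>z\<bar> < \<delta> \<Longrightarrow> \<bar>exp z - 1\<bar> < e / (2 * R)"
    unfolding continuous_at_eps_delta dist_real_def exp_zero diff_zero using eR by blast
  \<comment> \<open>With \<open>d * M\<close> small, the first summand controls the angular error
    \<open>d * E\<close> times the radius bound \<open>R\<close>, the second the change of the
    logarithmic radius; the \<open>1\<close> keeps \<open>M\<close> positive.\<close>
  define M where "M = 2 * R * E + L * (1 + K * E) + 1"
  have M: "M \<ge> 1" using pos K L by (auto simp: M_def)
  define d where "d = min (e / M) (\<delta> / (2 * M))"
  have d: "d > 0" "d * M \<le> e" "d * M < \<delta>" using e \<delta> M by (auto simp: d_def min_def field_simps)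
  have "\<bar>th p t x - th q t x\<bar> \<le> e \<and> \<bar>ysol p t x - ysol q t x\<bar> \<le> e \<and> \<bar>ysol1 p t x - ysol1 q t x\<bar> \<le> e"
    if p: "bdd_meas p" and pq: "\<And>x. \<bar>p x - q x\<bar> \<le> d" and x: "0 \<le> x" "x \<le> L" for p x
  proof -
    have a: "\<bar>th q t y - th p t y\<bar> \<le> d * E" if "0 \<le> y" "y \<le> L" for y
      using prufer_dist[OF p q th(1)[OF p, of t] th(1)[OF q, of t] K(2) pq that]
      by (simp add: th[OF p] th[OF q] E_def algebra_simps)
    have dE: "2 * R * (d * E) \<le> e" "d * E \<le> e" "L * (d * (1 + K * E)) < \<delta>"
    proof -
      have "2 * R * E \<le> M" "L * (1 + K * E) \<le> M" using pos K L by (auto simp: M_def)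
      moreover have "E \<le> 2 * R * E" using pos mult_right_mono[of 1 "2 * R" E] by simp
      ultimately have "d * (2 * R * E) \<le> d * M" "d * E \<le> d * M" "d * (L * (1 + K * E)) \<le> d * M"
        using d(1) by (intro mult_left_mono; linarith)+
      then have "d * (2 * R * E) \<le> e" "d * E \<le> e" "d * (L * (1 + K * E)) < \<delta>" using d by linarith+
      then show "2 * R * (d * E) \<le> e" "d * E \<le> e" "L * (d * (1 + K * E)) < \<delta>" by (simp_all only: mult.left_commute mult.assoc)
    qed
    let ?A = "log_rad q t x" and ?B = "log_rad p t x"
    have A: "\<bar>?A\<bar> \<le> K * L"
    proof -
      have "norm (log_rad q t x - log_rad q t 0) \<le> K * measure lborel {0..x}"
      proof (rule has_integral_bound_real[OF _ finite.emptyI primitiveD(1)[OF log_rad[OF q] x(1)]])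
        fix y
        have "\<bar>1 + q y\<bar> * (\<bar>sin (th q t y)\<bar> * \<bar>cos (th q t y)\<bar>) \<le> K * (1 * 1)"
          by (intro mult_mono K) (use K in auto)
        then show "norm ((1 + q y) * (sin (th q t y) * cos (th q t y))) \<le> K" by (simp add: abs_mult)
      qed (use K in auto)
      also have "\<dots> \<le> K * L" using x K by (simp add: mult_left_mono)
      finally show ?thesis by (simp add: log_rad_def)
    qed
    have BA: "\<bar>?B - ?A\<bar> < \<delta>"
    proof -
      have "norm ((?B - ?A) - (log_rad p t 0 - log_rad q t 0)) \<le> d * (1 + K * E) * measure lborel {0..x}"
      proof (rule has_integral_bound_real[OF _ finite.emptyI primitiveD(1)[OF primitive_diff[OF log_rad[OF p] log_rad[OF q]] x(1)]])
        show "0 \<le> d * (1 + K * E)" using d pos K by simp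
        fix y assume y: "y \<in> {0..x} - {}"
        let ?a = "th q t y" and ?b = "th p t y"
        have "(1 + p y) * (sin ?b * cos ?b) - (1 + q y) * (sin ?a * cos ?a)
          = (p y - q y) * (sin ?b * cos ?b) + (1 + q y) * (sin ?b * cos ?b - sin ?a * cos ?a)"
          by (simp add: algebra_simps)
        also have "\<bar>\<dots>\<bar> \<le> \<bar>p y - q y\<bar> * (\<bar>sin ?b\<bar> * \<bar>cos ?b\<bar>) + \<bar>1 + q y\<bar> * \<bar>sin ?b * cos ?b - sin ?a * cos ?a\<bar>"
          by (rule order_trans[OF abs_triangle_ineq]) (simp add: abs_mult)
        also have "\<dots> \<le> d * (1 * 1) + K * (d * E)"
        proof (intro add_mono mult_mono pq K)
          show "\<bar>sin ?b * cos ?b - sin ?a * cos ?a\<bar> \<le> d * E"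
            using sin_cos_diff_le[of ?b ?a] a[of y] y x by auto
        qed (use d K in auto)
        finally show "norm ((1 + p y) * (sin ?b * cos ?b) - (1 + q y) * (sin ?a * cos ?a)) \<le> d * (1 + K * E)"
          by (simp add: algebra_simps)
      qed
      also have "\<dots> \<le> d * (1 + K * E) * L" using x d pos K by (intro mult_left_mono) auto
      also have "\<dots> < \<delta>" using dE(3) by (simp add: algebra_simps)
      finally show ?thesis by (simp add: log_rad_def)
    qed
    have eA: "exp ?A \<le> R" using A by (auto simp: R_def)
    have r: "\<bar>exp ?B - exp ?A\<bar> \<le> e / 2"
    proof -
      have "\<bar>exp ?B - exp ?A\<bar> = exp ?A * \<bar>exp (?B - ?A) - 1\<bar>"
      proof -
        have "exp ?B - exp ?A = exp ?A * (exp (?B - ?A) - 1)" by (simp add: exp_diff field_simps)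
        then show ?thesis by (simp add: abs_mult)
      qed
      also have "\<dots> \<le> R * (e / (2 * R))"
        using \<delta>(2)[OF BA] pos eA by (intro mult_mono) auto
      finally show ?thesis using pos by simp
    qed
    have key: "\<bar>exp ?B * v - exp ?A * u\<bar> \<le> e" if "\<bar>v\<bar> \<le> 1" "\<bar>v - u\<bar> \<le> \<bar>th p t x - th q t x\<bar>" for u v
    proof -
      have "exp ?B * v - exp ?A * u = (exp ?B - exp ?A) * v + exp ?A * (v - u)" by (simp add: algebra_simps)
      also have "\<bar>\<dots>\<bar> \<le> \<bar>exp ?B - exp ?A\<bar> * \<bar>v\<bar> + exp ?A * \<bar>v - u\<bar>"
        by (rule order_trans[OF abs_triangle_ineq]) (simp add: abs_mult)
      also have "\<dots> \<le> e / 2 * 1 + R * (d * E)"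
        using r that eA pos e a[OF x] by (intro add_mono mult_mono) (auto simp: abs_minus_commute)
      also have "\<dots> \<le> e" using dE(1) by simp
      finally show ?thesis .
    qed
    have sl: "\<bar>sin b - sin a\<bar> \<le> \<bar>b - a\<bar>" "\<bar>cos b - cos a\<bar> \<le> \<bar>b - a\<bar>" for a b :: real
      using field_differentiable_bound[of UNIV sin cos 1 b a] field_differentiable_bound[of UNIV cos "\<lambda>x. - sin x" 1 b a]
      by (auto intro!: derivative_eq_intros)
    show ?thesis unfolding ysol_def ysol1_def using a[OF x] dE(2)
      by (intro conjI key sl) (auto simp: abs_minus_commute)
  qed
  then show ?thesis using that d(1) by blast
qed

section \<open>Band edges of Hill's equation\<close>

definition qform :: "real \<Rightarrow> real \<Rightarrow> real \<Rightarrow> real \<Rightarrow> real" where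
  "qform A B C t = A * (sin t)\<^sup>2 + B * (sin t * cos t) + C * (cos t)\<^sup>2"

lemma qform_complete_square:
  "4 * A * qform A B C t = (2 * A * sin t + B * cos t)\<^sup>2 - (B\<^sup>2 - 4 * A * C) * (cos t)\<^sup>2"
  by (simp add: qform_def algebra_simps power2_eq_square)

lemma qform_pi_half: "qform A B C (pi / 2) = A" by (simp add: qform_def)

text \<open>With \<open>tan t = x\<close> the form becomes a quadratic polynomial; the only
  direction missed is \<open>cos t = 0\<close>, which \<open>qform_pi_half\<close> covers.\<close>

lemma qform_arctan: "qform A B C (arctan x) = (A * x\<^sup>2 + B * x + C) / (1 + x\<^sup>2)"
proof -
  define s where "s = sqrt (1 + x\<^sup>2)"
  have "qform A B C (arctan x) = (A * x\<^sup>2 + B * x + C) / s\<^sup>2"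
    by (simp add: qform_def sin_arctan cos_arctan s_def[symmetric] power_divide add_divide_distrib power2_eq_square[of s])
  then show ?thesis by (simp add: s_def)
qed

lemma qform_root_disc:
  assumes "qform A B C t = 0" shows "B\<^sup>2 - 4 * A * C \<ge> 0"
proof (cases "cos t = 0")
  case True
  then have "sin t \<noteq> 0" using sin_cos_squared_add[of t] by auto
  then have "A = 0" using assms True by (simp add: qform_def)
  then show ?thesis by simp
next
  case False
  have "(B\<^sup>2 - 4 * A * C) * (cos t)\<^sup>2 = (2 * A * sin t + B * cos t)\<^sup>2"
    using qform_complete_square[of A B C t] assms by simp
  then have "(B\<^sup>2 - 4 * A * C) * (cos t)\<^sup>2 \<ge> 0" by simp
  then show ?thesis using False by (simp add: zero_le_mult_iff)
qed

lemma qform_no_root_disc: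
  assumes "\<And>t. qform A B C t \<noteq> 0" shows "B\<^sup>2 - 4 * A * C < 0"
proof (rule ccontr)
  assume "\<not> ?thesis"
  then have d: "B\<^sup>2 - 4 * A * C \<ge> 0" by simp
  have A: "A \<noteq> 0" using assms[of "pi/2"] by (simp add: qform_pi_half)
  define x where "x = (- B + sqrt (B\<^sup>2 - 4 * A * C)) / (2 * A)"
  have "4 * A * (A * x\<^sup>2 + B * x + C) = (2 * A * x + B)\<^sup>2 - (B\<^sup>2 - 4 * A * C)"
    by (simp add: algebra_simps power2_eq_square)
  also have "\<dots> = 0" using d A by (simp add: x_def)
  finally have "qform A B C (arctan x) = 0" using A by (simp add: qform_arctan)
  then show False using assms by blast
qed

lemma qform_indefinite_disc:
  assumes "qform A B C s < 0" "qform A B C t > 0" shows "B\<^sup>2 - 4 * A * C > 0"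
proof (rule ccontr)
  assume "\<not> ?thesis"
  then have d: "B\<^sup>2 - 4 * A * C \<le> 0" by simp
  have nn: "4 * A * qform A B C u \<ge> 0" for u
  proof -
    have "(B\<^sup>2 - 4 * A * C) * (cos u)\<^sup>2 \<le> 0" using d by (simp add: mult_nonpos_nonneg)
    then show ?thesis unfolding qform_complete_square by (smt (verit) zero_le_power2)
  qed
  have A: "A = 0" using nn[of s] nn[of t] assms by (auto simp: zero_le_mult_iff)
  then have "B = 0" using d by simp
  then show False using A assms by (auto simp: qform_def mult_less_0_iff zero_less_mult_iff)
qed

lemma qform_nonneg_disc:
  assumes "\<And>t. qform A B C t \<ge> 0" shows "B\<^sup>2 - 4 * A * C \<le> 0"
proof (rule ccontr)
  assume "\<not> ?thesis"
  then have d: "B\<^sup>2 - 4 * A * C > 0" by simp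
  have A: "A \<ge> 0" using assms[of "pi/2"] by (simp add: qform_pi_half)
  have p: "A * x\<^sup>2 + B * x + C \<ge> 0" for x
  proof -
    have "1 + x\<^sup>2 > 0" by (smt (verit) zero_le_power2)
    then show ?thesis using assms[of "arctan x"] by (simp add: qform_arctan zero_le_divide_iff)
  qed
  show False
  proof (cases "A = 0")
    case True
    then have "B \<noteq> 0" using d by auto
    then show False using p[of "(- C - 1) / B"] True by simp
  next
    case False
    then have "4 * A * (A * (- B / (2 * A))\<^sup>2 + B * (- B / (2 * A)) + C) = - (B\<^sup>2 - 4 * A * C)"
      by (simp add: field_simps power2_eq_square)
    then have "4 * A * (A * (- B / (2 * A))\<^sup>2 + B * (- B / (2 * A)) + C) < 0" using d by simp
    then show False using p[of "- B / (2 * A)"] A by (simp add: mult_less_0_iff)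
  qed
qed

lemma qform_neg: "qform (-A) (-B) (-C) t = - qform A B C t" by (simp add: qform_def)

lemma qform_nonpos_disc:
  assumes "\<And>t. qform A B C t \<le> 0" shows "B\<^sup>2 - 4 * A * C \<le> 0"
  using qform_nonneg_disc[of "-A" "-B" "-C"] assms by (simp add: qform_neg)

lemma sin_add_nat_pi: "sin (x + real m * pi) = (-1) ^ m * sin x"
proof (induction m)
  case (Suc m)
  have "sin (x + real (Suc m) * pi) = sin ((x + real m * pi) + pi)" by (simp add: algebra_simps)
  also have "\<dots> = - sin (x + real m * pi)" by simp
  finally show ?case using Suc by simp
qed simp

lemma cos_add_nat_pi: "cos (x + real m * pi) = (-1) ^ m * cos x"
proof (induction m)
  case (Suc m)
  have "cos (x + real (Suc m) * pi) = cos ((x + real m * pi) + pi)" by (simp add: algebra_simps)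
  also have "\<dots> = - cos (x + real m * pi)" by simp
  finally show ?case using Suc by simp
qed simp

lemma sin_band_pos:
  assumes "real j * pi < x" "x < real (Suc j) * pi" shows "(-1) ^ j * sin x > 0"
proof -
  have "sin (x - real j * pi) > 0" using assms by (intro sin_gt_zero) (auto simp: algebra_simps)
  moreover have "sin x = (-1) ^ j * sin (x - real j * pi)" using sin_add_nat_pi[of "x - real j * pi" j] by simp
  ultimately show ?thesis by (simp add: power_mult_distrib[symmetric] mult.assoc[symmetric])
qed

lemma sin_eq_0_multiple: "sin x = 0 \<Longrightarrow> \<exists>k::int. x = of_int k * pi"
  by (simp add: sin_zero_iff_int2)

text \<open>The minimum over \<open>t\<close> is continuous in \<open>l\<close> because the
  Lipschitz constant, though it may vary with \<open>l\<close>, is uniform in \<open>t\<close>; the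
  intermediate value theorem then applies.\<close>

lemma extremal_crossing:
  fixes F :: "real \<Rightarrow> real \<Rightarrow> real"
  assumes lip: "\<And>l. \<exists>C. \<forall>l' t. \<bar>F l t - F l' t\<bar> \<le> C * \<bar>l - l'\<bar>"
    and att: "\<And>l. \<exists>s. \<forall>t. F l s \<le> F l t"
    and lo: "\<exists>t. F a t \<le> c" and hi: "\<forall>t. c \<le> F b t"
  shows "\<exists>l. (\<forall>t. F l t \<ge> c) \<and> (\<exists>t. F l t = c)"
proof -
  obtain s where s: "\<And>l t. F l (s l) \<le> F l t" using att by metis
  have "isCont (\<lambda>l. F l (s l)) l" for l
    unfolding continuous_at_eps_delta dist_real_def
  proof (intro allI impI)
    fix e :: real assume e: "e > 0"
    obtain C where C: "\<forall>l' t. \<bar>F l t - F l' t\<bar> \<le> C * \<bar>l - l'\<bar>" using lip by blast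
    show "\<exists>d>0. \<forall>l'. \<bar>l' - l\<bar> < d \<longrightarrow> \<bar>F l' (s l') - F l (s l)\<bar> < e"
    proof (intro exI[of _ "e / (\<bar>C\<bar> + 1)"] conjI allI impI)
      fix l' assume l': "\<bar>l' - l\<bar> < e / (\<bar>C\<bar> + 1)"
      have "C * \<bar>l - l'\<bar> \<le> (\<bar>C\<bar> + 1) * \<bar>l - l'\<bar>" by (intro mult_right_mono) auto
      also have "\<dots> < e" using l' by (simp add: field_simps abs_minus_commute)
      finally have "\<bar>F l t - F l' t\<bar> < e" for t using C by (meson le_less_trans)
      from this[of "s l"] this[of "s l'"] s[of l "s l'"] s[of l' "s l"]
      show "\<bar>F l' (s l') - F l (s l)\<bar> < e" by (simp add: abs_less_iff)
    qed (use e in simp)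
  qed
  then have c: "continuous_on S (\<lambda>l. F l (s l))" for S by (simp add: continuous_at_imp_continuous_on)
  have "F a (s a) \<le> c" "c \<le> F b (s b)" using lo hi s order_trans by blast+
  then have "\<exists>l. F l (s l) = c"
    using IVT'[of "\<lambda>l. F l (s l)" a c b] IVT2'[of "\<lambda>l. F l (s l)" a c b] c by (cases "a \<le> b") auto
  then show ?thesis using s by metis
qed

section \<open>Monodromy of Hill's equation\<close>

locale hill =
  fixes X Vp :: real and V :: "real \<Rightarrow> real"
  assumes X: "X > 0" and Vm: "V \<in> borel_measurable borel"
    and Vper: "\<And>x. V (x + X) = V x" and V0: "\<And>x. 0 \<le> V x" and V1: "\<And>x. V x \<le> Vp"
begin

definition q :: "real \<Rightarrow> real \<Rightarrow> real" where "q l x = V x - l"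

lemma q_bdd [simp, intro]: "bdd_meas (q l)"
proof -
  have "\<bar>V x - l\<bar> \<le> Vp + \<bar>l\<bar>" for x using V0[of x] V1[of x] by linarith
  then show ?thesis using Vm by (auto simp: bdd_meas_def q_def[abs_def])
qed

lemma q_bound: "\<bar>1 + q l x\<bar> \<le> 1 + Vp + \<bar>l\<bar>"
  using V0[of x] V1[of x] by (auto simp: q_def)

lemma q_per: "q l (x + X) = q l x" by (simp add: q_def Vper)

definition Th :: "real \<Rightarrow> real \<Rightarrow> real" where "Th l t = th (q l) t X"
text \<open>Following the angle over a period gives a homeomorphism of the circle of lines; this is
  the displacement of its lift to the real line.\<close>

definition disp :: "real \<Rightarrow> real \<Rightarrow> real" where "disp l t = Th l t - t"
definition R :: "real \<Rightarrow> real \<Rightarrow> real" where "R l t = exp (log_rad (q l) t X)"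
definition ma where "ma l = ysol (q l) (pi / 2) X"
definition mb where "mb l = ysol (q l) 0 X"
definition mc where "mc l = ysol1 (q l) (pi / 2) X"
definition md where "md l = ysol1 (q l) 0 X"
text \<open>Hill's discriminant: as the determinant is \<open>1\<close> by \<open>det1\<close>, the
  eigenvalues of the monodromy matrix depend on \<open>D\<close> alone.\<close>

definition D :: "real \<Rightarrow> real" where "D l = ma l + md l"

lemma det1: "ma l * md l - mb l * mc l = 1"
  using wronskian_const[OF ysol_sol[OF q_bdd[of l], of 0] ysol_sol[OF q_bdd[of l], of "pi/2"], of X 0]
  by (simp add: ma_def mb_def mc_def md_def ysol_0 mult.commute)

lemma R_pos: "R l t > 0" by (simp add: R_def)

lemma R_sin_Th: "R l t * sin (Th l t) = sin t * ma l + cos t * mb l"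
  and R_cos_Th: "R l t * cos (Th l t) = sin t * mc l + cos t * md l"
  using ysol_repr[OF q_bdd[of l], of t X]
  by (simp_all add: ma_def mb_def mc_def md_def R_def Th_def ysol_def ysol1_def)

text \<open>This is the quadratic form \<open>det (v, M v)\<close> of the monodromy matrix \<open>M\<close> with rows \<open>(ma, mb)\<close> and
  \<open>(mc, md)\<close>; its discriminant is \<open>D\<^sup>2 - 4\<close>.\<close>

lemma R_sin_disp: "R l t * sin (disp l t) = qform (- mc l) (ma l - md l) (mb l) t"
proof -
  have "R l t * sin (disp l t) = (R l t * sin (Th l t)) * cos t - (R l t * cos (Th l t)) * sin t"
    by (simp add: disp_def sin_diff algebra_simps)
  then show ?thesis unfolding R_sin_Th R_cos_Th by (simp add: qform_def algebra_simps power2_eq_square)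
qed

lemma disc: "(ma l - md l)\<^sup>2 - 4 * (- mc l) * mb l = (D l)\<^sup>2 - 4"
  using det1[of l] by (simp add: D_def power2_eq_square algebra_simps)

lemma disp_add_pi: "disp l (t + of_int k * pi) = disp l t"
  by (simp add: disp_def Th_def th_add_pi_int)

lemma Th_less: "s < t \<Longrightarrow> Th l s < Th l t"
  unfolding Th_def using prufer_less[OF q_bdd[of l] q_bdd[of l] th(1)[OF q_bdd] th(1)[OF q_bdd], where s=0 and x=X] X
  by (simp add: th)

lemma disp_strict: "l < l' \<Longrightarrow> disp l t < disp l' t"
proof -
  assume "l < l'"
  then have "Th l t < Th l' t" unfolding Th_def
    by - (rule prufer_strict[OF q_bdd q_bdd th(1)[OF q_bdd] th(1)[OF q_bdd], where \<eta>="l' - l" and s=0],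
       auto simp: th q_def X)
  then show ?thesis by (simp add: disp_def)
qed

lemma disp_mono: "l \<le> l' \<Longrightarrow> disp l t \<le> disp l' t"
  using disp_strict[of l l' t] by (cases "l = l'") auto

text \<open>The lift \<open>Th l\<close> is increasing and commutes with translation by
  \<open>pi\<close>; the displacement of such a map varies by less than \<open>pi\<close>.\<close>

lemma disp_osc: "disp l s < disp l t + pi"
proof -
  \<comment> \<open>\<open>t + of_int k * pi\<close> is the first translate of \<open>t\<close> that
    is not below \<open>s\<close>.\<close>
  define k where "k = \<lceil>(s - t) / pi\<rceil>"
  have "(s - t) / pi \<le> of_int k" "of_int k < (s - t) / pi + 1" unfolding k_def by linarith+
  then have k: "s \<le> t + of_int k * pi" "t + of_int k * pi < s + pi" by (simp_all add: field_simps)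
  have "Th l s \<le> Th l (t + of_int k * pi)" using Th_less[of s "t + of_int k * pi" l] k by (cases "s = t + of_int k * pi") auto
  also have "\<dots> = Th l t + of_int k * pi" by (simp add: Th_def th_add_pi_int)
  finally show ?thesis using k by (simp add: disp_def)
qed

lemma disp_0_pos: "disp l 0 > 0"
proof -
  have "of_int 0 * pi < th (q l) 0 X"
    by (rule prufer_cross[OF q_bdd th(1)[OF q_bdd], where s=0]) (use X in \<open>auto simp: th\<close>)
  then show ?thesis by (simp add: disp_def Th_def)
qed

text \<open>The constant solution of \<open>y'' = 0\<close>. As a barrier it bounds the displacement
  for \<open>l \<le> 0\<close>, which starts the search for the edges and later makes them
  positive.\<close>

lemma prufer_zero: "prufer (\<lambda>x. 0) (\<lambda>x. pi / 2)"
  using primitive_const[of "pi / 2"] by (simp add: prufer_def)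

lemma bdd_meas_const: "bdd_meas (\<lambda>x. c)" by (auto simp: bdd_meas_def)

lemma disp_neg: "l < 0 \<Longrightarrow> disp l (pi / 2) < 0"
  using prufer_strict[OF q_bdd bdd_meas_const th(1)[OF q_bdd] prufer_zero, of "-l" l "pi/2" 0 X] X V0
  by (simp add: disp_def Th_def th q_def)

lemma disp_nonpos: "l \<le> 0 \<Longrightarrow> disp l (pi / 2) \<le> 0"
  using prufer_le[OF q_bdd bdd_meas_const th(1)[OF q_bdd] prufer_zero, of l "pi/2" 0 X] X V0[THEN order_trans[rotated]]
  by (simp add: disp_def Th_def th q_def)

lemma Th_dist: "\<bar>Th l' t' - Th l t\<bar> \<le> exp (2 * (1 + Vp + \<bar>l'\<bar>) * X) * (\<bar>t' - t\<bar> + \<bar>l' - l\<bar> * X)"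
  using prufer_dist[OF q_bdd q_bdd th(1)[OF q_bdd] th(1)[OF q_bdd] q_bound, of l l' "\<bar>l' - l\<bar>" X X t' t] X
  by (simp add: Th_def th q_def)

lemma disp_dist:
  obtains C where "C > 0" "\<And>l' t. \<bar>disp l t - disp l' t\<bar> \<le> C * \<bar>l - l'\<bar>"
proof -
  define C where "C = exp (2 * (1 + Vp + \<bar>l\<bar>) * X) * X"
  have "\<bar>disp l t - disp l' t\<bar> \<le> C * \<bar>l - l'\<bar>" for l' t
    using Th_dist[of l t l' t] by (simp add: disp_def C_def algebra_simps)
  moreover have "C > 0" using X by (simp add: C_def)
  ultimately show ?thesis using that by blast
qed

lemma disp_cont: "continuous_on A (disp l)"
proof -
  have "isCont (Th l) t" for t
  proof -
    define C where "C = exp (2 * (1 + Vp + \<bar>l\<bar>) * X)"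
    have C: "C > 0" "\<bar>Th l s - Th l t\<bar> \<le> C * \<bar>s - t\<bar>" for s
      using Th_dist[of l s l t] by (simp_all add: C_def)
    show ?thesis unfolding continuous_at_eps_delta dist_real_def
    proof (intro allI impI)
      fix e :: real assume "e > 0"
      then show "\<exists>d>0. \<forall>s. \<bar>s - t\<bar> < d \<longrightarrow> \<bar>Th l s - Th l t\<bar> < e"
        using C by (intro exI[of _ "e / C"]) (auto simp: field_simps intro: le_less_trans)
    qed
  qed
  then have "continuous_on A (Th l)" by (simp add: continuous_at_imp_continuous_on)
  then show ?thesis unfolding disp_def[abs_def] by (intro continuous_intros)
qed

lemma disp_reduce: "\<exists>s\<in>{0..pi}. disp l t = disp l s \<and> (\<forall>l'. disp l' t = disp l' s)"
proof -
  define k where "k = \<lfloor>t / pi\<rfloor>"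
  have "of_int k \<le> t / pi" "t / pi < of_int k + 1" unfolding k_def by linarith+
  then have "t - of_int k * pi \<in> {0..pi}" by (simp add: field_simps)
  moreover have "disp l' t = disp l' (t - of_int k * pi)" for l'
    using disp_add_pi[of l' "t - of_int k * pi" k] by simp
  ultimately show ?thesis by blast
qed

lemma disp_min_attained: "\<exists>s. \<forall>t. disp l s \<le> disp l t"
proof -
  obtain s where "s \<in> {0..pi}" "\<forall>t\<in>{0..pi}. disp l s \<le> disp l t"
    using continuous_attains_inf[OF _ _ disp_cont, of "{0..pi}" l] by auto
  then show ?thesis using disp_reduce[of l] by metis
qed

lemma disp_max_attained: "\<exists>s. \<forall>t. disp l t \<le> disp l s"
proof -
  obtain s where "s \<in> {0..pi}" "\<forall>t\<in>{0..pi}. disp l t \<le> disp l s"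
    using continuous_attains_sup[OF _ _ disp_cont, of "{0..pi}" l] by auto
  then show ?thesis using disp_reduce[of l] by metis
qed

text \<open>Comparison with \<open>sin (\<omega> x)\<close>, whose zeros \<open>j X / N\<close> force the angle above \<open>j \<pi>\<close>.\<close>

lemma disp_large: "\<exists>l. \<forall>t. disp l t \<ge> real N * pi"
proof -
  define n where "n = Suc N"
  define w where "w = real n * pi / X"
  have w: "w > 0" using X by (simp add: w_def n_def)
  define p where "p = (\<lambda>x::real. - w\<^sup>2)"
  have pb: "bdd_meas p" unfolding p_def by (rule bdd_meas_const)
  have s: "sol p (\<lambda>x. sin (w * x) / w) (\<lambda>x. cos (w * x))"
    unfolding sol_def
  proof
    show "primitive (\<lambda>x. sin (w * x) / w) (\<lambda>x. cos (w * x))"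
      by (rule primitive_deriv) (use w in \<open>auto intro!: derivative_eq_intros continuous_intros simp flip: has_real_derivative_iff_has_vector_derivative\<close>)
    show "primitive (\<lambda>x. cos (w * x)) (\<lambda>x. of_real (p x) * (sin (w * x) / w))"
      by (rule primitive_deriv) (use w in \<open>auto intro!: derivative_eq_intros continuous_intros simp: p_def power2_eq_square simp flip: has_real_derivative_iff_has_vector_derivative\<close>)
  qed
  have y: "ysol p 0 x = sin (w * x) / w" for x
    using sol_repr(1)[OF pb s, of x] by (simp add: ysol_0)
  have z: "sin (th p 0 (real j * (X / real n))) = 0" for j
  proof -
    have "w * (real j * (X / real n)) = real j * pi" using X by (simp add: w_def n_def)
    then have "ysol p 0 (real j * (X / real n)) = 0" unfolding y by simp
    then show ?thesis by (simp add: ysol_def)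
  qed
  have "th p 0 (real j * (X / real n)) \<ge> real j * pi" for j
  proof (induction j)
    case 0 then show ?case by (simp add: th[OF pb])
  next
    case (Suc j)
    obtain k where k: "th p 0 (real j * (X / real n)) = of_int k * pi" using sin_eq_0_multiple[OF z] by blast
    obtain k' where k': "th p 0 (real (Suc j) * (X / real n)) = of_int k' * pi" using sin_eq_0_multiple[OF z] by blast
    have "of_int k * pi < of_int k' * pi"
      using prufer_cross[OF pb th(1)[OF pb] k, of "real (Suc j) * (X / real n)"] k' X by (simp add: n_def divide_simps)
    then have "k + 1 \<le> k'" by simp
    moreover have "real j * pi \<le> of_int k * pi" using Suc k by simp
    then have "real j \<le> of_int k" by simp
    then have "int j \<le> k" by linarith
    ultimately have "int (Suc j) \<le> k'" by simp
    then have "real (Suc j) \<le> of_int k'" by linarith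
    then show ?case unfolding k' by (intro mult_right_mono) auto
  qed
  from this[of n] have "th p 0 X \<ge> real n * pi" by (simp add: n_def)
  moreover define l where "l = Vp + w\<^sup>2"
  have "th p 0 X \<le> Th l 0" unfolding Th_def
  proof (rule prufer_le[OF pb q_bdd th(1)[OF pb] th(1)[OF q_bdd], where s=0])
    show "q l x \<le> p x" for x using V1 by (simp add: p_def q_def l_def)
  qed (use X in \<open>simp_all add: th[OF pb] th\<close>)
  ultimately have "disp l 0 \<ge> real n * pi" by (simp add: disp_def)
  then have "disp l t \<ge> real N * pi" for t
    using disp_osc[of l 0 t] by (simp add: n_def algebra_simps)
  then show ?thesis by blast
qed

section \<open>Band edges as extremal displacements\<close>

definition is_beta :: "nat \<Rightarrow> real \<Rightarrow> bool" where
  "is_beta j l \<longleftrightarrow> (\<forall>t. disp l t \<ge> real j * pi) \<and> (\<exists>t. disp l t = real j * pi)"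

definition is_alpha :: "nat \<Rightarrow> real \<Rightarrow> bool" where
  "is_alpha j l \<longleftrightarrow> (\<forall>t. disp l t \<le> real j * pi) \<and> (\<exists>t. disp l t = real j * pi)"

lemma beta_ex: "\<exists>l. is_beta j l"
proof -
  obtain L where L: "\<forall>t. real j * pi \<le> disp L t" using disp_large by blast
  show ?thesis unfolding is_beta_def
  proof (rule extremal_crossing[where a="-1" and b=L])
    show "\<exists>C. \<forall>l' t. \<bar>disp l t - disp l' t\<bar> \<le> C * \<bar>l - l'\<bar>" for l using disp_dist by blast
    show "\<exists>s. \<forall>t. disp l s \<le> disp l t" for l by (rule disp_min_attained)
    have "disp (-1) (pi / 2) < 0" by (rule disp_neg) simp
    also have "0 \<le> real j * pi" by simp
    finally show "\<exists>t. disp (-1) t \<le> real j * pi" by (intro exI[of _ "pi / 2"]) simp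
  qed (rule L)
qed

lemma alpha_ex: assumes "j \<ge> 1" shows "\<exists>l. is_alpha j l"
proof -
  obtain L where L: "\<forall>t. real j * pi \<le> disp L t" using disp_large by blast
  \<comment> \<open>Reflecting both the parameter and the displacement turns the maximum into the
    minimum required by \<open>extremal_crossing\<close>.\<close>
  have "\<exists>l. (\<forall>t. - disp (- l) t \<ge> - (real j * pi)) \<and> (\<exists>t. - disp (- l) t = - (real j * pi))"
  proof (rule extremal_crossing[where a="- L" and b=1])
    show "\<exists>C. \<forall>l' t. \<bar>- disp (- l) t - - disp (- l') t\<bar> \<le> C * \<bar>l - l'\<bar>" for l
    proof -
      obtain C where C: "\<And>l' t. \<bar>disp (- l) t - disp l' t\<bar> \<le> C * \<bar>- l - l'\<bar>" using disp_dist by blast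
      have "\<bar>- disp (- l) t - - disp (- l') t\<bar> \<le> C * \<bar>l - l'\<bar>" for l' t
        using C[of t "- l'"] by (simp add: abs_minus_commute)
      then show ?thesis by blast
    qed
    show "\<exists>s. \<forall>t. - disp (- l) s \<le> - disp (- l) t" for l using disp_max_attained[of "- l"] by simp
    show "\<exists>t. - disp (- (- L)) t \<le> - (real j * pi)" using L by simp
    \<comment> \<open>For a parameter below the potential every displacement stays under
      \<open>pi\<close>; this is where the index has to be at least \<open>1\<close>.\<close>
    have "disp (-1) t \<le> real j * pi" for t
    proof -
      have "disp (-1) t < pi" using disp_osc[of "-1" t "pi/2"] disp_neg[of "-1"] by simp
      also have "pi \<le> real j * pi" using assms by simp
      finally show ?thesis by simp
    qed
    then show "\<forall>t. - (real j * pi) \<le> - disp (- 1) t" by simp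
  qed
  then show ?thesis unfolding is_alpha_def by (metis neg_equal_iff_equal neg_le_iff_le)
qed

definition beta :: "nat \<Rightarrow> real" where "beta j = (SOME l. is_beta j l)"
definition alpha :: "nat \<Rightarrow> real" where "alpha j = (SOME l. is_alpha j l)"

lemma beta: "real j * pi \<le> disp (beta j) t" "\<exists>t. disp (beta j) t = real j * pi"
  using someI_ex[OF beta_ex[of j]] by (auto simp: beta_def is_beta_def)

lemma alpha: "j \<ge> 1 \<Longrightarrow> disp (alpha j) t \<le> real j * pi" "j \<ge> 1 \<Longrightarrow> \<exists>t. disp (alpha j) t = real j * pi"
  using someI_ex[OF alpha_ex[of j]] by (auto simp: alpha_def is_alpha_def)

text \<open>One trial angle bounds an edge from one side, here and in the next lemma; the
  perturbation argument has nothing more at its disposal.\<close>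

lemma alpha_lessI: "j \<ge> 1 \<Longrightarrow> disp l t > real j * pi \<Longrightarrow> alpha j < l"
  using alpha(1)[of j t] disp_mono[of l "alpha j" t] by (meson leD le_less_trans not_le order_trans)

lemma beta_lessI: "disp l t < real j * pi \<Longrightarrow> l < beta j"
  using beta(1)[of j t] disp_mono[of "beta j" l t] by (meson leD not_le order_trans)

text \<open>Otherwise the displacement would be at most \<open>0\<close> at \<open>pi / 2\<close>
  and \<open>j * pi\<close> elsewhere, against \<open>disp_osc\<close>. Positive edges give the gap
  ratio a positive denominator.\<close>

lemma alpha_pos: "j \<ge> 1 \<Longrightarrow> alpha j > 0"
proof (rule ccontr)
  assume j: "j \<ge> 1" "\<not> alpha j > 0"
  then have "disp (alpha j) (pi/2) \<le> 0" by (intro disp_nonpos) simp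
  moreover obtain t where "disp (alpha j) t = real j * pi" using alpha(2) j by blast
  ultimately have "real j * pi < pi" using disp_osc[of "alpha j" t "pi/2"] by linarith
  then show False using j by simp
qed

text \<open>Counted from \<open>0\<close>: this is the band of \<open>E_n\<close> with
  \<open>n = Suc j\<close>, reaching from \<open>beta j\<close> to
  \<open>alpha (Suc j)\<close>.\<close>

definition inband :: "nat \<Rightarrow> real \<Rightarrow> bool" where
  "inband j l \<longleftrightarrow> (\<forall>t. real j * pi \<le> disp l t \<and> disp l t \<le> real (Suc j) * pi)"

text \<open>A displacement that varies by less than \<open>pi\<close> cannot touch two consecutive
  multiples of \<open>pi\<close>, so every band has interior, whereas gaps may be empty.\<close>

lemma beta_less_alpha_Suc: "beta j < alpha (Suc j)"
proof (rule ccontr)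
  assume "\<not> ?thesis"
  then have le: "alpha (Suc j) \<le> beta j" by simp
  obtain t where t: "disp (beta j) t = real j * pi" using beta(2) by blast
  obtain s where s: "disp (alpha (Suc j)) s = real (Suc j) * pi" using alpha(2)[of "Suc j"] by auto
  show False using disp_mono[OF le, of s] disp_osc[of "beta j" s t] s t by (simp add: algebra_simps)
qed

lemma alpha_le_beta: assumes "j \<ge> 1" shows "alpha j \<le> beta j"
proof (rule ccontr)
  assume "\<not> ?thesis"
  then have "disp (beta j) 0 < disp (alpha j) 0" by (intro disp_strict) simp
  then show False using beta(1)[of j 0] alpha(1)[OF assms, of 0] by simp
qed

lemma inband_iff: "inband j l \<longleftrightarrow> beta j \<le> l \<and> l \<le> alpha (Suc j)"
proof
  assume i: "inband j l"
  obtain t where t: "disp (beta j) t = real j * pi" using beta(2) by blast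
  obtain s where s: "disp (alpha (Suc j)) s = real (Suc j) * pi" using alpha(2)[of "Suc j"] by auto
  have b: "disp (beta j) t \<le> disp l t" "disp l s \<le> disp (alpha (Suc j)) s" using i s t by (simp_all only: inband_def)
  show "beta j \<le> l \<and> l \<le> alpha (Suc j)"
    using disp_strict[of l "beta j" t] disp_strict[of "alpha (Suc j)" l s] b by linarith
next
  assume a: "beta j \<le> l \<and> l \<le> alpha (Suc j)"
  have "real j * pi \<le> disp l t \<and> disp l t \<le> real (Suc j) * pi" for t
    using order_trans[OF beta(1) disp_mono, of j l t] order_trans[OF disp_mono alpha(1), of l "Suc j" t] a by simp
  then show "inband j l" by (simp only: inband_def simp_thms)
qed

lemma sin_band_nonneg:
  assumes "real j * pi \<le> x" "x \<le> real (Suc j) * pi" shows "(-1) ^ j * sin x \<ge> 0"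
proof -
  have "sin (x - real j * pi) \<ge> 0" using assms by (intro sin_ge_zero) (auto simp: algebra_simps)
  moreover have "sin x = (-1) ^ j * sin (x - real j * pi)" using sin_add_nat_pi[of "x - real j * pi" j] by simp
  ultimately show ?thesis by (simp add: power_mult_distrib[symmetric] mult.assoc[symmetric])
qed

lemma neg_one_cases: "(-1::real) ^ j = 1 \<or> (-1::real) ^ j = -1"
  by (cases "even j") auto

text \<open>Between consecutive multiples of \<open>pi\<close> the sine keeps its sign, so the form
  in \<open>R_sin_disp\<close> is semidefinite and its discriminant \<open>D^2 - 4\<close> is not
  positive.\<close>

lemma inband_D: assumes "inband j l" shows "(D l)\<^sup>2 \<le> 4"
proof -
  let ?Q = "qform (- mc l) (ma l - md l) (mb l)"
  have "(-1) ^ j * ?Q t \<ge> 0" for t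
  proof -
    have "(-1) ^ j * sin (disp l t) \<ge> 0" using assms by (intro sin_band_nonneg) (auto simp: inband_def)
    then have "R l t * ((-1) ^ j * sin (disp l t)) \<ge> 0" using R_pos[of l t] by simp
    then show ?thesis unfolding R_sin_disp[symmetric] by (simp add: mult.left_commute)
  qed
  then have "(ma l - md l)\<^sup>2 - 4 * (- mc l) * mb l \<le> 0"
    using neg_one_cases[of j] qform_nonneg_disc[of "- mc l" "ma l - md l" "mb l"] qform_nonpos_disc[of "- mc l" "ma l - md l" "mb l"]
    by auto
  then show ?thesis unfolding disc by simp
qed

lemma inband_interior_D:
  assumes "\<And>t. real j * pi < disp l t \<and> disp l t < real (Suc j) * pi" shows "(D l)\<^sup>2 < 4"
proof -
  have "qform (- mc l) (ma l - md l) (mb l) t \<noteq> 0" for t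
  proof -
    have "(-1) ^ j * sin (disp l t) > 0" using assms by (intro sin_band_pos) auto
    then have "sin (disp l t) \<noteq> 0" by auto
    then show ?thesis unfolding R_sin_disp[symmetric] using R_pos[of l t] by simp
  qed
  then have "(ma l - md l)\<^sup>2 - 4 * (- mc l) * mb l < 0" by (rule qform_no_root_disc)
  then show ?thesis unfolding disc by simp
qed

text \<open>\<open>t\<close> is an eigendirection of the monodromy matrix with real eigenvalue
  \<open>\<mu>\<close>; determinant \<open>1\<close> and \<open>D^2 = 4\<close> make it the double
  eigenvalue \<open>1\<close> or \<open>-1\<close>. So the radius returns to \<open>1\<close> and
  the solution is periodic or antiperiodic.\<close>

lemma edge_D:
  assumes D4: "(D l)\<^sup>2 \<le> 4" and t: "disp l t = real m * pi"
  shows "D l = 2 * (-1) ^ m" "R l t = 1"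
proof -
  define \<mu> where "\<mu> = (-1) ^ m * R l t"
  have Tt: "Th l t = t + real m * pi" using t by (simp add: disp_def)
  have "sin (disp l t) = 0" unfolding t by simp
  then have "(D l)\<^sup>2 - 4 \<ge> 0"
    using qform_root_disc[of "- mc l" "ma l - md l" "mb l" t] unfolding disc R_sin_disp[symmetric] by simp
  then have D4': "(D l)\<^sup>2 = 4" using D4 by simp
  define s c where "s = sin t" and "c = cos t"
  have sc: "s\<^sup>2 + c\<^sup>2 = 1" by (simp add: s_def c_def)
  have 1: "(ma l - \<mu>) * s + mb l * c = 0" "mc l * s + (md l - \<mu>) * c = 0"
    using R_sin_Th[of l t] R_cos_Th[of l t] unfolding Tt sin_add_nat_pi cos_add_nat_pi
    by (simp_all add: \<mu>_def s_def c_def algebra_simps)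
  have "((ma l - \<mu>) * (md l - \<mu>) - mb l * mc l) * s = 0" "((ma l - \<mu>) * (md l - \<mu>) - mb l * mc l) * c = 0"
    using 1 by algebra+
  then have "(ma l - \<mu>) * (md l - \<mu>) - mb l * mc l = 0" using sc by auto
  then have "\<mu>\<^sup>2 - D l * \<mu> + 1 = 0" using det1[of l] unfolding D_def by algebra
  then have "(2 * \<mu> - D l)\<^sup>2 = 0" using D4' by algebra
  then have m: "D l = 2 * \<mu>" by simp
  then have "\<mu>\<^sup>2 = 1" using D4' by (simp add: power_mult_distrib)
  moreover have "\<mu>\<^sup>2 = (R l t)\<^sup>2" by (simp add: \<mu>_def power_mult_distrib flip: power_mult)
  ultimately show "R l t = 1" using R_pos[of l t] by (simp add: power2_eq_1_iff)
  then show "D l = 2 * (-1) ^ m" using m by (simp add: \<mu>_def)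
qed

lemma alpha_inband: "j \<ge> 1 \<Longrightarrow> inband (j - 1) (alpha j)"
  using beta_less_alpha_Suc[of "j - 1"] by (simp add: inband_iff)

lemma beta_inband: "inband j (beta j)"
  using beta_less_alpha_Suc[of j] by (simp add: inband_iff)

lemma D_beta: "D (beta j) = 2 * (-1) ^ j"
  using beta(2)[of j] edge_D(1)[OF inband_D[OF beta_inband]] by blast

lemma D_alpha: "j \<ge> 1 \<Longrightarrow> D (alpha j) = 2 * (-1) ^ j"
  using alpha(2)[of j] edge_D(1)[OF inband_D[OF alpha_inband[of j]]] by blast

text \<open>Displacements on both sides of some \<open>m * pi\<close> would make the quadratic form
  indefinite and thus \<open>D^2 > 4\<close>.\<close>

lemma D_inband_ex:
  assumes "(D l)\<^sup>2 \<le> 4" shows "\<exists>j. inband j l"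
proof -
  have *: False if st: "disp l s < real m * pi" "disp l t > real m * pi" for s t m
  proof -
    have "real m * pi < disp l t" "disp l t < real (Suc m) * pi"
      using st disp_osc[of l t s] by (auto simp: algebra_simps)
    then have p: "(-1) ^ m * sin (disp l t) > 0" by (rule sin_band_pos)
    have "real m * pi < disp l s + pi" "disp l s + pi < real (Suc m) * pi"
      using st disp_osc[of l t s] by (auto simp: algebra_simps)
    then have n: "(-1) ^ m * sin (disp l s + pi) > 0" by (rule sin_band_pos)
    let ?Q = "qform (- mc l) (ma l - md l) (mb l)"
    have "R l t * ((-1) ^ m * sin (disp l t)) > 0" "R l s * ((-1) ^ m * sin (disp l s)) < 0"
      using p n R_pos[of l t] R_pos[of l s] by (simp_all add: mult_pos_neg)
    then have "(-1) ^ m * ?Q t > 0" "(-1) ^ m * ?Q s < 0" unfolding R_sin_disp[symmetric] by (simp_all add: mult.left_commute)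
    then have "(ma l - md l)\<^sup>2 - 4 * (- mc l) * mb l > 0"
      using neg_one_cases[of m] qform_indefinite_disc[of "- mc l" "ma l - md l" "mb l" s t]
        qform_indefinite_disc[of "- mc l" "ma l - md l" "mb l" t s] by auto
    then show False using assms unfolding disc by simp
  qed
  define k where "k = nat \<lfloor>disp l 0 / pi\<rfloor>"
  have "real k \<le> disp l 0 / pi" "disp l 0 / pi < real k + 1"
    unfolding k_def using disp_0_pos[of l] by (auto simp: divide_nonneg_pos)
  then have k: "real k * pi \<le> disp l 0" "disp l 0 < real (Suc k) * pi" by (simp_all add: field_simps)
  show ?thesis
  proof (cases "\<exists>t. disp l t < real k * pi")
    case False
    then have "inband k l" unfolding inband_def using *[of 0 "Suc k"] k by (meson not_le)
    then show ?thesis by blast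
  next
    case True
    then obtain t where t: "disp l t < real k * pi" by blast
    \<comment> \<open>Here angle \<open>0\<close> realises the largest displacement
      \<open>k * pi\<close>, so the band index is \<open>k - 1\<close>; positivity at angle
      \<open>0\<close> excludes \<open>k = 0\<close>.\<close>
    then have le: "disp l s \<le> real k * pi" for s using *[of t k s] by (meson not_le)
    then have eq: "disp l 0 = real k * pi" using k by (simp add: antisym)
    then have "k > 0" using disp_0_pos[of l] by (cases k) auto
    then obtain j where j: "k = Suc j" by (cases k) auto
    have "inband j l" unfolding inband_def
    proof (intro allI conjI)
      show "real j * pi \<le> disp l s" for s using disp_osc[of l 0 s] eq by (simp add: j algebra_simps)
    qed (use le j in auto)
    then show ?thesis by blast
  qed
qed

text \<open>A scalar matrix fixes every direction, so the quadratic form vanishes identically and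
  each displacement is a multiple of \<open>pi\<close>, the same one by \<open>disp_osc\<close>.
  This is the case of a closed gap.\<close>

lemma monodromy_scalar_iff: "(mb l = 0 \<and> mc l = 0 \<and> ma l = md l) \<longleftrightarrow> (\<exists>m::nat. m \<ge> 1 \<and> (\<forall>t. disp l t = real m * pi))"
proof
  assume "mb l = 0 \<and> mc l = 0 \<and> ma l = md l"
  then have "R l t * sin (disp l t) = 0" for t unfolding R_sin_disp by (simp add: qform_def)
  then have z: "sin (disp l t) = 0" for t using R_pos[of l t] by (auto simp: less_le)
  obtain k where k: "disp l 0 = of_int k * pi" using sin_eq_0_multiple[OF z] by blast
  have "disp l t = of_int k * pi" for t
  proof -
    obtain k' where k': "disp l t = of_int k' * pi" using sin_eq_0_multiple[OF z] by blast
    have "of_int k * pi < of_int (k' + 1) * pi" "of_int k' * pi < of_int (k + 1) * pi"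
      using disp_osc[of l 0 t] disp_osc[of l t 0] k k' by (simp_all add: algebra_simps)
    then have "k < k' + 1" "k' < k + 1" unfolding mult_less_cancel_right_pos[OF pi_gt_zero] of_int_less_iff by auto
    then show ?thesis using k' by simp
  qed
  moreover have "k > 0" using disp_0_pos[of l] k by (simp add: zero_less_mult_iff)
  ultimately show "\<exists>m::nat. m \<ge> 1 \<and> (\<forall>t. disp l t = real m * pi)" by (intro exI[of _ "nat k"]) auto
next
  assume "\<exists>m::nat. m \<ge> 1 \<and> (\<forall>t. disp l t = real m * pi)"
  then obtain m :: nat where "\<And>t. disp l t = real m * pi" by blast
  then have z: "qform (- mc l) (ma l - md l) (mb l) t = 0" for t unfolding R_sin_disp[symmetric] by simp
  have "mb l = 0" "mc l = 0" using z[of 0] z[of "pi/2"] by (auto simp: qform_def)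
  then show "mb l = 0 \<and> mc l = 0 \<and> ma l = md l"
    using z[of "pi/4"] by (simp add: qform_def sin_45 cos_45)
qed

lemma inband_unique_up_to_edge:
  assumes "inband i l" "inband j l" "i < j" shows "j = Suc i \<and> (\<forall>t. disp l t = real j * pi)"
proof -
  have "real j * pi \<le> real (Suc i) * pi" using assms(1,2) unfolding inband_def by (meson order_trans)
  then have j: "j = Suc i" using assms(3) by simp
  then show ?thesis using assms(1,2) by (auto simp: inband_def intro: antisym)
qed

text \<open>A parameter lies in two bands only where neighbours touch, and there the monodromy
  matrix is scalar. The count is arranged to agree with the multiplicity in
  \<open>bloch_mult_eq\<close>.\<close>

lemma card_inband:
  assumes "(D l)\<^sup>2 \<le> 4"
  shows "finite {j. inband j l} \<and> card {j. inband j l} = (if mb l = 0 \<and> mc l = 0 \<and> ma l = md l then 2 else 1)"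
proof (cases "mb l = 0 \<and> mc l = 0 \<and> ma l = md l")
  case True
  then obtain m :: nat where m: "m \<ge> 1" "\<And>t. disp l t = real m * pi" using monodromy_scalar_iff by auto
  have "{j. inband j l} = {m - 1, m}"
    unfolding inband_def m(2) using m(1) by (auto simp: mult_le_cancel_right)
  then show ?thesis using True m(1) by auto
next
  case False
  obtain j where j: "inband j l" using D_inband_ex[OF assms] by blast
  have "i = j" if i: "inband i l" for i
  proof (rule ccontr)
    assume "i \<noteq> j"
    then have "\<exists>m::nat. m \<ge> 1 \<and> (\<forall>t. disp l t = real m * pi)"
      using inband_unique_up_to_edge[OF i j] inband_unique_up_to_edge[OF j i]
      by (metis One_nat_def Suc_leI linorder_neqE_nat zero_less_Suc)
    then show False using False monodromy_scalar_iff by blast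
  qed
  then have "{j. inband j l} = {j}" using j by (intro set_eqI) (metis mem_Collect_eq singleton_iff)
  then show ?thesis using False by simp
qed

lemma D_cont: "continuous_on A D"
proof -
  have "isCont D l" for l
    unfolding continuous_at_eps_delta dist_real_def
  proof (intro allI impI)
    fix e :: real assume "e > 0"
    then have e: "e / 3 > 0" by simp
    obtain d1 where d1: "d1 > 0" "\<And>p x. bdd_meas p \<Longrightarrow> (\<And>x. \<bar>p x - q l x\<bar> \<le> d1) \<Longrightarrow> 0 \<le> x \<Longrightarrow> x \<le> X \<Longrightarrow>
       \<bar>th p (pi/2) x - th (q l) (pi/2) x\<bar> \<le> e/3 \<and> \<bar>ysol p (pi/2) x - ysol (q l) (pi/2) x\<bar> \<le> e/3 \<and> \<bar>ysol1 p (pi/2) x - ysol1 (q l) (pi/2) x\<bar> \<le> e/3"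
      using ysol_continuous_dependence[OF q_bdd less_imp_le[OF X] e] by blast
    obtain d2 where d2: "d2 > 0" "\<And>p x. bdd_meas p \<Longrightarrow> (\<And>x. \<bar>p x - q l x\<bar> \<le> d2) \<Longrightarrow> 0 \<le> x \<Longrightarrow> x \<le> X \<Longrightarrow>
       \<bar>th p 0 x - th (q l) 0 x\<bar> \<le> e/3 \<and> \<bar>ysol p 0 x - ysol (q l) 0 x\<bar> \<le> e/3 \<and> \<bar>ysol1 p 0 x - ysol1 (q l) 0 x\<bar> \<le> e/3"
      using ysol_continuous_dependence[OF q_bdd less_imp_le[OF X] e] by blast
    show "\<exists>d>0. \<forall>x'. \<bar>x' - l\<bar> < d \<longrightarrow> \<bar>D x' - D l\<bar> < e"
    proof (intro exI[of _ "min d1 d2"] conjI allI impI)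
      fix l' assume "\<bar>l' - l\<bar> < min d1 d2"
      then have "\<bar>q l' x - q l x\<bar> \<le> d1" "\<bar>q l' x - q l x\<bar> \<le> d2" for x by (auto simp: q_def)
      then have "\<bar>ma l' - ma l\<bar> \<le> e/3" "\<bar>md l' - md l\<bar> \<le> e/3"
        unfolding ma_def md_def using d1(2)[of "q l'" X] d2(2)[of "q l'" X] X by auto
      then show "\<bar>D l' - D l\<bar> < e" using \<open>e > 0\<close> unfolding D_def by linarith
    qed (use d1 d2 in auto)
  qed
  then show ?thesis by (simp add: continuous_at_imp_continuous_on)
qed

text \<open>The left side is the trace of \<open>M1^-1 M2\<close>. The trace-free parts of two
  elliptic matrices that turn in the same sense (\<open>b1 * b2 > 0\<close>) obey a reversed
  Cauchy-Schwarz inequality.\<close>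

lemma trace_lower_bound:
  fixes a1 b1 c1 d1 a2 b2 c2 d2 T :: real
  assumes "a1 * d1 - b1 * c1 = 1" "a2 * d2 - b2 * c2 = 1" "a1 + d1 = T" "a2 + d2 = T" "T\<^sup>2 < 4" "b1 * b2 > 0"
  shows "d1 * a2 - b1 * c2 - c1 * b2 + a1 * d2 \<ge> 2"
proof -
  \<comment> \<open>Splitting off \<open>T / 2\<close> leaves trace-free matrices of determinant
    \<open>k\<close>, positive because both matrices are elliptic.\<close>
  define p1 p2 k where "p1 = a1 - T / 2" and "p2 = a2 - T / 2" and "k = 1 - T\<^sup>2 / 4"
  have k: "k > 0" using assms by (simp add: k_def)
  have e: "a1 = T / 2 + p1" "d1 = T / 2 - p1" "a2 = T / 2 + p2" "d2 = T / 2 - p2" using assms by (auto simp: p1_def p2_def)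
  have bc: "b1 * c1 = - (k + p1\<^sup>2)" "b2 * c2 = - (k + p2\<^sup>2)"
    using assms(1,2) unfolding e k_def by (auto simp: field_simps power2_eq_square)
  \<comment> \<open>Multiplying by \<open>b1 * b2\<close> allows eliminating \<open>c1\<close> and
    \<open>c2\<close> through \<open>bc\<close> and leaves squares with nonnegative weights.\<close>
  have "b1 * b2 * (d1 * a2 - b1 * c2 - c1 * b2 + a1 * d2 - 2)
     = b1 * b2 * (T\<^sup>2 / 2 - 2 * p1 * p2 - 2) - b1\<^sup>2 * (b2 * c2) - b2\<^sup>2 * (b1 * c1)"
    unfolding e by (simp add: algebra_simps power2_eq_square)
  also have "\<dots> = k * (b1 - b2)\<^sup>2 + (b1 * p2 - b2 * p1)\<^sup>2"
    unfolding bc k_def by (simp add: field_simps power2_eq_square)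
  also have "\<dots> \<ge> 0" using k by simp
  finally show ?thesis using assms(6) by (simp add: zero_le_mult_iff)
qed

text \<open>If \<open>D\<close> agreed at two points of the interior of a band, the form
  \<open>det (M\<^sub>1 v, M\<^sub>2 v)\<close> would be definite by comparison, but its discriminant \<open>(tr M\<^sub>1\<^sup>-\<^sup>1 M\<^sub>2)\<^sup>2 - 4\<close> is not negative.\<close>

lemma D_inj_band:
  assumes i: "inband j l1" "inband j l2" and eq: "D l1 = D l2" shows "l1 = l2"
proof -
  have False if i: "inband j l1" "inband j l2" and eq: "D l1 = D l2" and l: "l1 < l2" for l1 l2
  proof (cases "(D l1)\<^sup>2 < 4")
    case True
    have int: "real j * pi < disp l t \<and> disp l t < real (Suc j) * pi" if "inband j l" "D l = D l1" for l t
    proof (rule ccontr)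
      assume "\<not> ?thesis"
      then have "disp l t = real j * pi \<or> disp l t = real (Suc j) * pi" using that(1) unfolding inband_def
        by (meson antisym not_le)
      then obtain m where "disp l t = real m * pi" by blast
      then have "D l = 2 * (-1) ^ m" using edge_D(1)[OF inband_D[OF that(1)]] by blast
      then have "(D l)\<^sup>2 = 4" by (simp add: power_mult_distrib flip: power_mult)
      then show False using True that(2) by simp
    qed
    note I1 = int[OF i(1) refl] and I2 = int[OF i(2) eq[symmetric]]
    \<comment> \<open>Coefficients of the determinant of \<open>M1 v\<close> and
      \<open>M2 v\<close>, up to sign, at \<open>v = (sin t, cos t)\<close>.\<close>
    define A where "A = ma l2 * mc l1 - ma l1 * mc l2"
    define B where "B = ma l2 * md l1 + mb l2 * mc l1 - ma l1 * md l2 - mb l1 * mc l2"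
    define C where "C = mb l2 * md l1 - mb l1 * md l2"
    have "qform A B C t \<noteq> 0" for t
    proof -
      \<comment> \<open>Both displacements lie inside the same interval of length \<open>pi\<close>,
        so their difference stays between \<open>0\<close> and \<open>pi\<close>.\<close>
      have "sin (Th l2 t - Th l1 t) > 0"
        using disp_strict[OF l, of t] I1[of t] I2[of t] by (intro sin_gt_zero) (auto simp: disp_def algebra_simps)
      then have "R l1 t * R l2 t * sin (Th l2 t - Th l1 t) > 0" using R_pos by simp
      also have "R l1 t * R l2 t * sin (Th l2 t - Th l1 t) =
          (R l2 t * sin (Th l2 t)) * (R l1 t * cos (Th l1 t)) - (R l1 t * sin (Th l1 t)) * (R l2 t * cos (Th l2 t))"
        by (simp add: sin_diff algebra_simps)
      also have "\<dots> = qform A B C t"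
        unfolding R_sin_Th R_cos_Th by (simp add: qform_def A_def B_def C_def algebra_simps power2_eq_square)
      finally show ?thesis by simp
    qed
    then have "B\<^sup>2 - 4 * A * C < 0" by (rule qform_no_root_disc)
    moreover define tr where "tr = md l1 * ma l2 - mb l1 * mc l2 - mc l1 * mb l2 + ma l1 * md l2"
    have "B\<^sup>2 - 4 * A * C = tr\<^sup>2 - 4 * (ma l1 * md l1 - mb l1 * mc l1) * (ma l2 * md l2 - mb l2 * mc l2)"
      unfolding A_def B_def C_def tr_def by algebra
    ultimately have "tr\<^sup>2 < 4" by (simp add: det1)
    moreover have "tr \<ge> 2" unfolding tr_def
    proof (rule trace_lower_bound[OF det1 det1 _ _ True])
      have s: "(-1) ^ j * mb l > 0" if "\<And>t. real j * pi < disp l t \<and> disp l t < real (Suc j) * pi" for l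
      proof -
        have "(-1) ^ j * sin (disp l 0) > 0" using that by (intro sin_band_pos) auto
        moreover have "mb l = R l 0 * sin (disp l 0)" unfolding R_sin_disp by (simp add: qform_def)
        ultimately show ?thesis using mult_pos_pos[OF R_pos[of l 0], of "(-1) ^ j * sin (disp l 0)"] by (simp add: mult.left_commute)
      qed
      show "mb l1 * mb l2 > 0" using s[OF I1] s[OF I2] neg_one_cases[of j] by (auto simp: mult_neg_neg)
    qed (use eq in \<open>auto simp: D_def\<close>)
    then have "tr\<^sup>2 \<ge> 2\<^sup>2" by (intro power_mono) auto
    ultimately show False by simp
  next
    case False
    have ed: "\<exists>t m. (m = j \<or> m = Suc j) \<and> disp l t = real m * pi \<and> D l = 2 * (-1) ^ m" if ib: "inband j l" and Dl: "D l = D l1" for l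
    proof -
      obtain t where "\<not> (real j * pi < disp l t \<and> disp l t < real (Suc j) * pi)"
        using inband_interior_D[of j l] False Dl by auto
      then have "disp l t = real j * pi \<or> disp l t = real (Suc j) * pi" using ib unfolding inband_def
        by (meson antisym not_le)
      then show ?thesis using edge_D(1)[OF inband_D[OF ib]] by blast
    qed
    obtain t m where t: "m = j \<or> m = Suc j" "disp l1 t = real m * pi" "D l1 = 2 * (-1) ^ m" using ed[OF i(1)] by blast
    obtain s n where s: "n = j \<or> n = Suc j" "disp l2 s = real n * pi" "D l2 = 2 * (-1) ^ n" using ed[OF i(2)] eq by metis
    \<comment> \<open>\<open>D\<close> takes opposite values at the two ends of a band, so equal
      \<open>D\<close> puts both parameters at the same end, where \<open>disp_strict\<close>
      separates them.\<close>
    have "m = n" using t(1,3) s(1,3) eq neg_one_cases[of j] by auto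
    show False
    proof (cases "m = j")
      case True
      then have "disp l2 s = real j * pi" using s \<open>m = n\<close> by simp
      moreover have "real j * pi \<le> disp l1 s" using i(1) by (simp only: inband_def)
      ultimately show ?thesis using disp_strict[OF l, of s] by linarith
    next
      case False
      then have "disp l1 t = real (Suc j) * pi" using t by simp
      moreover have "disp l2 t \<le> real (Suc j) * pi" using i(2) by (simp only: inband_def)
      ultimately show ?thesis using disp_strict[OF l, of t] by linarith
    qed
  qed
  from this[OF i eq] this[OF i(2,1) eq[symmetric]] show ?thesis by (cases l1 l2 rule: linorder_cases) auto
qed

text \<open>\<open>D\<close> runs from \<open>2 * (-1) ^ j\<close> at the bottom of the band to the
  opposite value at the top; continuity gives existence and \<open>D_inj_band\<close>
  uniqueness.\<close>

lemma band_value_ex1: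
  assumes "\<bar>c\<bar> \<le> 2" shows "\<exists>!l. inband j l \<and> D l = c"
proof -
  have le: "beta j \<le> alpha (Suc j)" using beta_less_alpha_Suc[of j] by simp
  have "\<exists>l. beta j \<le> l \<and> l \<le> alpha (Suc j) \<and> D l = c"
  proof (cases "even j")
    case True
    then have "D (beta j) = 2" "D (alpha (Suc j)) = -2" using D_beta[of j] D_alpha[of "Suc j"] by auto
    then show ?thesis using IVT2'[of D "alpha (Suc j)" c "beta j"] le assms D_cont by auto
  next
    case False
    then have "D (beta j) = -2" "D (alpha (Suc j)) = 2" using D_beta[of j] D_alpha[of "Suc j"] by auto
    then show ?thesis using IVT'[of D "beta j" c "alpha (Suc j)"] le assms D_cont by auto
  qed
  then show ?thesis using D_inj_band by (auto simp: inband_iff)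
qed

end

section \<open>Bloch eigenspaces and bands\<close>

lemma loc_bdd_meas_set_integrable:
  assumes "loc_bdd_meas f" shows "set_integrable lebesgue {a..b} f"
proof -
  obtain B where B: "\<And>x. \<bar>x\<bar> \<le> \<bar>a\<bar> + \<bar>b\<bar> \<Longrightarrow> norm (f x) \<le> B" using loc_bdd_meas_bound[OF assms] by blast
  show ?thesis
  proof (rule measurable_bounded_by_integrable_imp_absolutely_integrable)
    show "f \<in> borel_measurable (lebesgue_on {a..b})"
      using loc_bdd_measD[OF assms] by (simp add: measurable_completion measurable_restrict_space1)
    show "(\<lambda>x. B) integrable_on {a..b}" by (rule integrable_const_ivl)
    show "norm (f x) \<le> B" if "x \<in> {a..b}" for x using that by (intro B) auto
  qed auto
qed

lemma loc_bdd_meas_lebesgue: "loc_bdd_meas f \<Longrightarrow> f \<in> borel_measurable lebesgue"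
  by (simp add: loc_bdd_measD measurable_completion)

lemma primitive_set_integral:
  assumes "primitive F f" "a \<le> b" shows "set_lebesgue_integral lebesgue {a..b} f = F b - F a"
  using set_lebesgue_integral_eq_integral(2)[OF loc_bdd_meas_set_integrable[OF primitiveD(2)[OF assms(1)]]]
    primitiveD(3)[OF assms] by simp

text \<open>The potential enters only through an almost everywhere equation, which permits passing
  to a better representative.\<close>

lemma bloch_eigenspace_cong_AE:
  assumes "AE x in lebesgue. V x = W x" shows "bloch_eigenspace X V k \<mu> = bloch_eigenspace X W k \<mu>"
proof -
  have "(AE x in lebesgue. bloch_op V k u u1 u2 x = of_real \<mu> * u x) \<longleftrightarrow>
    (AE x in lebesgue. bloch_op W k u u1 u2 x = of_real \<mu> * u x)" for u u1 u2
    using assms by (intro AE_cong_simp eventually_subst) (auto simp: bloch_op_def elim: eventually_mono)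
  then show ?thesis by (simp add: bloch_eigenspace_def)
qed

lemma band_cong_AE:
  assumes "AE x in lebesgue. V x = W x"
  shows "band_max X V m = band_max X W m" "band_min X V m = band_min X W m" "gap_ratio X m V = gap_ratio X m W"
proof -
  have "bloch_mult X V k \<mu> = bloch_mult X W k \<mu>" for k \<mu>
    by (simp add: bloch_mult_def bloch_eigenspace_cong_AE[OF assms])
  then have "band X V n k = band X W n k" for n k
    by (simp add: band_def bloch_eigenvalue_seq_def)
  then show "band_max X V m = band_max X W m" "band_min X V m = band_min X W m" "gap_ratio X m V = gap_ratio X m W"
    by (simp_all add: band_max_def band_min_def gap_ratio_def)
qed

text \<open>Local square integrability of \<open>u2\<close> gives local integrability through
  \<open>norm z \<le> 1 + (norm z)^2\<close>, so \<open>u1\<close> is an indefinite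
  integral.\<close>

lemma periodic_H2_derivative_continuous:
  assumes "periodic_H2 X u u1 u2" shows "continuous_on UNIV u1"
proof -
  have int: "set_integrable lebesgue {a..b} u2" for a b
  proof -
    have 1: "set_integrable lebesgue {a..b} (\<lambda>x. 1 + (norm (u2 x))\<^sup>2)"
      using assms loc_bdd_meas_set_integrable[OF loc_bdd_meas_const[of "1::real"], of a b]
      by (intro set_integral_add(1)) (auto simp: periodic_H2_def)
    show ?thesis
    proof (rule set_integrable_bound[OF 1])
      show "set_borel_measurable lebesgue {a..b} u2" unfolding set_borel_measurable_def
        by (intro borel_measurable_scaleR borel_measurable_indicator) (use assms in \<open>auto simp: periodic_H2_def\<close>)
      have "norm (u2 x) \<le> norm (1 + (norm (u2 x))\<^sup>2)" for x
      proof -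
        have "0 \<le> (norm (u2 x) - 1)\<^sup>2 + (norm (u2 x))\<^sup>2 + 1" by simp
        then show ?thesis by (simp add: power2_eq_square algebra_simps)
      qed
      then show "AE x in lebesgue. x \<in> {a..b} \<longrightarrow> norm (u2 x) \<le> norm (1 + (norm (u2 x))\<^sup>2)" by simp
    qed
  qed
  have "isCont u1 x" for x
  proof -
    have "continuous_on {x-1..x+1} (\<lambda>y. u1 (x-1) + integral {x-1..y} u2)"
      by (intro continuous_intros indefinite_integral_continuous_1 set_lebesgue_integral_eq_integral(1) int)
    then have "continuous_on {x-1..x+1} u1"
    proof (rule continuous_on_eq)
      fix y assume y: "y \<in> {x-1..x+1}"
      then have "u1 y - u1 (x-1) = set_lebesgue_integral lebesgue {x-1..y} u2" using assms by (auto simp: periodic_H2_def)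
      also have "\<dots> = integral {x-1..y} u2" by (rule set_lebesgue_integral_eq_integral(2)[OF int])
      finally show "u1 (x-1) + integral {x-1..y} u2 = u1 y" by (simp add: algebra_simps)
    qed
    then show ?thesis by (rule continuous_on_interior) simp
  qed
  then show ?thesis by (simp add: continuous_at_imp_continuous_on)
qed

text \<open>Gauge factor: \<open>y x = phase k x * u x\<close> removes the quasimomentum from the
  operator and moves it into the boundary condition
  \<open>y (x + X) = phase k X * y x\<close>.\<close>

definition phase :: "real \<Rightarrow> real \<Rightarrow> complex" where "phase k x = cis (k * x)"

lemma phase_derivative: "(phase k has_vector_derivative \<i> * of_real k * phase k x) (at x)"
proof -
  have "((\<lambda>x. exp (of_real x * (\<i> * of_real k))) has_vector_derivative
      ((\<i> * of_real k) * exp (of_real x * (\<i> * of_real k)))) (at x)"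
    by (rule has_vector_derivative_real_field) (auto intro!: derivative_eq_intros)
  then show ?thesis by (simp add: phase_def[abs_def] cis_conv_exp mult_ac)
qed

lemma phase_cont: "continuous_on S (phase k)"
  using phase_derivative[of k] has_vector_derivative_continuous continuous_at_imp_continuous_on by blast

lemma phase_primitive: "primitive (phase k) (\<lambda>x. \<i> * of_real k * phase k x)"
  by (rule primitive_deriv[OF phase_derivative]) (intro continuous_intros phase_cont)

lemma phase_add: "phase k (x + y) = phase k x * phase k y" by (simp add: phase_def cis_mult algebra_simps)
lemma phase_cancel: "phase (-k) x * phase k x = 1" "phase k x * phase (-k) x = 1"
  by (simp_all add: phase_def cis_mult)
lemma phase_0: "phase k 0 = 1" by (simp add: phase_def)

lemma ysol_not_zero: assumes "bdd_meas q" shows "\<exists>x. ysol q t x \<noteq> 0"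
proof (rule ccontr)
  assume "\<not> ?thesis"
  then have "sin (th q t x) = 0" for x by (simp add: ysol_def)
  then show False using prufer_sin_not_zero_on[OF assms th(1)[OF assms], of 0 1] by auto
qed

text \<open>For a singular matrix that is not a multiple of the identity, a nonzero row determines
  the kernel up to scaling; the last two cases are diagonal with exactly one entry equal to
  \<open>z\<close>.\<close>

lemma kernel_2x2_span:
  fixes a b c d z :: complex
  assumes det: "(a - z) * (d - z) - b * c = 0" and ns: "\<not> (b = 0 \<and> c = 0 \<and> a = d)"
  obtains v w where "v \<noteq> 0 \<or> w \<noteq> 0"
    "\<And>x y. (x * a + y * b = z * x \<and> x * c + y * d = z * y) \<longleftrightarrow> (\<exists>s. x = s * v \<and> y = s * w)"
proof -
  consider "b \<noteq> 0" | "c \<noteq> 0" | "b = 0" "c = 0" "a = z" "d \<noteq> z" | "b = 0" "c = 0" "d = z" "a \<noteq> z"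
    using det ns by (cases "b = 0"; cases "c = 0"; cases "a = z"; cases "d = z") auto
  then show ?thesis
  proof cases
    case 1
    have "(x * a + y * b = z * x \<and> x * c + y * d = z * y) \<longleftrightarrow> (\<exists>s. x = s * b \<and> y = s * (z - a))" for x y
    proof
      assume h: "x * a + y * b = z * x \<and> x * c + y * d = z * y"
      then have "y * b = x * (z - a)" by (simp add: algebra_simps)
      then show "\<exists>s. x = s * b \<and> y = s * (z - a)" using 1 by (intro exI[of _ "x / b"]) (simp add: field_simps)
    next
      assume "\<exists>s. x = s * b \<and> y = s * (z - a)"
      then obtain s where s: "x = s * b" "y = s * (z - a)" by blast
      have "x * c + y * d - z * y = s * (b * c - (a - z) * (d - z))" unfolding s by (simp add: algebra_simps)
      also have "b * c - (a - z) * (d - z) = 0" using det by simp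
      finally have "x * c + y * d = z * y" by simp
      then show "x * a + y * b = z * x \<and> x * c + y * d = z * y" unfolding s by (simp add: algebra_simps)
    qed
    then show ?thesis using that[of b "z - a"] 1 by blast
  next
    case 2
    have "(x * a + y * b = z * x \<and> x * c + y * d = z * y) \<longleftrightarrow> (\<exists>s. x = s * (z - d) \<and> y = s * c)" for x y
    proof
      assume h: "x * a + y * b = z * x \<and> x * c + y * d = z * y"
      then have "x * c = y * (z - d)" by (simp add: algebra_simps)
      then show "\<exists>s. x = s * (z - d) \<and> y = s * c" using 2 by (intro exI[of _ "y / c"]) (simp add: field_simps)
    next
      assume "\<exists>s. x = s * (z - d) \<and> y = s * c"
      then obtain s where s: "x = s * (z - d)" "y = s * c" by blast
      have "x * a + y * b - z * x = s * (b * c - (a - z) * (d - z))" unfolding s by (simp add: algebra_simps)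
      also have "b * c - (a - z) * (d - z) = 0" using det by simp
      finally have "x * a + y * b = z * x" by simp
      then show "x * a + y * b = z * x \<and> x * c + y * d = z * y" unfolding s by (simp add: algebra_simps)
    qed
    then show ?thesis using that[of "z - d" c] 2 by blast
  next
    case 3
    then have "(x * a + y * b = z * x \<and> x * c + y * d = z * y) \<longleftrightarrow> (\<exists>s. x = s * 1 \<and> y = s * 0)" for x y by auto
    then show ?thesis using that[of 1 0] by auto
  next
    case 4
    then have "(x * a + y * b = z * x \<and> x * c + y * d = z * y) \<longleftrightarrow> (\<exists>s. x = s * 0 \<and> y = s * 1)" for x y by auto
    then show ?thesis using that[of 0 1] by auto
  qed
qed

context hill
begin

text \<open>\<open>c1\<close> and \<open>c2\<close> are the initial value and slope of the gauged
  function \<open>y\<close>, that is, of \<open>phase k\<close> times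
  \<open>bloch_fun\<close>.\<close>

definition bloch_fun :: "real \<Rightarrow> real \<Rightarrow> complex \<Rightarrow> complex \<Rightarrow> real \<Rightarrow> complex" where
  "bloch_fun k l c1 c2 x = phase (-k) x * (c1 * of_real (ysol (q l) (pi/2) x) + c2 * of_real (ysol (q l) 0 x))"

text \<open>Eigenvectors of the monodromy matrix for the Floquet multiplier
  \<open>phase k X\<close>, together with zero.\<close>

definition bloch_kernel :: "real \<Rightarrow> real \<Rightarrow> (complex \<times> complex) set" where
  "bloch_kernel k l = {(c1, c2). c1 * of_real (ma l) + c2 * of_real (mb l) = phase k X * c1 \<and>
      c1 * of_real (mc l) + c2 * of_real (md l) = phase k X * c2}"

lemma bloch_eigenspace_sub:
  assumes "u \<in> bloch_eigenspace X V k l"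
  shows "\<exists>c1 c2. (c1, c2) \<in> bloch_kernel k l \<and> u = bloch_fun k l c1 c2"
proof -
  obtain u1 u2 where H: "periodic_H2 X u u1 u2" and ae: "AE x in lebesgue. bloch_op V k u u1 u2 x = of_real l * u x"
    using assms by (auto simp: bloch_eigenspace_def)
  have per: "u (x + X) = u x" and du: "(u has_vector_derivative u1 x) (at x)" for x
    using H by (auto simp: periodic_H2_def)
  have c1: "continuous_on UNIV u1" by (rule periodic_H2_derivative_continuous[OF H])
  have c0: "continuous_on UNIV u" using du has_vector_derivative_continuous continuous_at_imp_continuous_on by blast
  \<comment> \<open>The eigenvalue equation solved for the second derivative at every point:
    \<open>u2\<close> is known only almost everywhere, while \<open>g\<close> is Borel and locally
    bounded and so qualifies for \<open>primitive\<close>.\<close>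
  define g where "g x = of_real (q l x) * u x - 2 * \<i> * of_real k * u1 x + (of_real k)\<^sup>2 * u x" for x
  have gm: "loc_bdd_meas g" unfolding g_def[abs_def]
    by (intro loc_bdd_meas_add loc_bdd_meas_diff loc_bdd_meas_mult loc_bdd_meas_of_real loc_bdd_meas_const bdd_meas_loc q_bdd loc_bdd_meas_cont c0 c1)
  have ug: "AE x in lebesgue. u2 x = g x"
  proof (rule AE_mp[OF ae], intro AE_I2 impI)
    fix x assume "bloch_op V k u u1 u2 x = of_real l * u x"
    then show "u2 x = g x" unfolding bloch_op_def g_def q_def of_real_diff
      by (simp add: algebra_simps power2_eq_square)
  qed
  have p0: "primitive u u1" by (rule primitive_deriv[OF du c1])
  have p1: "primitive u1 g" unfolding primitive_def
  proof (intro conjI gm allI impI)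
    fix a b :: real assume ab: "a \<le> b"
    have "u1 b - u1 a = set_lebesgue_integral lebesgue {a..b} u2" using H ab by (auto simp: periodic_H2_def)
    also have "\<dots> = set_lebesgue_integral lebesgue {a..b} g"
      using H ug loc_bdd_meas_lebesgue[OF gm] by (intro set_lebesgue_integral_cong_AE) (auto simp: periodic_H2_def)
    also have "\<dots> = integral {a..b} g"
      by (rule set_lebesgue_integral_eq_integral(2)[OF loc_bdd_meas_set_integrable[OF gm]])
    finally show "(g has_integral (u1 b - u1 a)) {a..b}"
      using loc_bdd_meas_integrable[OF gm] by (simp add: has_integral_integral)
  qed
  define y where "y x = phase k x * u x" for x
  define y1 where "y1 x = phase k x * (u1 x + \<i> * of_real k * u x)" for x
  have "sol (q l) y y1" unfolding sol_def
  proof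
    show "primitive y y1"
      by (rule primitive_cong[OF primitive_mult[OF phase_primitive[of k] p0]]) (auto simp: y_def y1_def algebra_simps)
    show "primitive y1 (\<lambda>x. of_real (q l x) * y x)"
      by (rule primitive_cong[OF primitive_mult[OF phase_primitive[of k] primitive_add[OF p1 primitive_cmult[OF p0, where c="\<i> * of_real k"]]]])
         (auto simp: y_def y1_def g_def algebra_simps power2_eq_square)
  qed
  note R = sol_repr[OF q_bdd this]
  have u1per: "u1 (x + X) = u1 x" for x
  proof -
    have d1: "((\<lambda>x. x + X) has_vector_derivative 1) (at x)"
      by (auto intro!: derivative_eq_intros simp flip: has_real_derivative_iff_has_vector_derivative)
    have "((\<lambda>x. u (x + X)) has_vector_derivative u1 (x + X)) (at x)"
      using vector_diff_chain_at[of "\<lambda>x. x + X" 1 x u "u1 (x + X)", OF d1 du]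
      by (simp add: o_def)
    then have "(u has_vector_derivative u1 (x + X)) (at x)" by (simp add: per)
    then show ?thesis using du vector_derivative_unique_at by blast
  qed
  have "y X = phase k X * y 0" "y1 X = phase k X * y1 0"
    using per[of 0] u1per[of 0] by (simp_all add: y_def y1_def phase_0)
  then have "(y 0, y1 0) \<in> bloch_kernel k l"
    using R[of X] by (simp add: bloch_kernel_def ma_def mb_def mc_def md_def)
  moreover have "u = bloch_fun k l (y 0) (y1 0)"
  proof
    fix x
    have "u x = phase (-k) x * y x" using phase_cancel[of k x] by (simp add: y_def flip: mult.assoc)
    then show "u x = bloch_fun k l (y 0) (y1 0) x" unfolding bloch_fun_def R(1)[of x] .
  qed
  ultimately show ?thesis by blast
qed

lemma bloch_eigenspace_sup:
  assumes K: "(c1, c2) \<in> bloch_kernel k l"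
  shows "bloch_fun k l c1 c2 \<in> bloch_eigenspace X V k l"
proof -
  let ?f = "\<lambda>t x. of_real (ysol (q l) t x) :: complex" and ?g = "\<lambda>t x. of_real (ysol1 (q l) t x) :: complex"
  define y where "y x = c1 * ?f (pi/2) x + c2 * ?f 0 x" for x
  define y1 where "y1 x = c1 * ?g (pi/2) x + c2 * ?g 0 x" for x
  note S = sol_of_real[OF ysol_sol[OF q_bdd], where 'a=complex]
  have s: "sol (q l) y y1" unfolding y_def[abs_def] y1_def[abs_def] by (intro sol_add sol_cmult S)
  have s2: "sol (q l) (\<lambda>x. y (x + X)) (\<lambda>x. y1 (x + X))" by (rule sol_shift[OF s q_per])
  have y0: "y 0 = c1" "y1 0 = c2" by (simp_all add: y_def y1_def ysol_0)
  have "y (0 + X) = phase k X * c1" "y1 (0 + X) = phase k X * c2"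
    using K by (simp_all add: bloch_kernel_def y_def y1_def ma_def mb_def mc_def md_def)
  then have yX: "y (x + X) = phase k X * y x" for x
    using sol_repr(1)[OF q_bdd s2, of x] sol_repr(1)[OF q_bdd s, of x] y0 by (simp add: algebra_simps)
  define u where "u x = phase (-k) x * y x" for x
  define u1 where "u1 x = phase (-k) x * (y1 x - \<i> * of_real k * y x)" for x
  define u2 where "u2 x = phase (-k) x * (of_real (q l x) * y x - 2 * \<i> * of_real k * y1 x - (of_real k)\<^sup>2 * y x)" for x
  have p: "primitive y y1" "primitive y1 (\<lambda>x. of_real (q l x) * y x)" using s by (auto simp: sol_def)
  have pu: "primitive u u1"
    by (rule primitive_cong[OF primitive_mult[OF phase_primitive[of "-k"] p(1)]]) (auto simp: u_def u1_def algebra_simps)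
  have pu1: "primitive u1 u2"
    by (rule primitive_cong[OF primitive_mult[OF phase_primitive[of "-k"] primitive_diff[OF p(2) primitive_cmult[OF p(1), where c="\<i> * of_real k"]]]])
       (auto simp: u1_def u2_def algebra_simps power2_eq_square)
  have u2m: "loc_bdd_meas u2" by (rule primitiveD(2)[OF pu1])
  have u2n: "loc_bdd_meas (\<lambda>x. norm (u2 x))"
    using u2m unfolding loc_bdd_meas_def by (auto intro: borel_measurable_norm)
  have "periodic_H2 X u u1 u2" unfolding periodic_H2_def
  proof (intro conjI allI impI)
    show "u (x + X) = u x" for x
      using phase_cancel[of k X] by (simp add: u_def yX phase_add mult_ac)
    show "(u has_vector_derivative u1 x) (at x)" for x
      by (rule primitive_has_vector_derivative[OF pu primitive_continuous[OF pu1]])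
    show "u2 \<in> borel_measurable lebesgue" by (rule loc_bdd_meas_lebesgue[OF u2m])
    show "set_integrable lebesgue {a..b} (\<lambda>x. (norm (u2 x))\<^sup>2)" for a b
      by (rule loc_bdd_meas_set_integrable[OF loc_bdd_meas_power[OF u2n]])
    show "u1 b - u1 a = set_lebesgue_integral lebesgue {a..b} u2" if "a \<le> b" for a b
      using primitive_set_integral[OF pu1 that] by simp
  qed
  moreover have "bloch_op V k u u1 u2 x = of_real l * u x" for x
    by (simp add: bloch_op_def u_def u1_def u2_def q_def algebra_simps power2_eq_square)
  moreover have "bloch_fun k l c1 c2 = u" by (simp add: fun_eq_iff bloch_fun_def u_def y_def)
  ultimately show ?thesis by (auto simp: bloch_eigenspace_def)
qed

lemma bloch_eigenspace_eq: "bloch_eigenspace X V k l = (\<lambda>(c1, c2). bloch_fun k l c1 c2) ` bloch_kernel k l"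
  using bloch_eigenspace_sub[of _ k l] bloch_eigenspace_sup[of _ _ k l] by (auto simp: image_iff)

lemma bloch_fun_eq_0:
  assumes "\<And>x. bloch_fun k l c1 c2 x = 0" shows "c1 = 0 \<and> c2 = 0"
proof -
  have 1: "c1 = 0" using assms[of 0] by (simp add: bloch_fun_def phase_0 ysol_0)
  obtain x where "ysol (q l) 0 x \<noteq> 0" using ysol_not_zero[OF q_bdd] by blast
  moreover have "phase (-k) x \<noteq> 0" by (simp add: phase_def)
  ultimately show ?thesis using assms[of x] 1 by (simp add: bloch_fun_def)
qed

text \<open>Characteristic polynomial at \<open>z = phase k X\<close>: it is
  \<open>z^2 - D z + 1 = z (z + 1/z - D)\<close>, and \<open>z + 1/z = 2 cos (k X)\<close> on the
  unit circle.\<close>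

lemma bloch_det:
  "(of_real (ma l) - phase k X) * (of_real (md l) - phase k X) - of_real (mb l) * of_real (mc l)
   = phase k X * of_real (2 * cos (k * X) - D l)"
proof -
  let ?z = "phase k X"
  have z: "?z * ?z + 1 = ?z * of_real (2 * cos (k * X))"
    using sin_cos_squared_add[of "k * X"] by (simp add: phase_def complex_eq_iff power2_eq_square algebra_simps)
  have d: "of_real (ma l) * of_real (md l) - of_real (mb l) * of_real (mc l) = (1::complex)"
    using det1[of l] by (metis of_real_1 of_real_diff of_real_mult)
  show ?thesis using z d unfolding D_def of_real_diff of_real_add by algebra
qed

text \<open>\<open>bloch_fun\<close> is linear and injective in its coefficients, so the
  multiplicity is the dimension of \<open>bloch_kernel\<close>: zero, a line or everything,
  according to \<open>bloch_det\<close> and whether the matrix is scalar.\<close>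

lemma bloch_mult_eq:
  "bloch_mult X V k l = (if D l = 2 * cos (k * X) then if mb l = 0 \<and> mc l = 0 \<and> ma l = md l then 2 else 1 else 0)"
proof -
  interpret cf: vector_space "\<lambda>(c::complex) (f::real \<Rightarrow> complex) x. c * f x" by (rule vector_space_cfun)
  let ?S = "bloch_eigenspace X V k l" and ?b = "bloch_fun k l" and ?z = "phase k X"
  have lin: "(\<lambda>x. s * ?b c1 c2 x) = ?b (s * c1) (s * c2)" "?b c1 c2 + ?b d1 d2 = ?b (c1 + d1) (c2 + d2)" for s c1 c2 d1 d2
    by (auto simp: bloch_fun_def fun_eq_iff algebra_simps)
  have zero: "?b c1 c2 = 0 \<longleftrightarrow> c1 = 0 \<and> c2 = 0" for c1 c2
    using bloch_fun_eq_0[of k l c1 c2] by (auto simp: fun_eq_iff bloch_fun_def)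
  show ?thesis
  proof (cases "D l = 2 * cos (k * X)")
    case False
    have "(c1, c2) \<in> bloch_kernel k l \<longleftrightarrow> c1 = 0 \<and> c2 = 0" for c1 c2
    proof
      assume "(c1, c2) \<in> bloch_kernel k l"
      then have 1: "c1 * of_real (ma l) + c2 * of_real (mb l) = ?z * c1" "c1 * of_real (mc l) + c2 * of_real (md l) = ?z * c2"
        by (auto simp: bloch_kernel_def)
      have nz: "?z * of_real (2 * cos (k * X) - D l) \<noteq> 0"
      proof -
        have "2 * cos (k * X) - D l \<noteq> 0" using False by simp
        then show ?thesis by (simp only: mult_eq_0_iff of_real_eq_0_iff) (simp add: phase_def)
      qed
      \<comment> \<open>Cramer's rule: the determinant of the system annihilates both
        unknowns.\<close>
      have "?z * of_real (2 * cos (k * X) - D l) * c1 = 0" "?z * of_real (2 * cos (k * X) - D l) * c2 = 0"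
        using 1 unfolding bloch_det[symmetric] by algebra+
      then show "c1 = 0 \<and> c2 = 0" using nz by auto
    qed (simp add: bloch_kernel_def)
    then have "bloch_kernel k l = {(0, 0)}" by auto
    then have "?S = {0}" using zero[of 0 0] by (simp add: bloch_eigenspace_eq)
    then have "cf.dim ?S = 0" by (intro cf.dim_unique[of "{}"]) (auto simp: cf.independent_empty)
    then show ?thesis using False by (simp add: bloch_mult_def)
  next
    case True
    show ?thesis
    proof (cases "mb l = 0 \<and> mc l = 0 \<and> ma l = md l")
      case sc: True
      have "(of_real (ma l) - ?z) * (of_real (ma l) - ?z) = 0" using bloch_det[of l k] sc True by simp
      then have mz: "of_real (ma l) = ?z" by simp
      have "bloch_kernel k l = UNIV" using sc mz by (auto simp: bloch_kernel_def)
      then have S: "?S = {?b c1 c2 | c1 c2. True}" by (auto simp: bloch_eigenspace_eq image_iff)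
      have ne: "?b 1 0 \<noteq> ?b 0 1"
      proof
        assume "?b 1 0 = ?b 0 1"
        then have "?b 1 0 + ?b 0 (-1) = ?b 0 1 + ?b 0 (-1)" by simp
        then show False unfolding lin using zero[of 1 "-1"] zero[of 0 0] by simp
      qed
      have "cf.dim ?S = 2"
      proof (rule cf.dim_unique[of "{?b 1 0, ?b 0 1}"])
        show "{?b 1 0, ?b 0 1} \<subseteq> ?S" unfolding S by blast
        show "?S \<subseteq> cf.span {?b 1 0, ?b 0 1}"
        proof
          fix f assume "f \<in> ?S"
          then obtain c1 c2 where f: "f = ?b c1 c2" unfolding S by blast
          have "(\<lambda>x. c1 * ?b 1 0 x) + (\<lambda>x. c2 * ?b 0 1 x) \<in> cf.span {?b 1 0, ?b 0 1}"
            by (intro cf.span_add cf.span_scale cf.span_base) auto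
          then show "f \<in> cf.span {?b 1 0, ?b 0 1}" unfolding lin f by simp
        qed
        have "?b 1 0 \<notin> cf.span {?b 0 1}"
        proof
          assume "?b 1 0 \<in> cf.span {?b 0 1}"
          then obtain s where "?b 1 0 = (\<lambda>x. s * ?b 0 1 x)" by (auto simp: cf.span_singleton)
          then have "?b 1 0 = ?b 0 s" unfolding lin by simp
          then have "?b 1 0 + ?b 0 (-s) = ?b 0 s + ?b 0 (-s)" by simp
          then show False unfolding lin using zero[of 1 "-s"] zero[of 0 0] by simp
        qed
        moreover have "cf.independent {?b 0 1}"
          using zero[of 0 1] by (simp add: cf.independent_insert cf.independent_empty)
        ultimately show "cf.independent {?b 1 0, ?b 0 1}" by (rule cf.independent_insertI)
        show "card {?b 1 0, ?b 0 1} = 2" using ne by simp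
      qed
      then show ?thesis using True sc by (simp add: bloch_mult_def)
    next
      case nsc: False
      have "(of_real (ma l) - ?z) * (of_real (md l) - ?z) - of_real (mb l) * of_real (mc l) = 0"
        using bloch_det[of l k] True by simp
      moreover have "\<not> (of_real (mb l) = (0::complex) \<and> of_real (mc l) = (0::complex) \<and> of_real (ma l) = (of_real (md l) :: complex))"
        using nsc by simp
      ultimately obtain v w where vw: "v \<noteq> 0 \<or> w \<noteq> 0"
        "\<And>x y. (x * of_real (ma l) + y * of_real (mb l) = ?z * x \<and> x * of_real (mc l) + y * of_real (md l) = ?z * y)
           \<longleftrightarrow> (\<exists>s. x = s * v \<and> y = s * w)" by (rule kernel_2x2_span) blast
      have "bloch_kernel k l = {(s * v, s * w) | s. True}" unfolding bloch_kernel_def vw(2) by auto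
      then have S: "?S = range (\<lambda>s x. s * ?b v w x)" by (auto simp: bloch_eigenspace_eq lin image_iff)
      have "cf.dim ?S = 1"
      proof (rule cf.dim_unique[of "{?b v w}"])
        show "{?b v w} \<subseteq> ?S" unfolding S using rangeI[of "\<lambda>s x. s * ?b v w x" 1] by simp
        show "?S \<subseteq> cf.span {?b v w}" unfolding S cf.span_singleton by simp
        show "cf.independent {?b v w}" using zero[of v w] vw(1) by (simp add: cf.independent_insert cf.independent_empty)
      qed simp
      then show ?thesis using True nsc by (simp add: bloch_mult_def)
    qed
  qed
qed

definition band_value :: "real \<Rightarrow> nat \<Rightarrow> real" where
  "band_value k j = (THE l. inband j l \<and> D l = 2 * cos (k * X))"

lemma band_value: "inband j (band_value k j) \<and> D (band_value k j) = 2 * cos (k * X)"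
  unfolding band_value_def by (rule theI'[OF band_value_ex1]) (simp add: abs_mult)

lemma band_value_eqI: "inband j l \<Longrightarrow> D l = 2 * cos (k * X) \<Longrightarrow> band_value k j = l"
  using D_inj_band[of j "band_value k j" l] band_value by simp

text \<open>When \<open>D l = 2 * cos (k * X)\<close>, the value \<open>l\<close> is taken once for
  each band containing it, and \<open>card_inband\<close> matches this with the multiplicity;
  neighbouring bands are ordered by \<open>alpha_le_beta\<close>.\<close>

lemma bloch_eigenvalue_seq_band_value: "bloch_eigenvalue_seq X V k (band_value k)"
  unfolding bloch_eigenvalue_seq_def
proof (intro conjI allI)
  show "mono (band_value k)" unfolding mono_iff_le_Suc
  proof
    fix j
    have "band_value k j \<le> alpha (Suc j)" "beta (Suc j) \<le> band_value k (Suc j)" using band_value inband_iff by blast+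
    then show "band_value k j \<le> band_value k (Suc j)" using alpha_le_beta[of "Suc j"] by simp
  qed
  fix l
  have e: "{j. band_value k j = l} = (if D l = 2 * cos (k * X) then {j. inband j l} else {})"
    using band_value band_value_eqI by auto
  have "(D l)\<^sup>2 \<le> 4" if "D l = 2 * cos (k * X)" unfolding that by (simp add: power_mult_distrib abs_square_le_1)
  then show "finite {j. band_value k j = l}" "card {j. band_value k j = l} = bloch_mult X V k l"
    unfolding e bloch_mult_eq using card_inband by auto
qed

end

text \<open>At the first index of disagreement, the smaller value can occur in the other sequence
  only at earlier indices, where both agree, hence less often. This justifies the \<open>THE\<close>
  in \<open>band\<close>.\<close>

lemma bloch_eigenvalue_seq_unique:
  assumes "bloch_eigenvalue_seq X V k e" "bloch_eigenvalue_seq X V k e'" shows "e = e'"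
proof
  have *: "\<not> e n < e' n" if e: "bloch_eigenvalue_seq X V k e" "bloch_eigenvalue_seq X V k e'"
    and IH: "\<And>i. i < n \<Longrightarrow> e i = e' i" for e e' n
  proof
    assume lt: "e n < e' n"
    let ?A = "{j. e j = e n}" and ?B = "{j. e' j = e n}"
    have m: "mono e'" and fin: "finite ?A" and c: "card ?A = card ?B" using e by (auto simp: bloch_eigenvalue_seq_def)
    have "?B \<subseteq> {j. j < n \<and> e j = e n}"
    proof
      fix j assume j: "j \<in> ?B"
      then have "j < n" using monoD[OF m, of n j] lt by (cases "j < n") auto
      then show "j \<in> {j. j < n \<and> e j = e n}" using j IH by auto
    qed
    then have "?B \<subset> ?A" by auto
    then have "card ?B < card ?A" by (rule psubset_card_mono[OF fin])
    then show False using c by simp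
  qed
  fix n show "e n = e' n"
  proof (induction n rule: less_induct)
    case (less n)
    then show ?case using *[OF assms, of n] *[OF assms(2,1), of n] by fastforce
  qed
qed

context hill
begin

lemma band_eq: "band X V n k = band_value k (n - 1)"
proof -
  have "(THE e. bloch_eigenvalue_seq X V k e) = band_value k"
    by (intro the_equality bloch_eigenvalue_seq_band_value bloch_eigenvalue_seq_unique[OF _ bloch_eigenvalue_seq_band_value])
  then show ?thesis by (simp add: band_def)
qed

lemma edge_quasimomentum: "\<exists>k\<in>{- pi / X..pi / X}. cos (k * X) = (-1) ^ m"
proof (cases "even m")
  case True
  then show ?thesis using X by (intro bexI[of _ 0]) auto
next
  case False
  then show ?thesis using X by (intro bexI[of _ "pi / X"]) (auto simp: field_simps)
qed

text \<open>The edge is reached where \<open>cos (k * X) = (-1) ^ m\<close>, that is at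
  \<open>k = 0\<close> or \<open>k = pi / X\<close>; band number \<open>m\<close> has the index
  \<open>m - 1\<close>.\<close>

lemma band_max_eq: assumes "m \<ge> 1" shows "band_max X V m = alpha m"
proof -
  obtain k where k: "k \<in> {- pi / X..pi / X}" "cos (k * X) = (-1) ^ m" using edge_quasimomentum by blast
  have "band_value k (m - 1) = alpha m"
    using alpha_inband[OF assms] D_alpha[OF assms] k(2) by (intro band_value_eqI) auto
  moreover have "band_value k' (m - 1) \<le> alpha m" for k'
    using band_value[of "m - 1" k'] assms by (simp add: inband_iff)
  ultimately show ?thesis unfolding band_max_def band_eq using k(1)
    by (intro cSup_eq_maximum) (auto intro!: image_eqI[of _ _ k])
qed

lemma band_min_eq: "band_min X V m = beta m"
proof -
  obtain k where k: "k \<in> {- pi / X..pi / X}" "cos (k * X) = (-1) ^ m" using edge_quasimomentum by blast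
  have "band_value k m = beta m"
    using beta_inband D_beta k(2) by (intro band_value_eqI) auto
  moreover have "beta m \<le> band_value k' m" for k'
    using band_value[of m k'] by (simp add: inband_iff)
  ultimately show ?thesis unfolding band_min_def band_eq using k(1)
    by (intro cInf_eq_minimum) (auto intro!: image_eqI[of _ _ k])
qed

lemma gap_ratio_eq: "m \<ge> 1 \<Longrightarrow> gap_ratio X m V = (beta m - alpha m) / ((alpha m + beta m) / 2)"
  by (simp add: gap_ratio_def band_max_eq band_min_eq)

end

section \<open>First order perturbation of the band edges\<close>

lemma ysol_cont: "bdd_meas q \<Longrightarrow> continuous_on S (ysol q t)" "bdd_meas q \<Longrightarrow> continuous_on S (ysol1 q t)"
  using ysol_sol[of q t] unfolding sol_def by (auto intro: primitive_continuous)

text \<open>The Wronskian of the two solutions equals \<open>t\<close> times the integral of \<open>g y z\<close>,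
  and determines the sign of the difference of the angles.\<close>

lemma angle_perturbation:
  assumes q: "bdd_meas q" and g: "bdd_meas g" and X: "X > 0"
    and I: "((\<lambda>x. g x * (ysol q s x)\<^sup>2) has_integral I) {0..X}" "I \<noteq> 0"
  shows "\<exists>d>0. \<forall>t. 0 < t \<longrightarrow> t < d \<longrightarrow> I * (th (\<lambda>x. q x - t * g x) s X - th q s X) > 0"
proof -
  obtain G where G: "G \<ge> 1" "\<And>x. \<bar>g x\<bar> \<le> G"
  proof -
    obtain G where "\<And>x. \<bar>g x\<bar> \<le> G" using g by (auto simp: bdd_meas_def)
    then show ?thesis using that[of "max 1 G"] by (auto simp: le_max_iff_disj)
  qed
  let ?y = "ysol q s"
  have yc: "continuous_on UNIV ?y" by (rule ysol_cont(1)[OF q])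
  obtain Y where Y: "Y > 0" "\<And>x. \<bar>x\<bar> \<le> X \<Longrightarrow> norm (?y x) \<le> Y"
    using loc_bdd_meas_bound[OF loc_bdd_meas_cont[OF yc]] by blast
  \<comment> \<open>The bound \<open>1\<close> keeps the angle difference below \<open>pi\<close>;
    the other one makes replacing one unperturbed factor by the perturbed one cost at most half of
    \<open>I\<close>.\<close>
  define e where "e = min 1 (\<bar>I\<bar> / (2 * X * G * Y))"
  have e: "e > 0" "e \<le> 1" "X * G * Y * e \<le> \<bar>I\<bar> / 2" using I X G Y by (auto simp: e_def min_def field_simps)
  obtain d where d: "d > 0" "\<And>p x. bdd_meas p \<Longrightarrow> (\<And>x. \<bar>p x - q x\<bar> \<le> d) \<Longrightarrow> 0 \<le> x \<Longrightarrow> x \<le> X \<Longrightarrow>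
     \<bar>th p s x - th q s x\<bar> \<le> e \<and> \<bar>ysol p s x - ysol q s x\<bar> \<le> e \<and> \<bar>ysol1 p s x - ysol1 q s x\<bar> \<le> e"
    using ysol_continuous_dependence[OF q less_imp_le[OF X] e(1)] by blast
  have "I * (th (\<lambda>x. q x - t * g x) s X - th q s X) > 0" if t: "0 < t" "t < d / G" for t
  proof -
    define p where "p x = q x - t * g x" for x
    have pb: "bdd_meas p"
    proof -
      obtain Q where Q: "\<And>x. \<bar>q x\<bar> \<le> Q" using q by (auto simp: bdd_meas_def)
      have "\<bar>p x\<bar> \<le> Q + t * G" for x
      proof -
        have "\<bar>p x\<bar> \<le> \<bar>q x\<bar> + \<bar>t * g x\<bar>" unfolding p_def by (rule abs_triangle_ineq4)
        moreover have "\<bar>t * g x\<bar> \<le> t * G" using t G(2)[of x] by (simp add: abs_mult mult_left_mono)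
        ultimately show ?thesis using Q[of x] by linarith
      qed
      moreover have "p \<in> borel_measurable borel" using q g unfolding p_def[abs_def] by (auto simp: bdd_meas_def)
      ultimately show ?thesis by (auto simp: bdd_meas_def)
    qed
    have pq: "\<bar>p x - q x\<bar> \<le> d" for x
    proof -
      have "\<bar>p x - q x\<bar> = t * \<bar>g x\<bar>" using t by (simp add: p_def abs_mult)
      also have "\<dots> \<le> t * G" using t G by (intro mult_left_mono) auto
      also have "\<dots> \<le> d" using t G(1) by (simp add: field_simps)
      finally show ?thesis .
    qed
    let ?z = "ysol p s"
    define J where "J = integral {0..X} (\<lambda>x. g x * (?y x * ?z x))"
    have zc: "continuous_on UNIV ?z" by (rule ysol_cont(1)[OF pb])
    have Jm: "loc_bdd_meas (\<lambda>x. g x * (?y x * ?z x))"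
      by (intro loc_bdd_meas_mult bdd_meas_loc[OF g] loc_bdd_meas_cont yc zc)
    have J: "((\<lambda>x. g x * (?y x * ?z x)) has_integral J) {0..X}"
      unfolding J_def using loc_bdd_meas_integrable[OF Jm] by (simp add: has_integral_integral)
    have "norm (J - I) \<le> (G * Y * e) * measure lborel {0..X}"
    proof (rule has_integral_bound_real[OF _ finite.emptyI has_integral_diff[OF J I(1)]])
      fix x assume "x \<in> {0..X} - {}"
      then have x: "0 \<le> x" "x \<le> X" by auto
      have "g x * (?y x * ?z x) - g x * (?y x)\<^sup>2 = g x * ?y x * (?z x - ?y x)" by (simp add: algebra_simps power2_eq_square)
      also have "norm \<dots> \<le> G * Y * e" unfolding norm_mult
        using G Y(2)[of x] Y(1) d(2)[OF pb pq x] x by (intro mult_mono) auto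
      finally show "norm (g x * (?y x * ?z x) - g x * (?y x)\<^sup>2) \<le> G * Y * e" .
    qed (use G Y e in auto)
    then have "\<bar>J - I\<bar> \<le> \<bar>I\<bar> / 2" using e(3) X by (simp add: algebra_simps)
    from abs_le_D1[OF this] abs_le_D2[OF this] have "J - I \<le> \<bar>I\<bar> / 2" "I - J \<le> \<bar>I\<bar> / 2" by linarith+
    then have IJ: "I * J > 0" using I(2) by (cases "I > 0") (simp_all add: zero_less_mult_iff)
    have W: "((\<lambda>x. of_real (q x - p x) * (?y x * ?z x)) has_integral
        (ysol1 q s X * ?z X - ?y X * ysol1 p s X) - (ysol1 q s 0 * ?z 0 - ?y 0 * ysol1 p s 0)) {0..X}"
      by (rule primitiveD(1)[OF wronskian_primitive[OF ysol_sol[OF q] ysol_sol[OF pb]]]) (use X in simp)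
    have "((\<lambda>x. t * (g x * (?y x * ?z x))) has_integral t * J) {0..X}" by (rule has_integral_mult_right[OF J])
    then have "((\<lambda>x. of_real (q x - p x) * (?y x * ?z x)) has_integral t * J) {0..X}"
      by (rule has_integral_eq[rotated]) (simp add: p_def algebra_simps)
    from has_integral_unique[OF W this]
    have "exp (log_rad q s X + log_rad p s X) * sin (th p s X - th q s X) = t * J"
      unfolding wronskian_polar using q pb by (simp add: th)
    then have "sin (th p s X - th q s X) = exp (- (log_rad q s X + log_rad p s X)) * (t * J)"
      by (metis add.left_inverse exp_add exp_zero mult.assoc mult_1)
    then have Is: "I * sin (th p s X - th q s X) = exp (- (log_rad q s X + log_rad p s X)) * t * (I * J)"
      by simp
    have s: "I * sin (th p s X - th q s X) > 0" unfolding Is by (rule mult_pos_pos[OF _ IJ]) (use t in simp)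
    have "\<bar>th p s X - th q s X\<bar> \<le> 1" using d(2)[OF pb pq, of X] X e(2) by linarith
    then have b: "\<bar>th p s X - th q s X\<bar> < pi" using pi_gt3 by linarith
    have "I * (th p s X - th q s X) > 0"
    proof (cases "th p s X - th q s X" "0::real" rule: linorder_cases)
      case less
      then have "sin (th p s X - th q s X) < 0" using b sin_gt_zero[of "th q s X - th p s X"] sin_minus[of "th q s X - th p s X"] by simp
      then have "I < 0" using s by (auto simp: zero_less_mult_iff)
      then show ?thesis using less by (simp add: mult_neg_neg)
    next
      case equal then show ?thesis using s by simp
    next
      case greater
      then have "sin (th p s X - th q s X) > 0" using b sin_gt_zero by simp
      then have "I > 0" using s by (auto simp: zero_less_mult_iff)
      then show ?thesis using greater by simp
    qed
    then show ?thesis by (simp add: p_def[abs_def])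
  qed
  then show ?thesis using d(1) G(1) by (intro exI[of _ "d / G"]) auto
qed

text \<open>The gap ratio is \<open>2 (r - 1) / (r + 1)\<close> with
  \<open>r = \<beta> / \<alpha>\<close>, hence increasing in the quotient of the edges.\<close>

lemma gap_expr_less:
  fixes a b c d :: real
  assumes "a > 0" "b > 0" "c > 0" "d > 0" "b * c < a * d"
  shows "(b - a) / ((a + b) / 2) < (d - c) / ((c + d) / 2)"
proof -
  have "(b - a) * (c + d) < (d - c) * (a + b)" using assms(5) by (simp add: algebra_simps)
  then have h: "(b - a) / (a + b) < (d - c) / (c + d)" using assms by (simp add: divide_simps)
  have "2 * ((b - a) / (a + b)) < 2 * ((d - c) / (c + d))" by (rule mult_strict_left_mono[OF h]) simp
  moreover have "(y - x) / ((x + y) / 2) = 2 * ((y - x) / (x + y))" for x y :: real by simp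
  ultimately show ?thesis by (simp only:)
qed

context hill
begin

lemma ysol_sq_integral_pos: "integral {0..X} (\<lambda>x. (ysol (q l) t x)\<^sup>2) > 0"
proof -
  have c: "continuous_on {0..X} (\<lambda>x. (ysol (q l) t x)\<^sup>2)"
    by (intro continuous_intros ysol_cont q_bdd)
  have "integral {0..X} (\<lambda>x. (ysol (q l) t x)\<^sup>2) \<noteq> 0"
  proof
    assume "integral {0..X} (\<lambda>x. (ysol (q l) t x)\<^sup>2) = 0"
    then have "((\<lambda>x. (ysol (q l) t x)\<^sup>2) has_integral 0) {0..X}"
      using integrable_continuous_real[OF c] by (simp add: has_integral_integral)
    then have "(ysol (q l) t x)\<^sup>2 = 0" if "x \<in> {0..X}" for x
      using has_integral_0_cbox_imp_0[of 0 X "\<lambda>x. (ysol (q l) t x)\<^sup>2" x] c that X by simp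
    then have "sin (th (q l) t x) = 0" if "0 < x" "x < X" for x using that by (simp add: ysol_def)
    then show False using prufer_sin_not_zero_on[OF q_bdd th(1)[OF q_bdd] X] by blast
  qed
  moreover have "integral {0..X} (\<lambda>x. (ysol (q l) t x)\<^sup>2) \<ge> 0"
    by (intro integral_nonneg integrable_continuous_real c) auto
  ultimately show ?thesis by simp
qed

text \<open>The eigen-angle of the unperturbed edge serves as trial angle for the perturbed potential.\<close>

lemma edge_perturbation:
  assumes h: "bdd_meas h" and W: "\<And>t. 0 < t \<Longrightarrow> t \<le> 1 \<Longrightarrow> hill X Vp (\<lambda>x. V x + t * h x)"
    and I: "((\<lambda>x. (s - h x) * (ysol (q l) t0 x)\<^sup>2) has_integral I) {0..X}"
    and t0: "disp l t0 = real m * pi"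
  shows "I > 0 \<Longrightarrow> m \<ge> 1 \<Longrightarrow> \<exists>d>0. \<forall>t. 0 < t \<longrightarrow> t < d \<longrightarrow> hill.alpha X (\<lambda>x. V x + t * h x) m < l + t * s"
    and "I < 0 \<Longrightarrow> \<exists>d>0. \<forall>t. 0 < t \<longrightarrow> t < d \<longrightarrow> l + t * s < hill.beta X (\<lambda>x. V x + t * h x) m"
proof -
  have g: "bdd_meas (\<lambda>x. s - h x)"
  proof -
    obtain H where "\<And>x. \<bar>h x\<bar> \<le> H" using h by (auto simp: bdd_meas_def)
    then have "\<bar>s - h x\<bar> \<le> \<bar>s\<bar> + H" for x using abs_triangle_ineq4[of s "h x"] by (meson add_left_mono order_trans)
    then show ?thesis using h by (auto simp: bdd_meas_def)
  qed
  \<comment> \<open>Moving \<open>V\<close> by \<open>t * h\<close> and the spectral parameter by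
    \<open>t * s\<close> changes the coefficient by \<open>- t * (s - h x)\<close>, so the sign of
    \<open>I\<close> tells on which side of the edge \<open>l + t * s\<close> falls.\<close>
  have eq: "th (\<lambda>x. q l x - t * (s - h x)) t0 X - th (q l) t0 X
      = hill.disp X (\<lambda>x. V x + t * h x) (l + t * s) t0 - real m * pi" if "0 < t" "t \<le> 1" for t
  proof -
    interpret W: hill X Vp "\<lambda>x. V x + t * h x" by (rule W[OF that])
    have "W.q (l + t * s) = (\<lambda>x. q l x - t * (s - h x))" by (simp add: fun_eq_iff W.q_def q_def algebra_simps)
    then show ?thesis using t0 by (simp add: W.disp_def W.Th_def disp_def Th_def)
  qed
  {
    assume p: "I > 0" "m \<ge> 1"
    then obtain d where d: "d > 0" "\<And>t. 0 < t \<Longrightarrow> t < d \<Longrightarrow> I * (th (\<lambda>x. q l x - t * (s - h x)) t0 X - th (q l) t0 X) > 0"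
      using angle_perturbation[OF q_bdd g X I] by auto
    have "hill.alpha X (\<lambda>x. V x + t * h x) m < l + t * s" if t: "0 < t" "t < min 1 d" for t
    proof -
      interpret W: hill X Vp "\<lambda>x. V x + t * h x" using t by (intro W) auto
      have "I * (W.disp (l + t * s) t0 - real m * pi) > 0" using d(2)[of t] eq[of t] t by simp
      then show ?thesis using p W.alpha_lessI[of m "l + t * s" t0] by (simp add: zero_less_mult_iff)
    qed
    then show "\<exists>d>0. \<forall>t. 0 < t \<longrightarrow> t < d \<longrightarrow> hill.alpha X (\<lambda>x. V x + t * h x) m < l + t * s"
      using d(1) by (intro exI[of _ "min 1 d"]) auto
  }
  {
    assume p: "I < 0"
    then obtain d where d: "d > 0" "\<And>t. 0 < t \<Longrightarrow> t < d \<Longrightarrow> I * (th (\<lambda>x. q l x - t * (s - h x)) t0 X - th (q l) t0 X) > 0"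
      using angle_perturbation[OF q_bdd g X I] by auto
    have "l + t * s < hill.beta X (\<lambda>x. V x + t * h x) m" if t: "0 < t" "t < min 1 d" for t
    proof -
      interpret W: hill X Vp "\<lambda>x. V x + t * h x" using t by (intro W) auto
      have "I * (W.disp (l + t * s) t0 - real m * pi) > 0" using d(2)[of t] eq[of t] t by simp
      then show ?thesis using p W.beta_lessI[of "l + t * s" t0 m] by (simp add: zero_less_mult_iff)
    qed
    then show "\<exists>d>0. \<forall>t. 0 < t \<longrightarrow> t < d \<longrightarrow> l + t * s < hill.beta X (\<lambda>x. V x + t * h x) m"
      using d(1) by (intro exI[of _ "min 1 d"]) auto
  }
qed

text \<open>With first order edge speeds \<open>\<alpha>'\<close> and \<open>\<beta>'\<close>, the
  integral in \<open>A\<close> is \<open>\<alpha> \<beta>' - \<beta> \<alpha>'\<close>, the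
  numerator of the derivative of \<open>\<beta> / \<alpha>\<close>.\<close>

lemma gap_ratio_increases:
  assumes m: "m \<ge> 1" and gap: "alpha m < beta m"
    and h: "bdd_meas h" and W: "\<And>t. 0 < t \<Longrightarrow> t \<le> 1 \<Longrightarrow> hill X Vp (\<lambda>x. V x + t * h x)"
    and ta: "disp (alpha m) ta = real m * pi" and tb: "disp (beta m) tb = real m * pi"
    and Na: "Na = integral {0..X} (\<lambda>x. (ysol (q (alpha m)) ta x)\<^sup>2)"
    and Nb: "Nb = integral {0..X} (\<lambda>x. (ysol (q (beta m)) tb x)\<^sup>2)"
    and A: "integral {0..X} (\<lambda>x. h x * (alpha m / Nb * (ysol (q (beta m)) tb x)\<^sup>2 - beta m / Na * (ysol (q (alpha m)) ta x)\<^sup>2)) > 0"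
  shows "\<exists>d>0. \<forall>t. 0 < t \<longrightarrow> t < d \<longrightarrow> gap_ratio X m V < gap_ratio X m (\<lambda>x. V x + t * h x)"
proof -
  let ?a = "alpha m" and ?b = "beta m"
  let ?y = "ysol (q (alpha m)) ta" and ?z = "ysol (q (beta m)) tb"
  have ab: "?a > 0" "?b > 0" using alpha_pos[OF m] gap by auto
  have N: "Na > 0" "Nb > 0" unfolding Na Nb by (rule ysol_sq_integral_pos)+
  have c: "continuous_on UNIV ?y" "continuous_on UNIV ?z" by (simp_all add: ysol_cont)
  note lm = loc_bdd_meas_mult loc_bdd_meas_power loc_bdd_meas_cont c bdd_meas_loc[OF h]
  have int: "(\<lambda>x. (?y x)\<^sup>2) integrable_on {0..X}" "(\<lambda>x. (?z x)\<^sup>2) integrable_on {0..X}"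
    "(\<lambda>x. h x * (?y x)\<^sup>2) integrable_on {0..X}" "(\<lambda>x. h x * (?z x)\<^sup>2) integrable_on {0..X}"
    by (intro loc_bdd_meas_integrable lm)+
  define Ha where "Ha = integral {0..X} (\<lambda>x. h x * (?y x)\<^sup>2)"
  define Hb where "Hb = integral {0..X} (\<lambda>x. h x * (?z x)\<^sup>2)"
  have hi: "((\<lambda>x. (?y x)\<^sup>2) has_integral Na) {0..X}" "((\<lambda>x. (?z x)\<^sup>2) has_integral Nb) {0..X}"
    "((\<lambda>x. h x * (?y x)\<^sup>2) has_integral Ha) {0..X}" "((\<lambda>x. h x * (?z x)\<^sup>2) has_integral Hb) {0..X}"
    using int unfolding Na Nb Ha_def Hb_def by (simp_all add: has_integral_integral)
  have "((\<lambda>x. ?a / Nb * (h x * (?z x)\<^sup>2) - ?b / Na * (h x * (?y x)\<^sup>2)) has_integral (?a / Nb * Hb - ?b / Na * Ha)) {0..X}"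
    by (intro has_integral_diff has_integral_mult_right hi)
  then have "((\<lambda>x. h x * (?a / Nb * (?z x)\<^sup>2 - ?b / Na * (?y x)\<^sup>2)) has_integral (?a / Nb * Hb - ?b / Na * Ha)) {0..X}"
    by (rule has_integral_eq[rotated]) (simp add: algebra_simps)
  then have A': "?a / Nb * Hb - ?b / Na * Ha > 0" using A by (simp add: integral_unique)
  define P where "P = ?a / Nb * Hb - ?b / Na * Ha"
  have P: "P > 0" using A' by (simp only: P_def)
  \<comment> \<open>\<open>Ha / Na\<close> and \<open>Hb / Nb\<close> are the first order speeds of
    the edges. Giving up \<open>\<eta>\<close> in each makes the one-sided bounds applicable, and
    this choice spends exactly half of \<open>P\<close>.\<close>
  define \<eta> where "\<eta> = P / 2 / (?a + ?b)"
  have \<eta>: "\<eta> > 0" using P ab by (simp add: \<eta>_def)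
  define sa where "sa = Ha / Na + \<eta>"
  define sb where "sb = Hb / Nb - \<eta>"
  have slope: "?a * sb - ?b * sa > 0"
  proof -
    have "?a * sb - ?b * sa = P - \<eta> * (?a + ?b)" by (simp add: P_def sa_def sb_def algebra_simps)
    also have "\<eta> * (?a + ?b) = P / 2"
      by (rule nonzero_eq_divide_eq[THEN iffD1, OF _ \<eta>_def]) (use ab in simp)
    finally show ?thesis using P by simp
  qed
  have "((\<lambda>x. sa * (?y x)\<^sup>2 - h x * (?y x)\<^sup>2) has_integral sa * Na - Ha) {0..X}"
    by (intro has_integral_diff has_integral_mult_right hi)
  then have Ia: "((\<lambda>x. (sa - h x) * (?y x)\<^sup>2) has_integral sa * Na - Ha) {0..X}" by (simp add: left_diff_distrib)
  have "((\<lambda>x. sb * (?z x)\<^sup>2 - h x * (?z x)\<^sup>2) has_integral sb * Nb - Hb) {0..X}"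
    by (intro has_integral_diff has_integral_mult_right hi)
  then have Ib: "((\<lambda>x. (sb - h x) * (?z x)\<^sup>2) has_integral sb * Nb - Hb) {0..X}" by (simp add: left_diff_distrib)
  have pos: "sa * Na - Ha > 0" "sb * Nb - Hb < 0" using N \<eta> by (simp_all add: sa_def sb_def field_simps)
  obtain d1 where d1: "d1 > 0" "\<And>t. 0 < t \<Longrightarrow> t < d1 \<Longrightarrow> hill.alpha X (\<lambda>x. V x + t * h x) m < ?a + t * sa"
    using edge_perturbation(1)[OF h W Ia ta pos(1) m] by blast
  obtain d2 where d2: "d2 > 0" "\<And>t. 0 < t \<Longrightarrow> t < d2 \<Longrightarrow> ?b + t * sb < hill.beta X (\<lambda>x. V x + t * h x) m"
    using edge_perturbation(2)[OF h W Ib tb pos(2)] by blast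
  have "gap_ratio X m V < gap_ratio X m (\<lambda>x. V x + t * h x)" if t: "0 < t" "t < min 1 (min d1 d2)" for t
  proof -
    interpret W: hill X Vp "\<lambda>x. V x + t * h x" using t by (intro W) auto
    have a: "W.alpha m < ?a + t * sa" "?b + t * sb < W.beta m" using d1(2) d2(2) t by auto
    have p: "W.alpha m > 0" "W.beta m > 0" using W.alpha_pos[OF m] W.alpha_le_beta[OF m] by auto
    have "t * (?a * sb - ?b * sa) > 0" using t slope by simp
    moreover have "?b * W.alpha m < ?b * (?a + t * sa)" "?a * (?b + t * sb) < ?a * W.beta m"
      using a ab by (auto intro!: mult_strict_left_mono)
    ultimately have k: "?b * W.alpha m < ?a * W.beta m" by (simp add: algebra_simps)
    have "(?b - ?a) / ((?a + ?b) / 2) < (W.beta m - W.alpha m) / ((W.alpha m + W.beta m) / 2)"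
      by (rule gap_expr_less) (use ab p k in auto)
    then show ?thesis unfolding gap_ratio_eq[OF m] W.gap_ratio_eq[OF m] .
  qed
  then show ?thesis using d1(1) d2(1) by (intro exI[of _ "min 1 (min d1 d2)"]) auto
qed

lemma hill_admissible: "V \<in> admissible X Vp"
  using Vm Vper V0 V1 by (auto simp: admissible_def measurable_completion)

end

lemma AE_lebesgue_translate:
  fixes c :: real
  assumes "AE x in lebesgue. P x" shows "AE x in lebesgue. P (x + c)"
proof -
  obtain N where N: "negligible N" "{x. \<not> P x} \<subseteq> N" using assms by (auto simp: eventually_ae_filter_negligible)
  have "negligible ((+) (- c) ` N)" by (rule negligible_translation[OF N(1)])
  moreover have "{x. \<not> P (x + c)} \<subseteq> (+) (- c) ` N"
  proof
    fix x assume "x \<in> {x. \<not> P (x + c)}"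
    then have "x + c \<in> N" using N(2) by auto
    then show "x \<in> (+) (- c) ` N" by (intro image_eqI[of _ _ "x + c"]) auto
  qed
  ultimately show ?thesis by (auto simp: eventually_ae_filter_negligible)
qed

lemma admissible_hill_representative:
  assumes X: "X > 0" and Vp: "Vp > 0" and V: "V \<in> admissible X Vp"
  shows "\<exists>V'. hill X Vp V' \<and> (AE x in lebesgue. V x = V' x)"
proof -
  obtain g where g: "g \<in> borel_measurable lborel" "AE x in lborel. V x = g x"
    using completion_ex_borel_measurable_real[of V lborel] V by (auto simp: admissible_def)
  \<comment> \<open>The values of \<open>g\<close> on \<open>[0, X)\<close> are repeated
    periodically and clipped to \<open>[0, Vp]\<close>, so that periodicity and bounds hold at every
    point.\<close>
  define V' where "V' x = max 0 (min Vp (g (x + of_int (- \<lfloor>x / X\<rfloor>) * X)))" for x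
  have "hill X Vp V'"
  proof
    show "V' (x + X) = V' x" for x
    proof -
      have "(x + X) / X = x / X + 1" using X by (simp add: add_divide_distrib)
      then have "\<lfloor>(x + X) / X\<rfloor> = \<lfloor>x / X\<rfloor> + 1" by simp
      then show ?thesis by (simp add: V'_def algebra_simps)
    qed
    show "V' \<in> borel_measurable borel" using g(1) unfolding V'_def by measurable
  qed (use X Vp in \<open>auto simp: V'_def\<close>)
  moreover have "AE x in lebesgue. V x = V' x"
  proof -
    \<comment> \<open>There are countably many translates, so almost every point has all of them
      outside the exceptional sets.\<close>
    have 1: "AE x in lebesgue. \<forall>n::int. V (x + of_int n * X + X) = V (x + of_int n * X)"
      using AE_lebesgue_translate[of "\<lambda>x. V (x + X) = V x"] V by (intro AE_all_countable[THEN iffD2]) (auto simp: admissible_def)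
    have 2: "AE x in lebesgue. \<forall>n::int. V (x + of_int n * X) = g (x + of_int n * X)"
      using AE_lebesgue_translate[of "\<lambda>x. V x = g x"] AE_completion[OF g(2)] by (intro AE_all_countable[THEN iffD2]) auto
    have 3: "AE x in lebesgue. V x \<in> {0..Vp}" using V by (simp add: admissible_def)
    show ?thesis using 1 2 3
    proof eventually_elim
      case (elim x)
      have "V (x + of_int n * X) = V x" for n :: int
      proof (induction n rule: int_induct[where k=0])
        case (step1 i)
        have "x + of_int (i + 1) * X = x + of_int i * X + X" by (simp add: algebra_simps)
        then show ?case using elim(1) step1 by metis
      next
        case (step2 i)
        have "x + of_int i * X = x + of_int (i - 1) * X + X" by (simp add: algebra_simps)
        then show ?case using elim(1) step2 by metis
      qed simp
      then have "g (x + of_int (- \<lfloor>x / X\<rfloor>) * X) = V x" using elim(2) by metis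
      then show ?case using elim(3) by (simp add: V'_def)
    qed
  qed
  ultimately show ?thesis by blast
qed

section \<open>Sign changes of the first variation\<close>

text \<open>By \<open>edge_D\<close> the radius returns to \<open>1\<close>, so after a period the
  solution has its initial data back up to the sign \<open>(-1) ^ m\<close>.\<close>

lemma (in hill) edge_solution:
  assumes D4: "(D l)\<^sup>2 \<le> 4" and t: "disp l t = real m * pi"
  shows "th (q l) t (x + X) = th (q l) t x + real m * pi"
    and "ysol (q l) t (x + X) = (-1) ^ m * ysol (q l) t x"
proof -
  have T: "th (q l) t X = t + real m * pi" using t by (simp add: disp_def Th_def)
  have "th (q l) t (x + X) = th (q l) (th (q l) t (0 + X)) x"
    by (rule th_eq[OF q_bdd prufer_shift[OF th(1)[OF q_bdd] q_per]])
  also have "\<dots> = th (q l) t x + real m * pi"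
    using th_add_pi_int[OF q_bdd, of l t "int m" x] T by simp
  finally show "th (q l) t (x + X) = th (q l) t x + real m * pi" .
  have R: "R l t = 1" by (rule edge_D(2)[OF D4 t])
  have y: "ysol (q l) t (0 + X) = (-1) ^ m * sin t" "ysol1 (q l) t (0 + X) = (-1) ^ m * cos t"
    using R unfolding R_def ysol_def ysol1_def by (simp_all add: T sin_add_nat_pi cos_add_nat_pi)
  have "ysol (q l) t (x + X) = (-1) ^ m * (sin t * ysol (q l) (pi/2) x + cos t * ysol (q l) 0 x)"
    using sol_repr(1)[OF q_bdd sol_shift[OF ysol_sol[OF q_bdd] q_per], of l t x] unfolding y by (simp add: algebra_simps)
  then show "ysol (q l) t (x + X) = (-1) ^ m * ysol (q l) t x" by (simp add: ysol_repr(1)[OF q_bdd, of l t x])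
qed

text \<open>Equality of the angles modulo \<open>\<pi>\<close> at one point would make the difference grow strictly over one period.\<close>

lemma (in hill) edge_angles_separated:
  assumes l: "l < l'" and D4: "(D l)\<^sup>2 \<le> 4" "(D l')\<^sup>2 \<le> 4"
    and t: "disp l t = real m * pi" "disp l' t' = real m * pi"
  shows "\<exists>s. disp l' s = real m * pi \<and> (\<forall>x. 0 < th (q l') s x - th (q l) t x \<and> th (q l') s x - th (q l) t x < pi)"
proof -
  \<comment> \<open>Brings \<open>t'\<close> into \<open>[t, t + pi)\<close> by a multiple of
    \<open>pi\<close>, which leaves the displacement unchanged.\<close>
  define k where "k = \<lfloor>(t' - t) / pi\<rfloor>"
  define s where "s = t' + of_int (-k) * pi"
  have s: "disp l' s = real m * pi" unfolding s_def disp_add_pi by (rule t(2))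
  have "of_int k \<le> (t' - t) / pi" "(t' - t) / pi < of_int k + 1" unfolding k_def by linarith+
  then have b: "0 \<le> s - t" "s - t < pi" by (simp_all add: s_def field_simps)
  define d where "d x = th (q l') s x - th (q l) t x" for x
  have dper: "d (x + X) = d x" for x
    unfolding d_def edge_solution(1)[OF D4(1) t(1)] edge_solution(1)[OF D4(2) s] by simp
  have dc: "continuous_on A d" for A
    unfolding d_def by (intro continuous_intros primitive_continuous[OF th_loc] q_bdd)
  have ne: "d x \<noteq> of_int j * pi" for x j
  proof
    assume e: "d x = of_int j * pi"
    have "th (q l) t (x + X) + of_int j * pi < th (q l') s (x + X)"
    proof (rule prufer_strict[OF q_bdd q_bdd prufer_add_pi_int[OF th(1)[OF q_bdd]] th(1)[OF q_bdd], where \<eta>="l' - l" and s=x])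
      show "th (q l) t x + of_int j * pi \<le> th (q l') s x" using e by (simp add: d_def)
    qed (use l X in \<open>auto simp: q_def\<close>)
    then show False using dper[of x] e by (simp add: d_def)
  qed
  have d0: "0 < d 0" "d 0 < pi" using b ne[of 0 0] by (simp_all add: d_def th less_le)
  have "0 < d x \<and> d x < pi" for x
  proof (rule ccontr)
    assume "\<not> ?thesis"
    then consider "d x \<le> 0" | "d x \<ge> pi" by linarith
    then show False
    proof cases
      case 1
      have "\<exists>y. d y = 0"
        using IVT2'[of d x 0 0] IVT'[of d x 0 0] 1 d0 dc by (cases "x \<le> 0") auto
      then show False using ne[of _ 0] by auto
    next
      case 2
      have "\<exists>y. d y = pi"
        using IVT'[of d 0 pi x] IVT2'[of d 0 pi x] 2 d0 dc by (cases "x \<le> 0") auto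
      then show False using ne[of _ 1] by auto
    qed
  qed
  then show ?thesis using s by (auto simp: d_def)
qed

text \<open>What the sign analysis uses of the two edges: angles that stay apart modulo
  \<open>pi\<close>, and periodic squares. The weights \<open>A\<close> and \<open>B\<close> absorb
  the edge values and the normalisation of the eigenfunctions.\<close>

locale angle_pair =
  fixes X :: real and m :: nat and qa qb :: "real \<Rightarrow> real" and ta tb A B :: real
  assumes X: "X > 0" and m: "m \<ge> 1" and qa: "bdd_meas qa" and qb: "bdd_meas qb"
    and tha_per: "\<And>x. th qa ta (x + X) = th qa ta x + real m * pi"
    and sep: "\<And>x. 0 < th qb tb x - th qa ta x" "\<And>x. th qb tb x - th qa ta x < pi"
    and A: "A > 0" and B: "B > 0"
    and sq_per: "\<And>x. (ysol qa ta (x + X))\<^sup>2 = (ysol qa ta x)\<^sup>2" "\<And>x. (ysol qb tb (x + X))\<^sup>2 = (ysol qb tb x)\<^sup>2"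
begin

definition f :: "real \<Rightarrow> real" where "f x = A * (ysol qb tb x)\<^sup>2 - B * (ysol qa ta x)\<^sup>2"

lemma f_per: "f (x + X) = f x" by (simp add: f_def sq_per)

lemma f_cont: "continuous_on S f"
  unfolding f_def[abs_def] by (intro continuous_intros ysol_cont qa qb)

lemma tha_cont: "continuous_on S (th qa ta)"
  by (rule primitive_continuous[OF th_loc[OF qa]])

lemma tha_per_nat: "th qa ta (x + real n * X) = th qa ta x + real n * (real m * pi)"
proof (induction n)
  case (Suc n)
  have "th qa ta (x + real (Suc n) * X) = th qa ta ((x + real n * X) + X)" by (simp add: algebra_simps)
  then show ?case using Suc unfolding tha_per by (simp add: algebra_simps)
qed simp

lemma node_ex: "\<exists>z. th qa ta z = real j * pi"
proof -
  obtain N :: nat where N: "real N > (\<bar>th qa ta 0\<bar> + real j * pi) / pi" using reals_Archimedean2 by blast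
  then have "\<bar>th qa ta 0\<bar> + real j * pi < real N * pi" by (simp add: field_simps)
  also have "\<dots> \<le> real N * (real m * pi)" using m by (intro mult_left_mono) auto
  finally have N: "\<bar>th qa ta 0\<bar> + real j * pi < real N * (real m * pi)" .
  have r: "th qa ta (real N * X) = th qa ta 0 + real N * (real m * pi)" using tha_per_nat[of 0 N] by simp
  have l: "th qa ta 0 = th qa ta (- real N * X) + real N * (real m * pi)" using tha_per_nat[of "- real N * X" N] by simp
  have "0 \<le> real j * pi" by simp
  then have b: "th qa ta (- real N * X) \<le> real j * pi" "real j * pi \<le> th qa ta (real N * X)"
    using r l N abs_ge_self[of "th qa ta 0"] abs_ge_minus_self[of "th qa ta 0"] by linarith+
  have "- real N * X \<le> real N * X" using X by simp
  then show ?thesis using IVT'[OF b _ tha_cont] by blast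
qed

lemma cross_node: "th qa ta z = real j * pi \<Longrightarrow> z < x \<Longrightarrow> th qa ta x > real j * pi"
  using prufer_cross[OF qa th(1)[OF qa], of ta z "int j" x] by simp

lemma node_unique: "th qa ta z = real j * pi \<Longrightarrow> th qa ta z' = real j * pi \<Longrightarrow> z = z'"
  using cross_node[of z j z'] cross_node[of z' j z] by (cases z z' rule: linorder_cases) auto

text \<open>Zeros of the lower edge solution, labelled by the multiple of \<open>pi\<close> that its
  angle crosses there; it does so only once, since it crosses upwards.\<close>

definition node :: "nat \<Rightarrow> real" where "node j = (THE z. th qa ta z = real j * pi)"

lemma node: "th qa ta (node j) = real j * pi"
  unfolding node_def using node_ex node_unique by (rule_tac theI') blast

lemma node_eqI: "th qa ta z = real j * pi \<Longrightarrow> node j = z"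
  using node node_unique by blast

lemma node_less: "node j < node (Suc j)"
proof (rule ccontr)
  assume "\<not> ?thesis"
  then have "node (Suc j) < node j \<or> node (Suc j) = node j" by linarith
  then have "th qa ta (node j) \<ge> real (Suc j) * pi" using cross_node[OF node, of "Suc j" "node j"] node[of "Suc j"] by fastforce
  then show False unfolding node by simp
qed

lemma node_add_period: "node (j + m) = node j + X"
  by (rule node_eqI) (simp add: tha_per node distrib_right)

lemma cell_angle:
  assumes "node j < x" "x < node (Suc j)"
  shows "real j * pi < th qa ta x \<and> th qa ta x < real (Suc j) * pi"
proof
  show "real j * pi < th qa ta x" by (rule cross_node[OF node assms(1)])
  show "th qa ta x < real (Suc j) * pi"
  proof (rule ccontr)
    assume "\<not> ?thesis"
    then obtain y where y: "node j \<le> y" "y \<le> x" "th qa ta y = real (Suc j) * pi"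
      using IVT'[of "th qa ta" "node j" "real (Suc j) * pi" x] node[of j] assms(1) tha_cont by (auto simp: algebra_simps)
    then show False using node_eqI[OF y(3)] assms(2) by simp
  qed
qed

text \<open>The derivative of the quotient is a Wronskian over a square, and the separation of the
  angles fixes its sign through \<open>wronskian_polar\<close>.\<close>

lemma ratio_decreasing:
  assumes "x < y" "\<And>u. x \<le> u \<Longrightarrow> u \<le> y \<Longrightarrow> ysol qa ta u \<noteq> 0"
  shows "ysol qb tb y / ysol qa ta y < ysol qb tb x / ysol qa ta x"
proof (rule DERIV_neg_imp_decreasing[OF assms(1)])
  fix u assume u: "x \<le> u" "u \<le> y"
  have "(ysol qa ta has_real_derivative ysol1 qa ta u) (at u)" "(ysol qb tb has_real_derivative ysol1 qb tb u) (at u)"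
    using ysol_sol[OF qa, of ta] ysol_sol[OF qb, of tb] ysol_cont(2)[OF qa] ysol_cont(2)[OF qb]
    by (auto simp: sol_def intro!: primitive_real_derivative)
  then have "((\<lambda>u. ysol qb tb u / ysol qa ta u) has_real_derivative
      ((ysol1 qb tb u * ysol qa ta u - ysol qb tb u * ysol1 qa ta u) / (ysol qa ta u * ysol qa ta u))) (at u)"
    using assms(2)[OF u] by (intro DERIV_divide)
  moreover have "ysol1 qb tb u * ysol qa ta u - ysol qb tb u * ysol1 qa ta u < 0"
  proof -
    have "sin (th qb tb u - th qa ta u) > 0" using sep by (intro sin_gt_zero)
    then have "sin (th qa ta u - th qb tb u) < 0" using sin_minus[of "th qb tb u - th qa ta u"] by simp
    then show ?thesis unfolding wronskian_polar by (simp add: mult_pos_neg)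
  qed
  moreover have "ysol qa ta u * ysol qa ta u > 0" using assms(2)[OF u] by (auto simp: zero_less_mult_iff)
  ultimately show "\<exists>y. ((\<lambda>u. ysol qb tb u / ysol qa ta u) has_real_derivative y) (at u) \<and> y < 0"
    by (intro exI conjI) (auto simp: divide_neg_pos)
qed

lemma ysol_sign: "s * sin (th p t x) > 0 \<Longrightarrow> s * ysol p t x > 0" for s
  unfolding ysol_def using mult_pos_pos[of "exp (log_rad p t x)" "s * sin (th p t x)"] by (simp add: mult.left_commute)

text \<open>The factor \<open>(-1) ^ j\<close> makes \<open>p\<close> positive inside the cell,
  where \<open>r = w / p\<close> strictly decreases and \<open>f\<close> has the sign of
  \<open>r^2 - B / A\<close>. Opposite signs of \<open>w\<close> at the nodes make \<open>r\<close>
  pass through \<open>b / a\<close> and then \<open>- b / a\<close>, once each.\<close>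

lemma cell:
  "\<exists>u v. node j < u \<and> u < v \<and> v < node (Suc j) \<and> f u = 0 \<and> f v = 0 \<and>
     (\<forall>x. node j \<le> x \<and> x < u \<longrightarrow> f x > 0) \<and> (\<forall>x. u < x \<and> x < v \<longrightarrow> f x < 0) \<and>
     (\<forall>x. v < x \<and> x \<le> node (Suc j) \<longrightarrow> f x > 0)"
proof -
  define s :: real where "s = (-1) ^ j"
  define p where "p x = s * ysol qa ta x" for x
  define w where "w x = s * ysol qb tb x" for x
  define a b where "a = sqrt A" and "b = sqrt B"
  have ab: "a > 0" "b > 0" using A B by (simp_all add: a_def b_def)
  have s2: "s * s = 1" by (simp add: s_def flip: power_mult_distrib)
  have f: "f x = (a * w x - b * p x) * (a * w x + b * p x)" for x
  proof -
    have "(a * w x - b * p x) * (a * w x + b * p x) = (s * s) * (a\<^sup>2 * (ysol qb tb x)\<^sup>2 - b\<^sup>2 * (ysol qa ta x)\<^sup>2)"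
      by (simp add: w_def p_def algebra_simps power2_eq_square)
    then show ?thesis using A B by (simp add: s2 f_def a_def b_def)
  qed
  have p_pos: "p x > 0" if "node j < x" "x < node (Suc j)" for x
    using sin_band_pos[of j "th qa ta x"] cell_angle[OF that] unfolding p_def s_def by (intro ysol_sign) auto
  have p0: "p (node j) = 0" "p (node (Suc j)) = 0"
    using node[of j] node[of "Suc j"] sin_add_nat_pi[of 0 j] sin_add_nat_pi[of 0 "Suc j"] by (simp_all add: p_def ysol_def)
  have w1: "w (node j) > 0" unfolding w_def s_def
    using sep[of "node j"] node[of j] by (intro ysol_sign sin_band_pos) (auto simp: algebra_simps)
  have "(-1) ^ Suc j * ysol qb tb (node (Suc j)) > 0"
    using sep[of "node (Suc j)"] node[of "Suc j"] by (intro ysol_sign sin_band_pos) (auto simp: algebra_simps)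
  then have w2: "w (node (Suc j)) < 0" by (simp add: w_def s_def)
  have c: "continuous_on S w" "continuous_on S p" for S unfolding w_def p_def by (intro continuous_intros ysol_cont qa qb)+
  have c': "continuous_on S (\<lambda>x. a * w x - b * p x)" "continuous_on S (\<lambda>x. a * w x + b * p x)" for S
    by (intro continuous_intros c)+
  \<comment> \<open>The zeros come from the two linear factors of \<open>f\<close>, which, unlike
    the quotient, are continuous up to the nodes.\<close>
  obtain u where u: "node j \<le> u" "u \<le> node (Suc j)" "a * w u - b * p u = 0"
    using IVT2'[of "\<lambda>x. a * w x - b * p x" "node (Suc j)" 0 "node j"] w1 w2 p0 ab node_less[of j] c'
    by (auto simp: mult_pos_neg less_imp_le)
  obtain v where v: "node j \<le> v" "v \<le> node (Suc j)" "a * w v + b * p v = 0"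
    using IVT2'[of "\<lambda>x. a * w x + b * p x" "node (Suc j)" 0 "node j"] w1 w2 p0 ab node_less[of j] c'
    by (auto simp: mult_pos_neg less_imp_le)
  have u': "node j < u" "u < node (Suc j)" using u p0 w1 w2 ab by (auto simp: less_le)
  have v': "node j < v" "v < node (Suc j)" using v p0 w1 w2 ab by (auto simp: less_le)
  define r where "r x = w x / p x" for x
  have r_eq: "r x = ysol qb tb x / ysol qa ta x" for x using s2 by (auto simp: r_def w_def p_def)
  have dec: "r y < r x" if "node j < x" "x < y" "y < node (Suc j)" for x y
    unfolding r_eq
  proof (rule ratio_decreasing[OF that(2)])
    fix t assume "x \<le> t" "t \<le> y"
    then have "p t > 0" using that by (intro p_pos) auto
    then show "ysol qa ta t \<noteq> 0" by (auto simp: p_def)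
  qed
  have wr: "w x = r x * p x" if "node j < x" "x < node (Suc j)" for x
    using p_pos[OF that] by (simp add: r_def)
  have ru: "a * r u = b" using u(3) wr[OF u'] p_pos[OF u'] by (simp add: algebra_simps)
  have "(a * r v + b) * p v = 0" using v(3) wr[OF v'] by (simp add: algebra_simps)
  then have rv: "a * r v = - b" using p_pos[OF v'] by simp
  have uv: "u < v"
  proof (rule ccontr)
    assume "\<not> u < v"
    then have "r u \<le> r v" using dec[of v u] u' v' by (cases "u = v") auto
    then have "a * r u \<le> a * r v" using ab by simp
    then show False using ru rv ab by simp
  qed
  have fx: "f x = (p x)\<^sup>2 * ((a * r x - b) * (a * r x + b))" if "node j < x" "x < node (Suc j)" for x
    unfolding f wr[OF that] by (simp add: algebra_simps power2_eq_square)
  have "f x > 0" if "node j < x" "x < u" for x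
  proof -
    have "a * r x > b" using dec[of x u] that u' ab(1) ru by (metis mult_strict_left_mono)
    then have "(a * r x - b) * (a * r x + b) > 0" using ab by (intro mult_pos_pos) auto
    then show ?thesis using fx[of x] p_pos[of x] that u' by simp
  qed
  moreover have "f x > 0" if "v < x" "x < node (Suc j)" for x
  proof -
    have "a * r x < - b" using dec[of v x] that v' ab(1) rv by (metis mult_strict_left_mono)
    then have "(a * r x - b) * (a * r x + b) > 0" using ab by (intro mult_neg_neg) auto
    then show ?thesis using fx[of x] p_pos[of x] that v' by simp
  qed
  moreover have "f x < 0" if "u < x" "x < v" for x
  proof -
    have "a * r x < b" "a * r x > - b" using dec[of u x] dec[of x v] that u' v' ab(1) ru rv by (metis mult_strict_left_mono less_trans)+
    then have "(a * r x - b) * (a * r x + b) < 0" by (intro mult_neg_pos) auto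
    moreover have "p x > 0" using that u' v' by (intro p_pos) auto
    ultimately show ?thesis using fx[of x] that u' v' by (simp add: mult_pos_neg)
  qed
  moreover have "f (node j) > 0" "f (node (Suc j)) > 0"
    unfolding f p0 using w1 w2 ab by (simp_all add: zero_less_mult_iff mult_pos_neg)
  moreover have "f u = 0" "f v = 0" unfolding f using u(3) v(3) by simp_all
  ultimately show ?thesis using u' v' uv by (intro exI[of _ u] exI[of _ v]) (auto simp: le_less)
qed

lemma alternating_sequence:
  obtains a :: "nat \<Rightarrow> real" where "\<And>j. j < 2 * m \<Longrightarrow> a j < a (Suc j)" "a (2 * m) = a 0 + X"
    "\<And>j x. a (2 * j) < x \<Longrightarrow> x < a (2 * j + 1) \<Longrightarrow> f x > 0"
    "\<And>j x. a (2 * j + 1) < x \<Longrightarrow> x < a (2 * j + 2) \<Longrightarrow> f x < 0"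
    "\<And>j. f (a j) = 0"
proof -
  obtain u v where uv: "\<And>j. node j < u j \<and> u j < v j \<and> v j < node (Suc j) \<and> f (u j) = 0 \<and> f (v j) = 0 \<and>
     (\<forall>x. node j \<le> x \<and> x < u j \<longrightarrow> f x > 0) \<and> (\<forall>x. u j < x \<and> x < v j \<longrightarrow> f x < 0) \<and>
     (\<forall>x. v j < x \<and> x \<le> node (Suc j) \<longrightarrow> f x > 0)" using cell by metis
  \<comment> \<open>Starting at \<open>v 0\<close> puts a positive interval first: the positive
    parts of neighbouring cells join across the node between them.\<close>
  define a where "a i = (if even i then v (i div 2) else u (Suc (i div 2)))" for i
  have ev: "a (2 * j) = v j" and od: "a (2 * j + 1) = u (Suc j)" "a (Suc (2 * j)) = u (Suc j)" for j by (simp_all add: a_def)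
  have "v m = v 0 + X"
  proof -
    have n: "node m = node 0 + X" "node (Suc m) = node (Suc 0) + X"
      using node_add_period[of 0] node_add_period[of "Suc 0"] by simp_all
    have b: "node m < v 0 + X" "v 0 + X < node (Suc m)" using uv[of 0] n by auto
    have z: "f (v 0 + X) = 0" using uv[of 0] f_per by simp
    have um: "\<forall>x. node m \<le> x \<and> x < u m \<longrightarrow> f x > 0" "\<forall>x. u m < x \<and> x < v m \<longrightarrow> f x < 0"
      "\<forall>x. v m < x \<and> x \<le> node (Suc m) \<longrightarrow> f x > 0" using uv[of m] by blast+
    \<comment> \<open>\<open>v 0 + X\<close> is a zero of \<open>f\<close> in cell \<open>m\<close>,
      hence one of its two zeros; the sign of \<open>f\<close> to its right decides which.\<close>
    have "v 0 + X = u m \<or> v 0 + X = v m"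
    proof (rule ccontr)
      assume "\<not> ?thesis"
      then consider "v 0 + X < u m" | "u m < v 0 + X" "v 0 + X < v m" | "v m < v 0 + X" by linarith
      then show False
        using um(1)[rule_format, of "v 0 + X"] um(2)[rule_format, of "v 0 + X"] um(3)[rule_format, of "v 0 + X"] z b
        by cases simp_all
    qed
    moreover have "v 0 + X \<noteq> u m"
    proof
      assume e: "v 0 + X = u m"
      define x where "x = (u m + v m) / 2"
      have x: "u m < x" "x < v m" using uv[of m] by (auto simp: x_def)
      then have "f x < 0" using uv[of m] by blast
      moreover have "v 0 < x - X" "x - X \<le> node (Suc 0)" using x e n uv[of m] by auto
      then have "f (x - X) > 0" using uv[of 0] by blast
      ultimately show False using f_per[of "x - X"] by simp
    qed
    ultimately show ?thesis by simp
  qed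
  then have fin: "a (2 * m) = a 0 + X" using ev[of m] ev[of 0] by simp
  have inc: "a j < a (Suc j)" for j
  proof (cases "even j")
    case True
    then obtain i where "j = 2 * i" by blast
    then show ?thesis using ev[of i] od[of i] uv[of i] uv[of "Suc i"] by simp
  next
    case False
    then obtain i where j: "j = Suc (2 * i)" by (metis oddE Suc_eq_plus1)
    then have "Suc j = 2 * Suc i" by simp
    then show ?thesis using ev[of "Suc i"] od[of i] uv[of "Suc i"] j by simp
  qed
  have pos: "f x > 0" if "a (2 * j) < x" "x < a (2 * j + 1)" for j x
    using that uv[of j] uv[of "Suc j"] unfolding ev od by (cases "x \<le> node (Suc j)") auto
  have neg: "f x < 0" if "a (2 * j + 1) < x" "x < a (2 * j + 2)" for j x
  proof -
    have "a (2 * j + 2) = v (Suc j)" using ev[of "Suc j"] by simp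
    then show ?thesis using that uv[of "Suc j"] unfolding od by auto
  qed
  have "f (a j) = 0" for j using uv by (auto simp: a_def)
  then show ?thesis using that inc fin pos neg by blast
qed

end

section \<open>The step function given by the sign of a periodic function\<close>

locale sign_cycle =
  fixes X Vp :: real and m :: nat and f :: "real \<Rightarrow> real" and a :: "nat \<Rightarrow> real"
  assumes X: "X > 0" and Vp: "Vp > 0" and m: "m \<ge> 1" and fc: "continuous_on UNIV f" and per: "\<And>x. f (x + X) = f x"
    and inc: "\<And>j. j < 2 * m \<Longrightarrow> a j < a (Suc j)" and fin: "a (2 * m) = a 0 + X"
    and pos: "\<And>j x. a (2 * j) < x \<Longrightarrow> x < a (2 * j + 1) \<Longrightarrow> f x > 0"
    and neg: "\<And>j x. a (2 * j + 1) < x \<Longrightarrow> x < a (2 * j + 2) \<Longrightarrow> f x < 0"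
    and zero: "\<And>j. f (a j) = 0"
begin

text \<open>The value at the zeros of \<open>f\<close> is an arbitrary choice on a countable
  set.\<close>

definition S :: "real \<Rightarrow> real" where "S x = (if f x > 0 then Vp else 0)"

lemmas per_int = periodic_int[of f, OF per]

lemma a_less: "i < k \<Longrightarrow> k \<le> 2 * m \<Longrightarrow> a i < a k"
proof (induction k)
  case (Suc k)
  then show ?case using inc[of k] by (cases "i = k") auto
qed simp

lemma sign_even: "even i \<Longrightarrow> a i < x \<Longrightarrow> x < a (Suc i) \<Longrightarrow> f x > 0"
  using pos[of "i div 2" x] by auto

lemma sign_odd: "odd i \<Longrightarrow> a i < x \<Longrightarrow> x < a (Suc i) \<Longrightarrow> f x < 0"
  using neg[of "i div 2" x] by (auto elim!: oddE)

lemma cell_ex: "a 0 \<le> x \<Longrightarrow> x < a n \<Longrightarrow> \<exists>i<n. a i \<le> x \<and> x < a (Suc i)"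
proof (induction n)
  case (Suc n)
  then show ?case by (cases "x < a n") (auto intro: less_SucI)
qed simp

lemma zeros_base: "{x \<in> {a 0..<a 0 + X}. f x = 0} = a ` {..<2 * m}"
proof
  show "{x \<in> {a 0..<a 0 + X}. f x = 0} \<subseteq> a ` {..<2 * m}"
  proof
    fix x assume x: "x \<in> {x \<in> {a 0..<a 0 + X}. f x = 0}"
    then obtain i where i: "i < 2 * m" "a i \<le> x" "x < a (Suc i)" using cell_ex[of x "2 * m"] fin by auto
    have "x = a i"
    proof (rule ccontr)
      assume "x \<noteq> a i"
      then have "a i < x" using i by simp
      then show False using sign_even[of i x] sign_odd[of i x] i(3) x by (cases "even i") auto
    qed
    then show "x \<in> a ` {..<2 * m}" using i by auto
  qed
  show "a ` {..<2 * m} \<subseteq> {x \<in> {a 0..<a 0 + X}. f x = 0}"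
  proof
    fix x assume "x \<in> a ` {..<2 * m}"
    then obtain i where i: "i < 2 * m" "x = a i" by auto
    have "a i < a (2 * m)" using a_less[of i "2 * m"] i by simp
    moreover have "a 0 \<le> a i" using a_less[of 0 i] i by (cases "i = 0") auto
    ultimately show "x \<in> {x \<in> {a 0..<a 0 + X}. f x = 0}" using i zero fin by simp
  qed
qed

text \<open>Representative of \<open>x\<close> modulo \<open>X\<close> in the period starting at
  \<open>c\<close>.\<close>

definition shift_to :: "real \<Rightarrow> real \<Rightarrow> real" where "shift_to c x = x + of_int (- \<lfloor>(x - c) / X\<rfloor>) * X"

lemma shift_to: "shift_to c x \<in> {c..<c + X}" "f (shift_to c x) = f x"
proof -
  have "of_int \<lfloor>(x - c) / X\<rfloor> * X \<le> x - c" using of_int_floor_le[of "(x - c) / X"] by (simp only: pos_le_divide_eq[OF X])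
  moreover have "x - c < (of_int \<lfloor>(x - c) / X\<rfloor> + 1) * X"
    using real_of_int_floor_add_one_gt[of "(x - c) / X"] by (simp only: pos_divide_less_eq[OF X])
  ultimately show "shift_to c x \<in> {c..<c + X}" by (simp add: shift_to_def algebra_simps)
  show "f (shift_to c x) = f x" unfolding shift_to_def by (rule per_int)
qed

lemma shift_to_inverse: assumes "x \<in> {c..<c + X}" shows "shift_to c (shift_to d x) = x"
proof -
  have e: "(y + of_int n * X) / X = y / X + of_int n" for y n using X by (simp add: field_simps)
  have "0 \<le> (x - c) / X" "(x - c) / X < 1" using assms X by (simp_all add: field_simps)
  then have "\<lfloor>(x - c) / X\<rfloor> = 0" by linarith
  moreover have "(shift_to d x - c) / X = (x - c) / X + of_int (- \<lfloor>(x - d) / X\<rfloor>)"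
    using e[of "x - c" "- \<lfloor>(x - d) / X\<rfloor>"] by (simp add: shift_to_def algebra_simps)
  ultimately have "\<lfloor>(shift_to d x - c) / X\<rfloor> = - \<lfloor>(x - d) / X\<rfloor>" by (simp only: floor_add_int[symmetric] add_0)
  then show ?thesis unfolding shift_to_def[of c] by (simp add: shift_to_def)
qed

text \<open>The zeros are known in the period cut at \<open>a 0\<close>, but are to be counted in
  \<open>[0, X)\<close>; reduction modulo \<open>X\<close> is a bijection between the two
  cuts.\<close>

lemma zeros_card: "card {x \<in> {0..<X}. f x = 0} = 2 * m" "finite {x \<in> {0..<X}. f x = 0}"
proof -
  have bij: "bij_betw (shift_to 0) {x \<in> {a 0..<a 0 + X}. f x = 0} {x \<in> {0..<X}. f x = 0}"
    by (rule bij_betw_byWitness[where f'="shift_to (a 0)"])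
       (use shift_to[of 0] shift_to[of "a 0"] shift_to_inverse[of _ 0] shift_to_inverse[of _ "a 0"] in auto)
  have "inj_on a {..<2 * m}"
  proof (rule inj_onI)
    fix i j assume "i \<in> {..<2 * m}" "j \<in> {..<2 * m}" "a i = a j"
    then show "i = j" using a_less[of i j] a_less[of j i] by (cases i j rule: linorder_cases) auto
  qed
  then have c: "card {x \<in> {a 0..<a 0 + X}. f x = 0} = 2 * m" unfolding zeros_base by (simp add: card_image)
  show "card {x \<in> {0..<X}. f x = 0} = 2 * m" using bij_betw_same_card[OF bij] c by simp
  show "finite {x \<in> {0..<X}. f x = 0}" using bij_betw_finite[OF bij] zeros_base by simp
qed

lemma zeros_countable: "countable {x. f x = 0}"
proof -
  have "{x. f x = 0} \<subseteq> (\<Union>n::int. (\<lambda>y. y + of_int n * X) ` {x \<in> {0..<X}. f x = 0})"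
  proof
    fix x assume "x \<in> {x. f x = 0}"
    then have "shift_to 0 x \<in> {x \<in> {0..<X}. f x = 0}" using shift_to[of 0 x] by simp
    moreover have "x = shift_to 0 x + of_int \<lfloor>(x - 0) / X\<rfloor> * X" by (simp add: shift_to_def)
    ultimately show "x \<in> (\<Union>n::int. (\<lambda>y. y + of_int n * X) ` {x \<in> {0..<X}. f x = 0})"
      by (intro UN_I[of "\<lfloor>(x - 0) / X\<rfloor>"] image_eqI[of _ _ "shift_to 0 x"]) auto
  qed
  moreover have "countable (\<Union>n::int. (\<lambda>y. y + of_int n * X) ` {x \<in> {0..<X}. f x = 0})"
    by (rule countable_UN) (simp, rule countable_image[OF countable_finite[OF zeros_card(2)]])
  ultimately show ?thesis by (rule countable_subset)
qed

lemma S_locally_const: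
  assumes "f x \<noteq> 0" obtains e where "e > 0" "\<And>y. \<bar>y - x\<bar> < e \<Longrightarrow> S y = S x"
proof -
  have "isCont f x" using fc by (simp add: continuous_on_eq_continuous_at)
  then obtain e where e: "e > 0" "\<And>y. \<bar>y - x\<bar> < e \<Longrightarrow> \<bar>f y - f x\<bar> < \<bar>f x\<bar>"
    using assms unfolding continuous_at_eps_delta dist_real_def by (metis zero_less_abs_iff)
  have "S y = S x" if "\<bar>y - x\<bar> < e" for y
  proof -
    have "0 < f y \<longleftrightarrow> 0 < f x" using e(2)[OF that] by (cases "f x > 0") (auto simp: abs_less_iff)
    then show ?thesis by (simp add: S_def)
  qed
  then show ?thesis using that e(1) by blast
qed

lemma transition_points_eq: "transition_points X Vp S = {x \<in> {0..<X}. f x = 0}"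
proof
  show "transition_points X Vp S \<subseteq> {x \<in> {0..<X}. f x = 0}"
  proof
    fix x assume "x \<in> transition_points X Vp S"
    then obtain d where x: "x \<in> {0..<X}" and d: "d > 0"
      "((\<forall>y\<in>{x - d<..<x}. S y = 0) \<and> (\<forall>y\<in>{x<..<x + d}. S y = Vp)) \<or>
       ((\<forall>y\<in>{x - d<..<x}. S y = Vp) \<and> (\<forall>y\<in>{x<..<x + d}. S y = 0))" by (auto simp: transition_points_def)
    have "f x = 0"
    proof (rule ccontr)
      assume "f x \<noteq> 0"
      then obtain e where e: "e > 0" "\<And>y. \<bar>y - x\<bar> < e \<Longrightarrow> S y = S x" by (rule S_locally_const) blast
      define h where "h = min d e / 2"
      have h: "0 < h" "h < d" "h < e" using d(1) e(1) by (auto simp: h_def)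
      have "S (x - h) = S x" "S (x + h) = S x" using h by (auto intro!: e(2))
      moreover have "x - h \<in> {x - d<..<x}" "x + h \<in> {x<..<x + d}" using h by auto
      ultimately show False using d(2) Vp by fastforce
    qed
    then show "x \<in> {x \<in> {0..<X}. f x = 0}" using x by simp
  qed
  show "{x \<in> {0..<X}. f x = 0} \<subseteq> transition_points X Vp S"
  proof
    fix x assume x: "x \<in> {x \<in> {0..<X}. f x = 0}"
    define n where "n = - \<lfloor>(x - a 0) / X\<rfloor>"
    have "shift_to (a 0) x \<in> a ` {..<2 * m}" using shift_to[of "a 0" x] x unfolding zeros_base[symmetric] by simp
    then obtain i where i: "i < 2 * m" "x + of_int n * X = a i" by (auto simp: shift_to_def n_def)
    \<comment> \<open>Index of the interval to the left of the zero \<open>a i\<close>. For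
      \<open>i = 0\<close> it is the last interval, a period later, and \<open>c\<close> records
      that shift.\<close>
    define i' where "i' = (if i = 0 then 2 * m - 1 else i - 1)"
    define c where "c = (if i = 0 then 1 else 0 :: int)"
    have i': "Suc i' \<le> 2 * m" "a (Suc i') = a i + of_int c * X" "even i' \<longleftrightarrow> odd i"
      using i m fin by (auto simp: i'_def c_def)
    define d where "d = min (a (Suc i) - a i) (a (Suc i') - a i')"
    have d: "d > 0" using inc[OF i(1)] inc[of i'] i'(1) by (simp add: d_def)
    have right: "a i < y + of_int n * X \<and> y + of_int n * X < a (Suc i)" if "y \<in> {x<..<x + d}" for y
      using that i(2) by (auto simp: d_def algebra_simps)
    have left: "a i' < y + of_int (n + c) * X \<and> y + of_int (n + c) * X < a (Suc i')" if "y \<in> {x - d<..<x}" for y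
      using that i(2) i'(2) by (auto simp: d_def algebra_simps)
    have fr: "f y = f (y + of_int n * X)" "f y = f (y + of_int (n + c) * X)" for y unfolding per_int by simp_all
    show "x \<in> transition_points X Vp S"
    proof (cases "even i")
      case True
      then have "S y = Vp" if "y \<in> {x<..<x + d}" for y
        using sign_even[OF True] right[OF that] fr(1)[of y] by (simp add: S_def)
      moreover have "S y = 0" if "y \<in> {x - d<..<x}" for y
        using sign_odd[of i' "y + of_int (n + c) * X"] True i'(3) left[OF that] fr(2)[of y] by (simp add: S_def)
      ultimately show ?thesis using x d unfolding transition_points_def by blast
    next
      case False
      then have "S y = 0" if "y \<in> {x<..<x + d}" for y
        using sign_odd[OF False, of "y + of_int n * X"] right[OF that] fr(1)[of y] by (simp add: S_def)
      moreover have "S y = Vp" if "y \<in> {x - d<..<x}" for y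
        using sign_even[of i' "y + of_int (n + c) * X"] False i'(3) left[OF that] fr(2)[of y] by (simp add: S_def)
      ultimately show ?thesis using x d unfolding transition_points_def by blast
    qed
  qed
qed

lemma step_function_S: "step_function X Vp S"
  unfolding step_function_def
proof (intro conjI allI)
  show "S (x + X) = S x" for x by (simp add: S_def per)
  show "S x \<in> {0, Vp}" for x by (simp add: S_def)
  have "isCont S x" if nz: "f x \<noteq> 0" for x
  proof -
    obtain e where e: "e > 0" "\<And>y. \<bar>y - x\<bar> < e \<Longrightarrow> S y = S x" using nz by (rule S_locally_const) blast
    have "eventually (\<lambda>y. S y = S x) (nhds x)"
      unfolding eventually_nhds_metric dist_real_def
      by (intro exI[of _ e] conjI allI impI e)
    then show ?thesis using isCont_cong[of S "\<lambda>y. S x" x] by simp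
  qed
  then show "finite {x \<in> {0..<X}. \<not> isCont S x}"
    by (intro finite_subset[OF _ zeros_card(2)]) auto
qed

lemma alternating_S: "alternating_intervals X Vp m S"
  unfolding alternating_intervals_def
proof (intro exI[of _ a] conjI allI impI ballI)
  show "a j < a (j + 1)" if "j < 2 * m" for j using inc[OF that] by simp
  show "S x = Vp" if "j < m" "x \<in> {a (2 * j)<..<a (2 * j + 1)}" for j x using pos[of j x] that by (simp add: S_def)
  show "S x = 0" if "j < m" "x \<in> {a (2 * j + 1)<..<a (2 * j + 2)}" for j x using neg[of j x] that by (simp add: S_def)
qed (rule fin)

lemma AE_nonzero: "AE x in lebesgue. f x \<noteq> 0"
  using AE_completion[OF AE_not_in[OF countable_imp_null_set_lborel[OF zeros_countable]]] by simp

end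

text \<open>\<open>S\<close> takes the extreme value that the sign of \<open>f\<close> favours, so
  \<open>(S - V) * f\<close> is nowhere negative; a nonpositive integral makes it vanish almost
  everywhere in one period, and translation does the rest.\<close>

lemma (in hill) bang_bang:
  assumes S: "S \<in> borel_measurable borel" "\<And>x. S x \<in> {0..Vp}" "\<And>x. S (x + X) = S x"
    and f: "continuous_on UNIV f" "\<And>x. f (x + X) = f x"
    and pos: "\<And>x. f x > 0 \<Longrightarrow> S x = Vp" and neg: "\<And>x. f x < 0 \<Longrightarrow> S x = 0"
    and I: "integral {0..X} (\<lambda>x. (S x - V x) * f x) \<le> 0"
  shows "AE x in lebesgue. (S x - V x) * f x = 0"
proof -
  define g where "g x = (S x - V x) * f x" for x
  have nn: "g x \<ge> 0" for x
  proof (cases "f x" "0::real" rule: linorder_cases)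
    case less then show ?thesis using neg V0[of x] by (simp add: g_def mult_nonneg_nonpos mult_nonpos_nonpos)
  next
    case equal then show ?thesis by (simp add: g_def)
  next
    case greater then show ?thesis using pos V1[of x] by (simp add: g_def)
  qed
  have lb: "loc_bdd_meas (\<lambda>x. S x - V x)"
  proof (rule loc_bdd_meas_bdd)
    show "(\<lambda>x. S x - V x) \<in> borel_measurable borel" using S(1) Vm by measurable
    show "norm (S x - V x) \<le> Vp" for x using S(2)[of x] V0[of x] V1[of x] by (auto simp: abs_le_iff)
  qed
  have gm: "loc_bdd_meas g" unfolding g_def[abs_def] by (intro loc_bdd_meas_mult lb loc_bdd_meas_cont f)
  have si: "set_integrable lebesgue {0..X} g" by (rule loc_bdd_meas_set_integrable[OF gm])
  have "set_lebesgue_integral lebesgue {0..X} g \<le> 0"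
    using I unfolding set_lebesgue_integral_eq_integral(2)[OF si] by (simp add: g_def[abs_def])
  moreover have "set_lebesgue_integral lebesgue {0..X} g \<ge> 0"
    unfolding set_lebesgue_integral_def by (intro Bochner_Integration.integral_nonneg) (simp add: nn)
  ultimately have "integral\<^sup>L lebesgue (\<lambda>x. indicator {0..X} x *\<^sub>R g x) = 0" by (simp add: set_lebesgue_integral_def)
  then have "AE x in lebesgue. indicator {0..X} x *\<^sub>R g x = 0"
    using integral_nonneg_eq_0_iff_AE[of lebesgue "\<lambda>x. indicator {0..X} x *\<^sub>R g x"] si nn by (simp add: set_integrable_def)
  then have 1: "AE x in lebesgue. \<forall>n::int. indicator {0..X} (x + of_int n * X) *\<^sub>R g (x + of_int n * X) = 0"
    using AE_lebesgue_translate by (intro AE_all_countable[THEN iffD2]) blast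
  have gper: "g (x + of_int n * X) = g x" for x n
    by (rule periodic_int) (simp add: g_def S(3) f(2) Vper)
  have "AE x in lebesgue. g x = 0"
  proof (rule AE_mp[OF 1], intro AE_I2 impI)
    fix x assume h: "\<forall>n::int. indicator {0..X} (x + of_int n * X) *\<^sub>R g (x + of_int n * X) = 0"
    define n where "n = - \<lfloor>x / X\<rfloor>"
    have "of_int \<lfloor>x / X\<rfloor> * X \<le> x" using of_int_floor_le[of "x / X"] by (simp only: pos_le_divide_eq[OF X])
    moreover have "x < (of_int \<lfloor>x / X\<rfloor> + 1) * X"
      using real_of_int_floor_add_one_gt[of "x / X"] by (simp only: pos_divide_less_eq[OF X])
    ultimately have "x + of_int n * X \<in> {0..X}" by (simp add: n_def algebra_simps)
    then have "g (x + of_int n * X) = 0" using h[rule_format, of n] by simp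
    then show "g x = 0" by (simp add: gper)
  qed
  then show ?thesis by (simp add: g_def)
qed

theorem corollary2p11:
  fixes X Vp :: real and m :: nat and V :: "real \<Rightarrow> real"
  assumes "m \<ge> 1" and "X > 0" and "Vp > 0"
    and "local_maximizer X Vp m V"
    and "band_min X V m > band_max X V m"
  shows "\<exists>S. step_function X Vp S \<and> (AE x in lebesgue. V x = S x) \<and>
           card (transition_points X Vp S) = 2 * m \<and>
           alternating_intervals X Vp m S"
proof -
  note m = assms(1) and X = assms(2) and Vp = assms(3)
  have VA: "V \<in> admissible X Vp" using assms(4) by (simp add: local_maximizer_def)
  obtain \<epsilon> where \<epsilon>: "\<epsilon> > 0" "\<And>W. W \<in> admissible X Vp \<Longrightarrow> Linf_dist W V < ereal \<epsilon> \<Longrightarrow> gap_ratio X m W \<le> gap_ratio X m V"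
    using assms(4) by (auto simp: local_maximizer_def)
  obtain U where U: "hill X Vp U" "AE x in lebesgue. V x = U x"
    using admissible_hill_representative[OF X Vp VA] by blast
  interpret H: hill X Vp U by (rule U(1))
  let ?a = "H.alpha m" and ?b = "H.beta m"
  have gap: "?a < ?b" using assms(5) H.band_max_eq[OF m] H.band_min_eq by (simp add: band_cong_AE[OF U(2)])
  have ab: "?a > 0" "?b > 0" using H.alpha_pos[OF m] gap by auto
  obtain ta where ta: "H.disp ?a ta = real m * pi" using H.alpha(2)[OF m] by blast
  obtain tb' where tb': "H.disp ?b tb' = real m * pi" using H.beta(2) by blast
  have D4: "(H.D ?a)\<^sup>2 \<le> 4" "(H.D ?b)\<^sup>2 \<le> 4" using H.inband_D H.alpha_inband[OF m] H.beta_inband by blast+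
  obtain tb where tb: "H.disp ?b tb = real m * pi"
    "\<And>x. 0 < th (H.q ?b) tb x - th (H.q ?a) ta x" "\<And>x. th (H.q ?b) tb x - th (H.q ?a) ta x < pi"
    using H.edge_angles_separated[OF gap D4 ta tb'] by blast
  define Na where "Na = integral {0..X} (\<lambda>x. (ysol (H.q ?a) ta x)\<^sup>2)"
  define Nb where "Nb = integral {0..X} (\<lambda>x. (ysol (H.q ?b) tb x)\<^sup>2)"
  have N: "Na > 0" "Nb > 0" unfolding Na_def Nb_def by (rule H.ysol_sq_integral_pos)+
  have neg1: "((-1) ^ m * y)\<^sup>2 = y\<^sup>2" for y :: real by (simp add: power_mult_distrib flip: power_mult)
  interpret P: angle_pair X m "H.q ?a" "H.q ?b" ta tb "?a / Nb" "?b / Na"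
  proof
    show "th (H.q ?a) ta (x + X) = th (H.q ?a) ta x + real m * pi" for x by (rule H.edge_solution(1)[OF D4(1) ta])
    show "(ysol (H.q ?a) ta (x + X))\<^sup>2 = (ysol (H.q ?a) ta x)\<^sup>2" for x
      unfolding H.edge_solution(2)[OF D4(1) ta] by (rule neg1)
    show "(ysol (H.q ?b) tb (x + X))\<^sup>2 = (ysol (H.q ?b) tb x)\<^sup>2" for x
      unfolding H.edge_solution(2)[OF D4(2) tb(1)] by (rule neg1)
  qed (use X m tb ab N in auto)
  obtain a where a: "\<And>j. j < 2 * m \<Longrightarrow> a j < a (Suc j)" "a (2 * m) = a 0 + X"
    "\<And>j x. a (2 * j) < x \<Longrightarrow> x < a (2 * j + 1) \<Longrightarrow> P.f x > 0"
    "\<And>j x. a (2 * j + 1) < x \<Longrightarrow> x < a (2 * j + 2) \<Longrightarrow> P.f x < 0"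
    "\<And>j. P.f (a j) = 0" by (rule P.alternating_sequence) blast
  interpret C: sign_cycle X Vp m P.f a
    by unfold_locales (use X Vp m P.f_cont P.f_per a in auto)
  have Sm: "C.S \<in> borel_measurable borel"
  proof -
    have [measurable]: "P.f \<in> borel_measurable borel" by (rule borel_measurable_continuous_onI[OF P.f_cont])
    show ?thesis unfolding C.S_def[abs_def] by measurable
  qed
  have S01: "0 \<le> C.S x" "C.S x \<le> Vp" for x using Vp by (simp_all add: C.S_def)
  have Sper: "C.S (x + X) = C.S x" for x by (simp add: C.S_def P.f_per)
  \<comment> \<open>\<open>U + t * h\<close> is a convex combination of \<open>U\<close> and
    \<open>C.S\<close>, so the bounds persist for \<open>t\<close> up to \<open>1\<close>.\<close>
  define h where "h x = C.S x - U x" for x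
  have hb: "\<bar>h x\<bar> \<le> Vp" for x using S01[of x] H.V0[of x] H.V1[of x] by (auto simp: h_def abs_le_iff)
  have hm: "bdd_meas h"
  proof -
    have "h \<in> borel_measurable borel" unfolding h_def[abs_def] using Sm H.Vm by measurable
    then show ?thesis using hb by (auto simp: bdd_meas_def)
  qed
  have W: "hill X Vp (\<lambda>x. U x + t * h x)" if t: "0 < t" "t \<le> 1" for t
  proof
    show "(\<lambda>x. U x + t * h x) \<in> borel_measurable borel" using hm H.Vm by (auto simp: bdd_meas_def)
    show "U (x + X) + t * h (x + X) = U x + t * h x" for x by (simp add: h_def Sper H.Vper)
    have e: "U x + t * h x = (1 - t) * U x + t * C.S x" for x by (simp add: h_def algebra_simps)
    show "0 \<le> U x + t * h x" for x unfolding e using t S01[of x] H.V0[of x] by simp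
    have "(1 - t) * U x + t * C.S x \<le> (1 - t) * Vp + t * Vp" for x
      using t S01[of x] H.V1[of x] by (intro add_mono mult_left_mono) auto
    then show "U x + t * h x \<le> Vp" for x unfolding e by (simp add: algebra_simps)
  qed (rule X)
  have "integral {0..X} (\<lambda>x. h x * P.f x) \<le> 0"
  proof (rule ccontr)
    assume "\<not> ?thesis"
    then have "integral {0..X} (\<lambda>x. h x * (?a / Nb * (ysol (H.q ?b) tb x)\<^sup>2 - ?b / Na * (ysol (H.q ?a) ta x)\<^sup>2)) > 0"
      by (simp add: P.f_def)
    from H.gap_ratio_increases[OF m gap hm W ta tb(1) Na_def Nb_def this]
    obtain d where d: "d > 0" "\<And>t. 0 < t \<Longrightarrow> t < d \<Longrightarrow> gap_ratio X m U < gap_ratio X m (\<lambda>x. U x + t * h x)" by blast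
    \<comment> \<open>The last term keeps the competitor within \<open>\<epsilon>\<close> of
      \<open>V\<close>, as \<open>t * h\<close> is bounded by \<open>t * Vp\<close>; the factor
      \<open>2\<close> makes this strict.\<close>
    define t where "t = min (min 1 (d / 2)) (\<epsilon> / (2 * Vp))"
    have t: "0 < t" "t \<le> 1" "t < d" using d(1) \<epsilon>(1) Vp by (auto simp: t_def)
    have "t * Vp \<le> \<epsilon> / (2 * Vp) * Vp" using Vp by (intro mult_right_mono) (auto simp: t_def)
    then have tV: "t * Vp < \<epsilon>" using Vp \<epsilon>(1) by simp
    define Wt where "Wt x = U x + t * h x" for x
    interpret Wt: hill X Vp Wt unfolding Wt_def[abs_def] by (rule W[OF t(1,2)])
    have "Linf_dist Wt V \<le> ereal (t * Vp)" unfolding Linf_dist_def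
    proof (rule esssup_I)
      show "(\<lambda>x. ereal \<bar>Wt x - V x\<bar>) \<in> borel_measurable lebesgue"
        using VA Wt.hill_admissible by (auto simp: admissible_def)
      show "AE x in lebesgue. ereal \<bar>Wt x - V x\<bar> \<le> ereal (t * Vp)"
      proof (rule AE_mp[OF U(2)], intro AE_I2 impI)
        fix x assume "V x = U x"
        then have "\<bar>Wt x - V x\<bar> = t * \<bar>h x\<bar>" using t by (simp add: Wt_def abs_mult)
        also have "\<dots> \<le> t * Vp" using t hb by (intro mult_left_mono) auto
        finally show "ereal \<bar>Wt x - V x\<bar> \<le> ereal (t * Vp)" by simp
      qed
    qed
    also have "\<dots> < ereal \<epsilon>" using tV by simp
    finally have "gap_ratio X m Wt \<le> gap_ratio X m V" by (intro \<epsilon>(2) Wt.hill_admissible)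
    moreover have "gap_ratio X m U < gap_ratio X m Wt" using d(2)[OF t(1,3)] by (simp add: Wt_def[abs_def])
    ultimately show False by (simp add: band_cong_AE(3)[OF U(2)])
  qed
  then have "AE x in lebesgue. (C.S x - U x) * P.f x = 0"
    using S01 Vp by (intro H.bang_bang[OF Sm _ Sper P.f_cont P.f_per]) (auto simp: C.S_def h_def)
  \<comment> \<open>Off the countable zero set of \<open>P.f\<close> this factor can be
    cancelled.\<close>
  then have "AE x in lebesgue. V x = C.S x"
    using C.AE_nonzero U(2) by eventually_elim auto
  then show ?thesis
    using C.step_function_S C.alternating_S C.transition_points_eq C.zeros_card(1) by (intro exI[of _ C.S]) simp
qed

end
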